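(* Let $\alpha,\beta\in PSL_2\mathbb R=\mathrm{Isom}^+\mathbb H^2$ and $p\in\mathbb H^2$, and let $\tilde\alpha,\tilde\beta\in\widetilde{PSL_2\mathbb R}$ be any lifts of $\alpha,\beta$. If the pentagon $\mathcal P(\alpha,\beta;p)$ is nondegenerate and bounds an immersed disc, then $$\mathrm{Tw}\left([\tilde\alpha^{-1},\tilde\beta^{-1}],p\right)=\Delta[\mathcal P(\alpha,\beta;p)].$$
   Context: $\mathbb H^2$ is the oriented hyperbolic plane (curvature $-1$). $PSL_2\mathbb R$ is identified with $\mathrm{Isom}^+\mathbb H^2$ (acting on the left), and $\widetilde{PSL_2\mathbb R}$ is its universal covering group, whose elements are homotopy classes rel endpoints of paths $(g_t)_{t\in[0,1]}$ in $PSL_2\mathbb R$ with $g_0=1$; the image of such a class in $PSL_2\mathbb R$ is $g_1$. Commutators are $[x,y]=xyx^{-1}y^{-1}$; since the kernel of $\widetilde{PSL_2\mathbb R}\to PSL_2\mathbb R$ is central, $[\tilde\alpha^{-1},\tilde\beta^{-1}]$ does not depend on the choice of lifts. Twist at $y\in\mathbb H^2$: let $\tilde\gamma\in\widetilde{PSL_2\mathbb R}$ be represented by $(g_t)$, with image $\gamma=g_1$. Let $c:[0,1]\to\mathbb H^2$ be the constant speed (possibly constant) geodesic from $y$ to $\gamma(y)$. For a unit tangent vector $u$ at $y$, choose a path $\mathcal V:[0,1]\to UT\mathbb H^2$ of unit tangent vectors along $c$ (that is, $\mathcal V(t)$ is based at $c(t)$) which is homotopic rel endpoints in $UT\mathbb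 H^2$ to $t\mapsto Dg_t(u)$. Then $\mathrm{Tw}(\tilde\gamma,y)\in\mathbb R$ is the total change $\theta(1)-\theta(0)$ of a continuous determination $\theta(t)$ of the anticlockwise angle from the unit velocity vector of $c$ (if $c$ is constant: from a fixed unit tangent vector at $y$) to $\mathcal V(t)$. This is independent of choices. The pentagon $\mathcal P(\alpha,\beta;p)$ generated by $\alpha,\beta$ at $p$ is the closed geodesic pentagon in $\mathbb H^2$ obtained by joining the segments $$p\to\alpha^{-1}\beta^{-1}\alpha\beta p\to\beta p\to\alpha\beta p\to\beta^{-1}\alpha\beta p\to p.$$ It may in general intersect itself or have coinciding vertices. It is nondegenerate if all five segments have nonzero length. If it bounds an immersed disc, $\Delta[\mathcal P(\alpha,\beta;p)]$ is the signed hyperbolic area of that disc, the sign being determined by the boundary orientation given by the displayed order of vertices (positive if the boundary is traversed anticlockwise, i.e. with the disc on the left; negative if clockwise). *)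

theory Defs
  imports "HOL-Analysis.Analysis"
begin

section \<open>The group PSL(2,R) as a topological group\<close>

definition SL2 :: "(real^2^2) set" where
  "SL2 = {A. det A = 1}"

definition psl2_rel :: "real^2^2 \<Rightarrow> real^2^2 \<Rightarrow> bool" where
  "psl2_rel A B \<longleftrightarrow> A \<in> SL2 \<and> B \<in> SL2 \<and> (B = A \<or> B = - A)"

quotient_type psl2 = "real^2^2" / partial: psl2_rel
proof (rule part_equivpI)
  show "\<exists>A. psl2_rel A A"
    by (rule exI[of _ "mat 1"]) (simp add: psl2_rel_def SL2_def)
  show "symp psl2_rel" by (auto simp: symp_def psl2_rel_def)
  show "transp psl2_rel" by (auto simp: transp_def psl2_rel_def)
qed

text \<open>The inverse of a matrix of determinant one, as a polynomial expression in its entries.\<close>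

definition adj2 :: "real^2^2 \<Rightarrow> real^2^2" where
  "adj2 A = vector [vector [A$2$2, - A$1$2], vector [- A$2$1, A$1$1]]"

lemma adj2_nth [simp]:
  "adj2 A $ 1 $ 1 = A$2$2" "adj2 A $ 1 $ 2 = - A$1$2"
  "adj2 A $ 2 $ 1 = - A$2$1" "adj2 A $ 2 $ 2 = A$1$1"
  by (simp_all add: adj2_def)

lemma adj2_mult:
  assumes "A \<in> SL2" shows "adj2 A ** A = mat 1" "A ** adj2 A = mat 1"
  using assms
  by (simp_all add: vec_eq_iff forall_2 matrix_matrix_mult_def sum_2 SL2_def det_2 mat_def algebra_simps)

lemma SL2_mult: "A \<in> SL2 \<Longrightarrow> B \<in> SL2 \<Longrightarrow> A ** B \<in> SL2"
  by (simp add: SL2_def det_mul)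

lemma SL2_adj2: "A \<in> SL2 \<Longrightarrow> adj2 A \<in> SL2"
  by (simp add: SL2_def det_2 algebra_simps)

lemma SL2_uminus: "A \<in> SL2 \<Longrightarrow> - A \<in> SL2"
  by (simp add: SL2_def det_2)

lemma mat2_mult_uminus:
  "(- A) ** B = - (A ** (B :: real^2^2))" "A ** (- B) = - ((A :: real^2^2) ** B)"
  by (simp_all add: vec_eq_iff forall_2 matrix_matrix_mult_def sum_2)

lemma adj2_uminus: "adj2 (- A) = - adj2 A"
  by (simp add: vec_eq_iff forall_2)

instantiation psl2 :: "{one, times, inverse}"
begin
lift_definition one_psl2 :: psl2 is "mat 1"
  by (simp add: psl2_rel_def SL2_def)
lift_definition times_psl2 :: "psl2 \<Rightarrow> psl2 \<Rightarrow> psl2" is "(**)"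
  by (auto simp: psl2_rel_def SL2_mult mat2_mult_uminus)
lift_definition inverse_psl2 :: "psl2 \<Rightarrow> psl2" is adj2
  by (auto simp: psl2_rel_def SL2_adj2 adj2_uminus)
definition divide_psl2 :: "psl2 \<Rightarrow> psl2 \<Rightarrow> psl2" where
  "divide_psl2 g h = g * inverse h"
instance ..
end

instance psl2 :: monoid_mult
proof
  fix a b c :: psl2
  show "a * b * c = a * (b * c)"
    by transfer (auto simp: psl2_rel_def SL2_mult matrix_mul_assoc)
  show "1 * a = a" by transfer (auto simp: psl2_rel_def)
  show "a * 1 = a" by transfer (auto simp: psl2_rel_def)
qed

lemma psl2_inverse:
  fixes a :: psl2 shows "inverse a * a = 1" "a * inverse a = 1"
  by (transfer; auto simp: psl2_rel_def adj2_mult SL2_adj2 SL2_def)+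

text \<open>\<^typ>\<open>psl2\<close> carries the quotient topology from \<^const>\<open>SL2\<close>.\<close>

instantiation psl2 :: topological_space
begin
definition open_psl2 :: "psl2 set \<Rightarrow> bool" where
  "open_psl2 U \<longleftrightarrow> openin (top_of_set SL2) {A \<in> SL2. abs_psl2 A \<in> U}"
instance
proof
  show "open (UNIV :: psl2 set)" by (simp add: open_psl2_def)
next
  fix S T :: "psl2 set" assume "open S" "open T"
  moreover have "{A \<in> SL2. abs_psl2 A \<in> S \<inter> T} =
      {A \<in> SL2. abs_psl2 A \<in> S} \<inter> {A \<in> SL2. abs_psl2 A \<in> T}" by auto
  ultimately show "open (S \<inter> T)" by (simp add: open_psl2_def openin_Int)
next
  fix K :: "psl2 set set" assume K: "\<forall>S\<in>K. open S"
  have "{A \<in> SL2. abs_psl2 A \<in> \<Union>K} = \<Union> ((\<lambda>S. {A \<in> SL2. abs_psl2 A \<in> S}) ` K)" by auto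
  moreover have "openin (top_of_set SL2) \<dots>"
    by (rule openin_Union) (use K in \<open>auto simp only: open_psl2_def\<close>)
  ultimately show "open (\<Union>K)" by (simp only: open_psl2_def)
qed
end

lemma abs_psl2_eq_iff:
  assumes "A \<in> SL2" "B \<in> SL2" shows "abs_psl2 A = abs_psl2 B \<longleftrightarrow> B = A \<or> B = - A"
proof -
  have refl: "psl2_rel C C" if "C \<in> SL2" for C using that by (simp add: psl2_rel_def)
  have "abs_psl2 A = abs_psl2 B \<longleftrightarrow> psl2_rel A B"
    using Quotient_rel[OF Quotient_psl2, of A B] refl[OF assms(1)] refl[OF assms(2)] by blast
  then show ?thesis using assms unfolding psl2_rel_def by blast
qed

lemma psl2_cases:
  obtains A where "A \<in> SL2" "g = abs_psl2 A"
proof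
  show "rep_psl2 g \<in> SL2"
    using Quotient_rep_reflp[OF Quotient_psl2, of g] unfolding psl2_rel_def by blast
  show "g = abs_psl2 (rep_psl2 g)"
    using Quotient_abs_rep[OF Quotient_psl2, of g] by (rule sym)
qed

lemma times_psl2_abs:
  "A \<in> SL2 \<Longrightarrow> B \<in> SL2 \<Longrightarrow> abs_psl2 A * abs_psl2 B = abs_psl2 (A ** B)"
  by (rule times_psl2.abs_eq) (auto simp: psl2_rel_def)

lemma inverse_psl2_abs: "A \<in> SL2 \<Longrightarrow> inverse (abs_psl2 A) = abs_psl2 (adj2 A)"
  by (rule inverse_psl2.abs_eq) (auto simp: psl2_rel_def)

lemma open_image_abs_psl2:
  assumes "openin (top_of_set SL2) V" shows "open (abs_psl2 ` V)"
proof -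
  have VS: "V \<subseteq> SL2" using assms openin_imp_subset by blast
  obtain W where W: "open W" "V = SL2 \<inter> W" using assms by (auto simp: openin_open)
  have "{A \<in> SL2. abs_psl2 A \<in> abs_psl2 ` V} = SL2 \<inter> (W \<union> uminus ` W)"
  proof (intro set_eqI iffI)
    fix A assume "A \<in> {A \<in> SL2. abs_psl2 A \<in> abs_psl2 ` V}"
    then obtain B where B: "A \<in> SL2" "B \<in> V" "abs_psl2 A = abs_psl2 B" by blast
    then have "B = A \<or> B = - A" using VS abs_psl2_eq_iff by blast
    moreover have "A = - (- A)" by simp
    ultimately have "A \<in> W \<or> A \<in> uminus ` W" using B(2) W(2) by blast
    then show "A \<in> SL2 \<inter> (W \<union> uminus ` W)" using B(1) by blast
  next
    fix A assume A: "A \<in> SL2 \<inter> (W \<union> uminus ` W)"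
    then consider "A \<in> W" | "- A \<in> W" by fastforce
    then show "A \<in> {A \<in> SL2. abs_psl2 A \<in> abs_psl2 ` V}"
    proof cases
      case 1 then show ?thesis using A W(2) by blast
    next
      case 2
      then have "- A \<in> V" using A W(2) SL2_uminus by blast
      moreover have "abs_psl2 A = abs_psl2 (- A)"
        using A SL2_uminus abs_psl2_eq_iff by blast
      ultimately show ?thesis using A by blast
    qed
  qed
  moreover have "open (W \<union> uminus ` W)"
    using W(1) by (simp add: open_Un open_negations)
  ultimately show ?thesis by (auto simp: open_psl2_def openin_open)
qed

lemma continuous_on_mmult2: "continuous_on S (\<lambda>(A::real^2^2, B::real^2^2). A ** B)"
  unfolding matrix_matrix_mult_def case_prod_unfold by (intro continuous_intros)

lemma continuous_on_adj2: "continuous_on S adj2"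
proof -
  have "adj2 = (\<lambda>A. \<chi> i j. if i = 1 then if j = 1 then A$2$2 else - A$1$2
                    else if j = 1 then - A$2$1 else A$1$1)"
    by (rule ext) (simp add: vec_eq_iff forall_2)
  moreover have "continuous_on S \<dots>"
  proof (intro continuous_on_vec_lambda)
    fix i j :: 2
    show "continuous_on S (\<lambda>A. if i = 1 then if j = 1 then A$2$2 else - A$1$2
                    else if j = 1 then - A$2$1 else A$1$1)"
      by (cases "i = 1"; cases "j = 1"; simp; intro continuous_intros)
  qed
  ultimately show ?thesis by (simp only:)
qed

instance psl2 :: topological_semigroup_mult
proof
  fix a b :: psl2
  show "LIM x nhds a \<times>\<^sub>F nhds b. fst x * snd x :> nhds (a * b)"
    unfolding filterlim_iff
  proof (intro allI impI)
    fix P assume "\<forall>\<^sub>F x in nhds (a * b). P x"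
    then obtain U where U: "open U" "a * b \<in> U" "\<And>x. x \<in> U \<Longrightarrow> P x"
      unfolding eventually_nhds by blast
    obtain A where A: "A \<in> SL2" "a = abs_psl2 A" by (rule psl2_cases)
    obtain B where B: "B \<in> SL2" "b = abs_psl2 B" by (rule psl2_cases)
    note AB = A(1) B(1) A(2) B(2)
    obtain W where W: "open W" "{A \<in> SL2. abs_psl2 A \<in> U} = SL2 \<inter> W"
      using U(1) by (auto simp: open_psl2_def openin_open)
    have Wiff: "C \<in> W \<longleftrightarrow> abs_psl2 C \<in> U" if "C \<in> SL2" for C
      using W(2) that by blast
    have "abs_psl2 (A ** B) \<in> U"
      using U(2) unfolding AB(3,4) times_psl2_abs[OF AB(1,2)] .
    then have ABW: "(A, B) \<in> (\<lambda>(A::real^2^2, B::real^2^2). A ** B) -` W"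
      using Wiff[OF SL2_mult[OF AB(1,2)]] by simp
    have "open ((\<lambda>(A::real^2^2, B::real^2^2). A ** B) -` W)"
      by (rule open_vimage[OF W(1) continuous_on_mmult2])
    then obtain X Y where XY': "open X" "open Y" "(A, B) \<in> X \<times> Y"
        "X \<times> Y \<subseteq> (\<lambda>(A::real^2^2, B::real^2^2). A ** B) -` W"
      using ABW by (rule open_prod_elim)
    then have XY: "open X" "open Y" "A \<in> X" "B \<in> Y"
        "X \<times> Y \<subseteq> (\<lambda>(A::real^2^2, B::real^2^2). A ** B) -` W"
      by blast+
    let ?X = "abs_psl2 ` (SL2 \<inter> X)" and ?Y = "abs_psl2 ` (SL2 \<inter> Y)"
    have "open ?X" "open ?Y"
      by (rule open_image_abs_psl2, rule openin_open_Int, rule XY)+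
    moreover have "a \<in> ?X" "b \<in> ?Y"
      unfolding AB(3,4) by (rule imageI, rule IntI, rule AB, rule XY)+
    ultimately have "\<forall>\<^sub>F x in nhds a \<times>\<^sub>F nhds b. fst x \<in> ?X \<and> snd x \<in> ?Y"
      by (intro eventually_prodI eventually_nhds_in_open)
    moreover have "P (x * y)" if xy: "x \<in> ?X" "y \<in> ?Y" for x y
    proof -
      obtain A' where A': "x = abs_psl2 A'" "A' \<in> SL2 \<inter> X" using xy(1) by (rule imageE)
      obtain B' where B': "y = abs_psl2 B'" "B' \<in> SL2 \<inter> Y" using xy(2) by (rule imageE)
      have S: "A' \<in> SL2" "B' \<in> SL2" using A' B' by simp_all
      have "(A', B') \<in> X \<times> Y" using A' B' by simp
      then have "A' ** B' \<in> W" using XY(5) by (metis (no_types, lifting) case_prod_conv subsetD vimageD)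
      then have "abs_psl2 (A' ** B') \<in> U" using Wiff[OF SL2_mult[OF S]] by simp
      then show ?thesis unfolding A'(1) B'(1) times_psl2_abs[OF S] by (rule U(3))
    qed
    ultimately show "\<forall>\<^sub>F x in nhds a \<times>\<^sub>F nhds b. P (fst x * snd x)"
      by (elim eventually_mono) simp
  qed
qed

lemma continuous_on_inverse_psl2: "continuous_on UNIV (inverse :: psl2 \<Rightarrow> psl2)"
  unfolding continuous_on_open_vimage[OF open_UNIV] Int_UNIV_right
proof (intro allI impI)
  fix U :: "psl2 set" assume "open U"
  then obtain W where W: "open W" "{A \<in> SL2. abs_psl2 A \<in> U} = SL2 \<inter> W"
    by (auto simp: open_psl2_def openin_open)
  have Wiff: "abs_psl2 C \<in> U \<longleftrightarrow> C \<in> W" if "C \<in> SL2" for C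
    using W(2) that by blast
  have "inverse (abs_psl2 A) \<in> U \<longleftrightarrow> adj2 A \<in> W" if "A \<in> SL2" for A
    unfolding inverse_psl2_abs[OF that] by (rule Wiff[OF SL2_adj2[OF that]])
  then have eq: "{A \<in> SL2. abs_psl2 A \<in> inverse -` U} = SL2 \<inter> adj2 -` W"
    by (intro set_eqI) (simp cong: conj_cong)
  have "open (adj2 -` W)" by (rule open_vimage[OF W(1) continuous_on_adj2])
  then show "open (inverse -` U)"
    unfolding open_psl2_def eq by (rule openin_open_Int)
qed


section \<open>The universal covering group\<close>

definition psl2_path_rel :: "(real \<Rightarrow> psl2) \<Rightarrow> (real \<Rightarrow> psl2) \<Rightarrow> bool" where
  "psl2_path_rel g h \<longleftrightarrow> pathstart g = 1 \<and> homotopic_paths UNIV g h"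

quotient_type psl2_cover = "real \<Rightarrow> psl2" / partial: psl2_path_rel
proof (rule part_equivpI)
  show "\<exists>g. psl2_path_rel g g"
    by (rule exI[of _ "\<lambda>_. 1"]) (simp add: psl2_path_rel_def pathstart_def path_def)
  show "symp psl2_path_rel"
    unfolding symp_def psl2_path_rel_def
    by (metis homotopic_paths_sym homotopic_paths_imp_pathstart)
  show "transp psl2_path_rel"
    unfolding transp_def psl2_path_rel_def by (metis homotopic_paths_trans)
qed

lemma psl2_inverse_one: "inverse (1 :: psl2) = 1"
  by (metis psl2_inverse(1) mult_1_right)

lemma psl2_path_rel_times:
  assumes "psl2_path_rel g g'" "psl2_path_rel h h'"
  shows "psl2_path_rel (\<lambda>t. g t * h t) (\<lambda>t. g' t * h' t)"
proof -
  have g: "homotopic_paths UNIV g g'" and h: "homotopic_paths UNIV h h'"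
    and 1: "g 0 * h 0 = 1"
    using assms by (simp_all add: psl2_path_rel_def pathstart_def)
  from g[unfolded homotopic_paths] obtain k where
    k: "continuous_on ({0..1} \<times> {0..1}) k"
      "\<forall>x\<in>{0..1}. k (0, x) = g x" "\<forall>x\<in>{0..1}. k (1, x) = g' x"
      "\<forall>t\<in>{0..1::real}. pathstart (k \<circ> Pair t) = pathstart g \<and> pathfinish (k \<circ> Pair t) = pathfinish g"
    by (elim exE conjE)
  from h[unfolded homotopic_paths] obtain l where
    l: "continuous_on ({0..1} \<times> {0..1}) l"
      "\<forall>x\<in>{0..1}. l (0, x) = h x" "\<forall>x\<in>{0..1}. l (1, x) = h' x"
      "\<forall>t\<in>{0..1::real}. pathstart (l \<circ> Pair t) = pathstart h \<and> pathfinish (l \<circ> Pair t) = pathfinish h"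
    by (elim exE conjE)
  have "homotopic_paths UNIV (\<lambda>t. g t * h t) (\<lambda>t. g' t * h' t)"
    unfolding homotopic_paths
  proof (intro exI[of _ "\<lambda>x. k x * l x"] conjI)
    show "continuous_on ({0..1} \<times> {0..1}) (\<lambda>x. k x * l x)"
      by (rule continuous_on_mult'[OF k(1) l(1)])
  qed (use k(2-) l(2-) in \<open>simp_all add: pathstart_def pathfinish_def\<close>)
  with 1 show ?thesis by (simp add: psl2_path_rel_def pathstart_def)
qed

lemma psl2_path_rel_inverse:
  assumes "psl2_path_rel g g'"
  shows "psl2_path_rel (\<lambda>t. inverse (g t)) (\<lambda>t. inverse (g' t))"
proof -
  have "homotopic_paths UNIV (inverse \<circ> g) (inverse \<circ> g')"
    by (rule homotopic_paths_continuous_image[of UNIV])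
      (use assms in \<open>auto simp: psl2_path_rel_def continuous_on_inverse_psl2\<close>)
  with assms show ?thesis
    by (simp add: psl2_path_rel_def pathstart_def psl2_inverse_one o_def)
qed

instantiation psl2_cover :: "{one, times, inverse}"
begin
lift_definition one_psl2_cover :: psl2_cover is "\<lambda>_. 1"
  by (simp add: psl2_path_rel_def pathstart_def path_def)
lift_definition times_psl2_cover :: "psl2_cover \<Rightarrow> psl2_cover \<Rightarrow> psl2_cover"
  is "\<lambda>g h t. g t * h t" by (rule psl2_path_rel_times)
lift_definition inverse_psl2_cover :: "psl2_cover \<Rightarrow> psl2_cover"
  is "\<lambda>g t. inverse (g t)" by (rule psl2_path_rel_inverse)
definition divide_psl2_cover :: "psl2_cover \<Rightarrow> psl2_cover \<Rightarrow> psl2_cover" where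
  "divide_psl2_cover G H = G * inverse H"
instance ..
end

definition represents :: "(real \<Rightarrow> psl2) \<Rightarrow> psl2_cover \<Rightarrow> bool" where
  "represents g G \<longleftrightarrow> path g \<and> pathstart g = 1 \<and> abs_psl2_cover g = G"

definition cover_proj :: "psl2_cover \<Rightarrow> psl2" where
  "cover_proj G = pathfinish (rep_psl2_cover G)"

lemma cover_proj_represents:
  assumes "represents g G" shows "cover_proj G = g 1"
proof -
  have "psl2_path_rel g g" using assms by (simp add: represents_def psl2_path_rel_def)
  then have "psl2_path_rel (rep_psl2_cover G) g"
    using assms Quotient3_psl2_cover rep_abs_rsp_left represents_def by metis
  then show ?thesis
    by (auto simp: cover_proj_def psl2_path_rel_def pathfinish_def
        dest: homotopic_paths_imp_pathfinish)
qed

definition comm :: "'a::{times, inverse} \<Rightarrow> 'a \<Rightarrow> 'a" where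
  "comm x y = x * y * inverse x * inverse y"


section \<open>The hyperbolic plane: upper half-plane model\<close>

definition H2 :: "complex set" where
  "H2 = {z. Im z > 0}"

definition hdist :: "complex \<Rightarrow> complex \<Rightarrow> real" where
  "hdist z w = arcosh (1 + (cmod (z - w))\<^sup>2 / (2 * Im z * Im w))"

lift_definition act :: "psl2 \<Rightarrow> complex \<Rightarrow> complex" is
  "\<lambda>A z. (of_real (A$1$1) * z + of_real (A$1$2)) / (of_real (A$2$1) * z + of_real (A$2$2))"
proof -
  have neg: "(- x * z + - y) / (- u * z + - v) = (x * z + y) / (u * z + v)" for x y u v z :: complex
  proof -
    have "- x * z + - y = - (x * z + y)" "- u * z + - v = - (u * z + v)" by simp_all
    then show ?thesis by (simp only: minus_divide_divide)
  qed
  show "psl2_rel A B \<Longrightarrow>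
    (\<lambda>z. (of_real (A$1$1) * z + of_real (A$1$2)) / (of_real (A$2$1) * z + of_real (A$2$2)) :: complex) =
    (\<lambda>z. (of_real (B$1$1) * z + of_real (B$1$2)) / (of_real (B$2$1) * z + of_real (B$2$2)))" for A B
    using neg by (auto simp: psl2_rel_def fun_eq_iff)
qed

text \<open>The hyperbolic norm of a tangent vector \<open>v\<close> at \<open>z\<close> is \<open>|v| / Im z\<close>.\<close>

definition UTH2 :: "(complex \<times> complex) set" where
  "UTH2 = {(z, v). z \<in> H2 \<and> cmod v = Im z}"

definition tangent_act :: "psl2 \<Rightarrow> complex \<times> complex \<Rightarrow> complex \<times> complex" where
  "tangent_act g = (\<lambda>(z, v). (act g z, deriv (act g) z * v))"

definition geodesic_from_to :: "complex \<Rightarrow> complex \<Rightarrow> (real \<Rightarrow> complex) \<Rightarrow> bool" where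
  "geodesic_from_to y z c \<longleftrightarrow> c ` {0..1} \<subseteq> H2 \<and> c 0 = y \<and> c 1 = z \<and>
     (\<forall>s\<in>{0..1}. \<forall>t\<in>{0..1}. hdist (c s) (c t) = \<bar>s - t\<bar> * hdist y z)"

text \<open>This choice concerns only the values outside \<open>[0,1]\<close>: on \<open>[0,1]\<close> the constant speed
  geodesic between two points of the hyperbolic plane is unique.\<close>

definition geodesic :: "complex \<Rightarrow> complex \<Rightarrow> real \<Rightarrow> complex" where
  "geodesic y z = (SOME c. geodesic_from_to y z c)"


section \<open>The twist\<close>

text \<open>The half-plane metric is conformal and the orientation is that of \<^typ>\<open>complex\<close>, so
  anticlockwise angles between tangent vectors are differences of complex arguments. In
  \<open>ref_direction c e t\<close> a tangent vector at \<open>c t\<close> is normalised to euclidean length one; the fixed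
  vector \<open>e\<close> is only used for a constant geodesic.\<close>

definition ref_direction :: "(real \<Rightarrow> complex) \<Rightarrow> complex \<Rightarrow> real \<Rightarrow> complex" where
  "ref_direction c e t = (if c 0 = c 1 then sgn e
     else sgn (vector_derivative c (at t within {0..1})))"

definition twist_witness :: "psl2_cover \<Rightarrow> complex \<Rightarrow> real \<Rightarrow> bool" where
  "twist_witness G y \<tau> \<longleftrightarrow> (\<exists>g c u V e \<theta>.
     represents g G \<and>
     geodesic_from_to y (act (cover_proj G) y) c \<and>
     (y, u) \<in> UTH2 \<and> (y, e) \<in> UTH2 \<and>
     homotopic_paths UTH2 V (\<lambda>t. tangent_act (g t) (y, u)) \<and>
     (\<forall>t\<in>{0..1}. fst (V t) = c t) \<and>
     continuous_on {0..1} \<theta> \<and>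
     (\<forall>t\<in>{0..1}. snd (V t) = of_real (Im (c t)) * cis (\<theta> t) * ref_direction c e t) \<and>
     \<tau> = \<theta> 1 - \<theta> 0)"

definition Tw :: "psl2_cover \<Rightarrow> complex \<Rightarrow> real" where
  "Tw G y = (THE \<tau>. twist_witness G y \<tau>)"


section \<open>The pentagon\<close>

definition pentagon_vertices :: "psl2 \<Rightarrow> psl2 \<Rightarrow> complex \<Rightarrow> complex list" where
  "pentagon_vertices \<alpha> \<beta> p =
     [p, act (inverse \<alpha> * inverse \<beta> * \<alpha> * \<beta>) p, act \<beta> p, act (\<alpha> * \<beta>) p,
      act (inverse \<beta> * \<alpha> * \<beta>) p]"

definition pentagon_nondegenerate :: "psl2 \<Rightarrow> psl2 \<Rightarrow> complex \<Rightarrow> bool" where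
  "pentagon_nondegenerate \<alpha> \<beta> p \<longleftrightarrow> (let v = pentagon_vertices \<alpha> \<beta> p in
     \<forall>i<5. hdist (v ! i) (v ! (Suc i mod 5)) \<noteq> 0)"

definition pentagon :: "psl2 \<Rightarrow> psl2 \<Rightarrow> complex \<Rightarrow> real \<Rightarrow> complex" where
  "pentagon \<alpha> \<beta> p = (let v = pentagon_vertices \<alpha> \<beta> p in
     geodesic (v!0) (v!1) +++ geodesic (v!1) (v!2) +++ geodesic (v!2) (v!3) +++
     geodesic (v!3) (v!4) +++ geodesic (v!4) (v!0))"


section \<open>Immersed discs and their signed area\<close>

definition jacobian :: "(complex \<Rightarrow> complex) \<Rightarrow> complex \<Rightarrow> real" where
  "jacobian f z = (let D = frechet_derivative f (at z) in
     Re (D 1) * Im (D \<i>) - Re (D \<i>) * Im (D 1))"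

text \<open>The closed disc is immersed as a \<open>C\<^sup>1\<close> immersion of its interior. On the boundary, where the
  image has corners, being an immersion means being locally injective.\<close>

definition immersed_disc :: "(complex \<Rightarrow> complex) \<Rightarrow> bool" where
  "immersed_disc f \<longleftrightarrow>
     continuous_on (cball 0 1) f \<and> f ` cball 0 1 \<subseteq> H2 \<and>
     (\<forall>z\<in>ball 0 1. f differentiable (at z) \<and> jacobian f z \<noteq> 0) \<and>
     (\<forall>v. continuous_on (ball 0 1) (\<lambda>z. frechet_derivative f (at z) v)) \<and>
     (\<forall>z\<in>cball 0 1. \<exists>r>0. inj_on f (cball 0 1 \<inter> ball z r))"

text \<open>The anticlockwise unit circle is sent to the loop \<open>L\<close>, traversed in its own direction;
  \<open>f\<close> itself may preserve or reverse orientation.\<close>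

definition disc_boundary :: "(complex \<Rightarrow> complex) \<Rightarrow> (real \<Rightarrow> complex) \<Rightarrow> bool" where
  "disc_boundary f L \<longleftrightarrow> (\<exists>\<phi>. continuous_on {0..1} \<phi> \<and> strict_mono_on {0..1} \<phi> \<and>
     \<phi> 0 = 0 \<and> \<phi> 1 = (1::real) \<and> (\<forall>t\<in>{0..1}. f (cis (2 * pi * t)) = L (\<phi> t)))"

text \<open>The integral over the disc of the pullback of the hyperbolic area form
  \<open>dx dy / y\<^sup>2\<close>: the area in the pulled back metric, with the sign of the (constant)
  orientation of \<open>f\<close>.\<close>

definition signed_area :: "(complex \<Rightarrow> complex) \<Rightarrow> real" where
  "signed_area f = integral (ball 0 1) (\<lambda>z. jacobian f z / (Im (f z))\<^sup>2)"

end

theory Submission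
  imports Defs "HOL-Complex_Analysis.Riemann_Mapping"
begin

text \<open>Write \<open>\<omega> = dx / y\<close> on the upper half-plane. Two properties of this form carry everything:
\<open>d\<omega> = dx \<and> dy / y\<^sup>2\<close> is the area form, and along a geodesic the euclidean angle of the velocity
changes by \<open>- \<integral>\<omega>\<close>. So \<open>\<omega>\<close> measures how parallel transport turns against the euclidean
directions, and the theorem becomes a comparison of both sides with the integral of \<open>\<omega>\<close> around the
pentagon.

Twist side. Reading all angles as euclidean ones, the twist of a path \<open>g\<^sub>t\<close> at \<open>y\<close> is the change of the
argument of the derivative of \<open>g\<^sub>t\<close> at \<open>y\<close>, plus \<open>\<integral>\<omega>\<close> over the segment from \<open>y\<close> to its image
(\<open>Tw_eq\<close>). For the commutator the chain rule writes this derivative as a product of two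
quotients \<open>a\<^sub>t'(w) / a\<^sub>t'(w')\<close> and \<open>b\<^sub>t'(w) / b\<^sub>t'(w')\<close>. Since \<open>g'(z) = (c z + d)\<^sup>-\<^sup>2\<close> and the ratio of two
values of \<open>c z + d\<close> is never a negative number or zero, the principal logarithm gives an
argument of such a quotient that is continuous in all data; it is called \<open>turn\<close> below. The twist of
the commutator is thus \<open>\<integral>\<omega>\<close> over the first side of the pentagon plus one \<open>turn\<close> of \<open>\<alpha>\<close> and one of \<open>\<beta>\<close>
(\<open>Tw_commutator\<close>), whatever the lifts are.

Pentagon side. An isometry \<open>g\<close> does not preserve \<open>\<omega>\<close>, but \<open>g\<^sup>*\<omega> - \<omega>\<close> is exact, and its integral along a
curve is the \<open>turn\<close> of \<open>g\<close> between the end points (\<open>C1_turning_act\<close>). The isometry \<open>\<alpha>\<close> carries the reversed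
second side of the pentagon to the fourth one, and \<open>\<beta>\<close> carries the reversed fifth side to the third one.
The integrals over these four sides cancel up to the same two turns, so the twist is the integral of
\<open>\<omega>\<close> around the whole pentagon (\<open>pentagon_turn\<close>).

Area side. What remains is Stokes' theorem \<open>\<integral>\<^sub>D f\<^sup>*d\<omega> = \<integral>\<^sub>\<partial>\<^sub>D f\<^sup>*\<omega>\<close> (\<open>area_eq_boundary_integral\<close>). The map \<open>f\<close> is \<open>C\<^sup>1\<close>
only inside the disc, and nothing bounds its derivatives near the circle. Therefore the density
\<open>1 / y\<^sup>2\<close> is first replaced by continuous densities \<open>q\<close> vanishing near the boundary curve. With
\<open>V(x, y) = \<integral>\<^sub>0\<^sup>y q(x, s) ds\<close> the form \<open>- V dx\<close> is a primitive of \<open>q dx \<and> dy\<close>. It is discretised on a fine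
square grid. Cells near the circle contribute exactly zero, because only the values of \<open>q\<close>
around the image of the cell matter; the other cells lie in a compact part of the disc, where
uniform differentiability shows that a cell contributes its share of \<open>\<integral> q(f) det Df\<close> up to a small
error. Edges of neighbouring cells cancel, and the edges on the boundary converge to \<open>- \<integral> V dx\<close> along the
curve (\<open>green_cutoff\<close>). Finally \<open>q\<close> increases to \<open>1 / y\<^sup>2\<close>: the integrals over the disc converge
monotonically because the jacobian has constant sign, and those along the pentagon by dominated
convergence because almost all vertical lines meet it in finitely many points.\<close>

section \<open>Orientation preserving isometries of the half-plane\<close>

text \<open>The factor \<open>c z + d\<close> of a matrix, for which \<open>g'(z) = (c z + d)\<^sup>-\<^sup>2\<close>.\<close>

definition denom :: "real^2^2 \<Rightarrow> complex \<Rightarrow> complex" where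
  "denom A z = of_real (A$2$1) * z + of_real (A$2$2)"

lemma psl2_rel_refl: "A \<in> SL2 \<Longrightarrow> psl2_rel A A"
  by (simp add: psl2_rel_def)

lemma act_abs:
  "A \<in> SL2 \<Longrightarrow> act (abs_psl2 A) z = (of_real (A$1$1) * z + of_real (A$1$2)) / denom A z"
  by (simp add: act.abs_eq psl2_rel_refl denom_def)

lemma SL2_det: "A \<in> SL2 \<Longrightarrow> A$1$1 * A$2$2 - A$1$2 * A$2$1 = 1"
  by (simp add: SL2_def det_2)

lemma denom_nonzero:
  assumes "A \<in> SL2" "z \<in> H2" shows "denom A z \<noteq> 0"
proof
  assume "denom A z = 0"
  then have "Im (denom A z) = 0" "Re (denom A z) = 0" by simp_all
  then have "A$2$1 = 0" "A$2$2 = 0" using assms(2) by (auto simp: denom_def H2_def)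
  then show False using SL2_det[OF assms(1)] by simp
qed

lemma act_num:
  assumes "A \<in> SL2" "z \<in> H2"
  shows "of_real (A$1$1) * z + of_real (A$1$2) = act (abs_psl2 A) z * denom A z"
  using denom_nonzero[OF assms] by (simp add: act_abs[OF assms(1)])

lemma Im_act:
  assumes "A \<in> SL2" "z \<in> H2"
  shows "Im (act (abs_psl2 A) z) = Im z / (cmod (denom A z))\<^sup>2"
proof -
  have "Im ((of_real (A$1$1) * z + of_real (A$1$2)) * cnj (denom A z)) = (A$1$1 * A$2$2 - A$1$2 * A$2$1) * Im z"
    by (simp add: denom_def algebra_simps)
  then show ?thesis
    unfolding act_abs[OF assms(1)] SL2_det[OF assms(1)] complex_div_cnj[of _ "denom A z"]
    by (simp add: Im_divide_of_real flip: of_real_power)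
qed

lemma act_H2: "z \<in> H2 \<Longrightarrow> act g z \<in> H2"
proof -
  assume z: "z \<in> H2"
  obtain A where A: "A \<in> SL2" "g = abs_psl2 A" by (rule psl2_cases)
  then show ?thesis using z denom_nonzero[OF A(1) z] by (simp add: H2_def Im_act)
qed

lemma denom_mult:
  assumes "A \<in> SL2" "B \<in> SL2" "z \<in> H2"
  shows "denom (A ** B) z = denom A (act (abs_psl2 B) z) * denom B z"
proof -
  have "denom A (act (abs_psl2 B) z) * denom B z
      = of_real (A$2$1) * (of_real (B$1$1) * z + of_real (B$1$2)) + of_real (A$2$2) * denom B z"
    unfolding act_num[OF assms(2,3)] by (simp add: denom_def algebra_simps)
  then show ?thesis by (simp add: denom_def matrix_matrix_mult_def sum_2 algebra_simps)
qed

lemma act_mult: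
  assumes z: "z \<in> H2" shows "act (g * h) z = act g (act h z)"
proof -
  obtain A where A: "A \<in> SL2" "g = abs_psl2 A" by (rule psl2_cases)
  obtain B where B: "B \<in> SL2" "h = abs_psl2 B" by (rule psl2_cases)
  note AB = SL2_mult[OF A(1) B(1)]
  have Bz: "act h z \<in> H2" by (rule act_H2[OF z])
  have "act (g * h) z * denom (A ** B) z = of_real ((A ** B)$1$1) * z + of_real ((A ** B)$1$2)"
    using act_num[OF AB z] by (simp add: A(2) B(2) times_psl2_abs[OF A(1) B(1)])
  also have "\<dots> = of_real (A$1$1) * (of_real (B$1$1) * z + of_real (B$1$2)) + of_real (A$1$2) * denom B z"
    by (simp add: denom_def matrix_matrix_mult_def sum_2 algebra_simps)
  also have "\<dots> = (of_real (A$1$1) * act h z + of_real (A$1$2)) * denom B z"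
    unfolding act_num[OF B(1) z] B(2)[symmetric] by (simp add: algebra_simps)
  also have "\<dots> = act g (act h z) * denom (A ** B) z"
    using act_num[OF A(1) Bz] denom_mult[OF A(1) B(1) z] by (simp add: A(2) B(2))
  finally show ?thesis using denom_nonzero[OF AB z] by simp
qed

lemma mat_1_SL2: "mat 1 \<in> SL2" by (simp add: SL2_def)

lemma one_psl2_abs: "1 = abs_psl2 (mat 1)"
  by (simp add: one_psl2_def)

lemma act_one: "act 1 z = z"
  unfolding one_psl2_abs act_abs[OF mat_1_SL2] denom_def by (simp add: mat_def)

lemma act_inverse:
  assumes "z \<in> H2" shows "act (inverse g) (act g z) = z" "act g (act (inverse g) z) = z"
  using act_mult[OF assms, of "inverse g" g] act_mult[OF assms, of g "inverse g"]
  by (simp_all add: psl2_inverse act_one)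

lemma act_inj: "z \<in> H2 \<Longrightarrow> w \<in> H2 \<Longrightarrow> act g z = act g w \<longleftrightarrow> z = w"
  using act_inverse(1) by metis

lemma inverse_inverse_psl2: "inverse (inverse g) = (g :: psl2)"
proof -
  have "inverse (inverse g) = inverse (inverse g) * (inverse g * g)" by (simp add: psl2_inverse)
  also have "\<dots> = inverse (inverse g) * inverse g * g" by (rule mult.assoc[symmetric])
  also have "\<dots> = g" by (simp only: psl2_inverse mult_1_left)
  finally show ?thesis .
qed

lemma act_has_field_derivative:
  assumes A: "A \<in> SL2" and z: "z \<in> H2"
  shows "(act (abs_psl2 A) has_field_derivative 1 / (denom A z)\<^sup>2) (at z)"
proof -
  have nz: "of_real (A$2$1) * z + of_real (A$2$2) \<noteq> 0" using denom_nonzero[OF A z] by (simp add: denom_def)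
  have "((\<lambda>z. (of_real (A$1$1) * z + of_real (A$1$2)) / (of_real (A$2$1) * z + of_real (A$2$2)))
      has_field_derivative 1 / (denom A z)\<^sup>2) (at z)"
  proof (rule derivative_eq_intros refl | rule nz)+
    have "of_real (A$1$1 * A$2$2 - A$1$2 * A$2$1) = (1::complex)" by (simp add: SL2_det[OF A])
    then have "of_real (A$1$1) * of_real (A$2$2) = 1 + of_real (A$1$2) * (of_real (A$2$1) :: complex)"
      by (simp add: algebra_simps)
    then show "((0 * z + 1 * of_real (A$1$1) + 0) * (of_real (A$2$1) * z + of_real (A$2$2))
       - (of_real (A$1$1) * z + of_real (A$1$2)) * (0 * z + 1 * of_real (A$2$1) + 0)) /
      ((of_real (A$2$1) * z + of_real (A$2$2)) * (of_real (A$2$1) * z + of_real (A$2$2))) = 1 / (denom A z)\<^sup>2"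
      by (simp add: denom_def power2_eq_square algebra_simps)
  qed
  then show ?thesis unfolding act_abs[OF A] denom_def .
qed

lemma deriv_act: "A \<in> SL2 \<Longrightarrow> z \<in> H2 \<Longrightarrow> deriv (act (abs_psl2 A)) z = 1 / (denom A z)\<^sup>2"
  by (rule DERIV_imp_deriv[OF act_has_field_derivative])

lemma has_field_derivative_act: "z \<in> H2 \<Longrightarrow> (act g has_field_derivative deriv (act g) z) (at z)"
  by (metis act_has_field_derivative deriv_act psl2_cases)

lemma deriv_act_nonzero: "z \<in> H2 \<Longrightarrow> deriv (act g) z \<noteq> 0"
  by (metis deriv_act denom_nonzero psl2_cases divide_eq_0_iff power_eq_0_iff zero_neq_one)

lemma norm_deriv_act: "z \<in> H2 \<Longrightarrow> cmod (deriv (act g) z) = Im (act g z) / Im z"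
proof -
  assume z: "z \<in> H2"
  obtain A where A: "A \<in> SL2" "g = abs_psl2 A" by (rule psl2_cases)
  show ?thesis using z unfolding A(2) deriv_act[OF A(1) z] Im_act[OF A(1) z]
    by (simp add: H2_def norm_divide norm_power)
qed

lemma deriv_act_mult:
  assumes z: "z \<in> H2"
  shows "deriv (act (g * h)) z = deriv (act g) (act h z) * deriv (act h) z"
proof -
  obtain A where A: "A \<in> SL2" "g = abs_psl2 A" by (rule psl2_cases)
  obtain B where B: "B \<in> SL2" "h = abs_psl2 B" by (rule psl2_cases)
  show ?thesis
    using deriv_act[OF SL2_mult[OF A(1) B(1)] z] deriv_act[OF A(1) act_H2[OF z], of h] deriv_act[OF B(1) z]
    by (simp add: A(2) B(2) times_psl2_abs[OF A(1) B(1)] denom_mult[OF A(1) B(1) z] power_mult_distrib)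
qed

lemma deriv_act_one: "z \<in> H2 \<Longrightarrow> deriv (act 1) z = 1"
  unfolding one_psl2_abs by (subst deriv_act[OF mat_1_SL2]) (simp_all add: denom_def mat_def)

lemma deriv_act_inverse:
  assumes "z \<in> H2" shows "deriv (act (inverse g)) (act g z) = 1 / deriv (act g) z"
  using deriv_act_mult[OF assms, of "inverse g" g] deriv_act_nonzero[OF assms, of g]
  by (simp add: psl2_inverse deriv_act_one[OF assms] field_simps)

text \<open>A matrix is determined by the isometry up to sign only, so \<open>c z + d\<close> is not a function of the
isometry; the ratio of two of its values is.\<close>

lift_definition denom_ratio :: "psl2 \<Rightarrow> complex \<Rightarrow> complex \<Rightarrow> complex" is
  "\<lambda>A w w'. denom A w' / denom A w"
proof -
  have "denom (- A) w = - denom A w" for A w by (simp add: denom_def)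
  then show "psl2_rel A B \<Longrightarrow> (\<lambda>w w'. denom A w' / denom A w) = (\<lambda>w w'. denom B w' / denom B w)" for A B
    by (auto simp: psl2_rel_def fun_eq_iff)
qed

lemma denom_ratio_abs: "A \<in> SL2 \<Longrightarrow> denom_ratio (abs_psl2 A) w w' = denom A w' / denom A w"
  by (simp add: denom_ratio.abs_eq psl2_rel_refl)

lemma denom_ratio_one: "denom_ratio 1 w w' = 1"
  unfolding one_psl2_abs denom_ratio_abs[OF mat_1_SL2] denom_def by (simp add: mat_def)

text \<open>For \<open>c \<noteq> 0\<close> both values of \<open>c z + d\<close> lie in the same open half-plane, bounded by the real axis.
If one were a nonpositive multiple of the other, comparing imaginary parts would force \<open>c = 0\<close>.\<close>

lemma denom_ratio_not_nonpos:
  assumes "w \<in> H2" "w' \<in> H2" shows "denom_ratio g w w' \<notin> \<real>\<^sub>\<le>\<^sub>0"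
proof
  obtain A where A: "A \<in> SL2" "g = abs_psl2 A" by (rule psl2_cases)
  assume "denom_ratio g w w' \<in> \<real>\<^sub>\<le>\<^sub>0"
  then obtain r where r: "r \<le> 0" "denom A w' / denom A w = of_real r"
    unfolding A(2) denom_ratio_abs[OF A(1)] by (auto elim: nonpos_Reals_cases)
  then have eq: "denom A w' = of_real r * denom A w" using denom_nonzero[OF A(1) assms(1)] by (simp add: field_simps)
  have "A$2$1 * (Im w' - r * Im w) = 0"
    using arg_cong[OF eq, of Im] by (simp add: denom_def algebra_simps)
  moreover have "0 < Im w' - r * Im w"
    using assms r(1) mult_nonpos_nonneg[of r "Im w"] by (auto simp: H2_def)
  ultimately have c: "A$2$1 = 0" by simp
  then have "A$2$2 = r * A$2$2" using arg_cong[OF eq, of Re] by (simp add: denom_def)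
  moreover have "A$2$2 \<noteq> 0" using SL2_det[OF A(1)] c by auto
  ultimately show False using r(1) by simp
qed

lemma denom_ratio_nonzero: "w \<in> H2 \<Longrightarrow> w' \<in> H2 \<Longrightarrow> denom_ratio g w w' \<noteq> 0"
  using denom_ratio_not_nonpos[of w w' g] by auto

lemma denom_ratio_square:
  assumes "w \<in> H2" "w' \<in> H2"
  shows "deriv (act g) w / deriv (act g) w' = (denom_ratio g w w')\<^sup>2"
proof -
  obtain A where A: "A \<in> SL2" "g = abs_psl2 A" by (rule psl2_cases)
  show ?thesis
    unfolding A(2) deriv_act[OF A(1) assms(1)] deriv_act[OF A(1) assms(2)] denom_ratio_abs[OF A(1)]
    by (simp add: power_divide)
qed

text \<open>The canonical argument of \<open>g'(w) / g'(w')\<close>, see \<open>cis_turn\<close>. The factor 2 comes from the square in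
\<open>g'(z) = (c z + d)\<^sup>-\<^sup>2\<close>.\<close>

definition turn :: "psl2 \<Rightarrow> complex \<Rightarrow> complex \<Rightarrow> real" where
  "turn g w w' = 2 * Im (Ln (denom_ratio g w w'))"

lemma turn_swap:
  assumes "w \<in> H2" "w' \<in> H2" shows "turn g w' w = - turn g w w'"
proof -
  obtain A where A: "A \<in> SL2" "g = abs_psl2 A" by (rule psl2_cases)
  have "denom_ratio g w' w = inverse (denom_ratio g w w')" unfolding A(2) denom_ratio_abs[OF A(1)] by simp
  then show ?thesis
    using Ln_inverse[OF denom_ratio_not_nonpos[OF assms, of g]] by (simp add: turn_def)
qed

lemma turn_refl: "w \<in> H2 \<Longrightarrow> turn g w w = 0"
  using turn_swap[of w w g] by simp

lemma cis_turn:
  assumes "w \<in> H2" "w' \<in> H2"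
  shows "deriv (act g) w / deriv (act g) w' =
    of_real (cmod (deriv (act g) w / deriv (act g) w')) * cis (turn g w w')"
proof -
  let ?r = "denom_ratio g w w'"
  have "?r = exp (Ln ?r)" using denom_ratio_nonzero[OF assms] by simp
  also have "\<dots> = of_real (exp (Re (Ln ?r))) * cis (Im (Ln ?r))" by (simp add: exp_eq_polar)
  also have "exp (Re (Ln ?r)) = cmod ?r" using denom_ratio_nonzero[OF assms] by simp
  finally have "?r\<^sup>2 = (of_real (cmod ?r) * cis (Im (Ln ?r)))\<^sup>2" by simp
  also have "\<dots> = of_real (cmod (?r\<^sup>2)) * cis (turn g w w')"
    by (simp add: power_mult_distrib turn_def norm_power power2_eq_square[of "cis _"] cis_mult)
  finally show ?thesis unfolding denom_ratio_square[OF assms] .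
qed

text \<open>The quotient map from matrices to isometries is open. Its product with an identity map is
therefore open as well, so continuity in the isometry and further variables jointly can be
checked on matrices.\<close>

lemma continuous_on_psl2_prod:
  fixes \<Phi> :: "psl2 \<Rightarrow> 'a::topological_space \<Rightarrow> 'b::topological_space"
  assumes "continuous_on (SL2 \<times> T) (\<lambda>(A, x). \<Phi> (abs_psl2 A) x)"
  shows "continuous_on (UNIV \<times> T) (\<lambda>(g, x). \<Phi> g x)"
  unfolding continuous_on_topological
proof (intro ballI allI impI)
  fix p B assume p: "p \<in> (UNIV :: psl2 set) \<times> T" and B: "open B" "(case p of (g, x) \<Rightarrow> \<Phi> g x) \<in> B"
  obtain g x where gx: "p = (g, x)" "x \<in> T" using p by auto
  obtain A where A: "A \<in> SL2" "g = abs_psl2 A" by (rule psl2_cases)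
  have "(A, x) \<in> SL2 \<times> T" using A gx by simp
  moreover have "(case (A, x) of (A, x) \<Rightarrow> \<Phi> (abs_psl2 A) x) \<in> B" using B(2) gx A by simp
  ultimately obtain W where W: "open W" "(A, x) \<in> W"
    "\<And>p. p \<in> SL2 \<times> T \<Longrightarrow> p \<in> W \<Longrightarrow> (case p of (A, x) \<Rightarrow> \<Phi> (abs_psl2 A) x) \<in> B"
    using assms B(1) unfolding continuous_on_topological by metis
  obtain X Y where XY: "open X" "open Y" "(A, x) \<in> X \<times> Y" "X \<times> Y \<subseteq> W"
    using W(1,2) by (rule open_prod_elim)
  show "\<exists>U. open U \<and> p \<in> U \<and> (\<forall>y\<in>UNIV \<times> T. y \<in> U \<longrightarrow> (case y of (g, x) \<Rightarrow> \<Phi> g x) \<in> B)"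
  proof (intro exI[of _ "abs_psl2 ` (SL2 \<inter> X) \<times> Y"] conjI ballI impI)
    show "open (abs_psl2 ` (SL2 \<inter> X) \<times> Y)"
      by (intro open_Times open_image_abs_psl2 openin_open_Int XY)
    show "p \<in> abs_psl2 ` (SL2 \<inter> X) \<times> Y" using gx A XY(3) by auto
    fix y assume y: "y \<in> UNIV \<times> T" "y \<in> abs_psl2 ` (SL2 \<inter> X) \<times> Y"
    then obtain A' x' where *: "y = (abs_psl2 A', x')" "A' \<in> SL2 \<inter> X" "x' \<in> Y" "x' \<in> T" by auto
    have "(A', x') \<in> W" using XY(4) * by auto
    then show "(case y of (g, x) \<Rightarrow> \<Phi> g x) \<in> B" using W(3)[of "(A', x')"] * by simp
  qed
qed

lemma continuous_on_act: "continuous_on (UNIV \<times> H2) (\<lambda>(g, z). act g z)"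
proof (rule continuous_on_psl2_prod)
  have "continuous_on (SL2 \<times> H2) (\<lambda>p. (of_real (fst p$1$1) * snd p + of_real (fst p$1$2)) / denom (fst p) (snd p))"
    unfolding denom_def by (intro continuous_intros) (auto simp: denom_nonzero[unfolded denom_def])
  then show "continuous_on (SL2 \<times> H2) (\<lambda>(A, z). act (abs_psl2 A) z)"
    by (rule continuous_on_eq) (auto simp: act_abs)
qed

lemma continuous_on_deriv_act: "continuous_on (UNIV \<times> H2) (\<lambda>(g, z). deriv (act g) z)"
proof (rule continuous_on_psl2_prod)
  have "continuous_on (SL2 \<times> H2) (\<lambda>p. 1 / (denom (fst p) (snd p))\<^sup>2)"
    unfolding denom_def by (intro continuous_intros) (auto simp: denom_nonzero[unfolded denom_def])
  then show "continuous_on (SL2 \<times> H2) (\<lambda>(A, z). deriv (act (abs_psl2 A)) z)"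
    by (rule continuous_on_eq) (auto simp: deriv_act)
qed

lemma continuous_on_denom_ratio: "continuous_on (UNIV \<times> (H2 \<times> H2)) (\<lambda>(g, p). denom_ratio g (fst p) (snd p))"
proof (rule continuous_on_psl2_prod)
  have "continuous_on (SL2 \<times> (H2 \<times> H2)) (\<lambda>p. denom (fst p) (snd (snd p)) / denom (fst p) (fst (snd p)))"
    unfolding denom_def by (intro continuous_intros) (auto simp: denom_nonzero[unfolded denom_def])
  then show "continuous_on (SL2 \<times> (H2 \<times> H2)) (\<lambda>(A, p). denom_ratio (abs_psl2 A) (fst p) (snd p))"
    by (rule continuous_on_eq) (auto simp: denom_ratio_abs)
qed

lemma continuous_on_act_comp:
  "continuous_on S g \<Longrightarrow> continuous_on S z \<Longrightarrow> z ` S \<subseteq> H2 \<Longrightarrow> continuous_on S (\<lambda>t. act (g t) (z t))"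
  using continuous_on_compose2[OF continuous_on_act, of S "\<lambda>t. (g t, z t)"]
  by (auto intro!: continuous_intros)

lemma continuous_on_deriv_act_comp:
  "continuous_on S g \<Longrightarrow> continuous_on S z \<Longrightarrow> z ` S \<subseteq> H2 \<Longrightarrow> continuous_on S (\<lambda>t. deriv (act (g t)) (z t))"
  using continuous_on_compose2[OF continuous_on_deriv_act, of S "\<lambda>t. (g t, z t)"]
  by (auto intro!: continuous_intros)

lemma continuous_on_turn_comp:
  assumes "continuous_on S g" "continuous_on S w" "w ` S \<subseteq> H2" "continuous_on S w'" "w' ` S \<subseteq> H2"
  shows "continuous_on S (\<lambda>t. turn (g t) (w t) (w' t))"
proof -
  have "continuous_on S (\<lambda>t. denom_ratio (g t) (w t) (w' t))"
  proof -
    have "continuous_on S (\<lambda>t. (g t, (w t, w' t)))" by (intro continuous_on_Pair assms)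
    moreover have "(\<lambda>t. (g t, (w t, w' t))) ` S \<subseteq> UNIV \<times> (H2 \<times> H2)" using assms by auto
    ultimately show ?thesis
      using continuous_on_compose2[OF continuous_on_denom_ratio, of S "\<lambda>t. (g t, (w t, w' t))"] by simp
  qed
  moreover have "denom_ratio (g t) (w t) (w' t) \<notin> \<real>\<^sub>\<le>\<^sub>0" if "t \<in> S" for t
    using that assms by (intro denom_ratio_not_nonpos) auto
  ultimately show ?thesis unfolding turn_def by (intro continuous_intros) auto
qed

section \<open>Geodesics and the form dx/y along them\<close>

definition C1_in_H2 :: "(real \<Rightarrow> complex) \<Rightarrow> (real \<Rightarrow> complex) \<Rightarrow> bool" where
  "C1_in_H2 \<gamma> \<gamma>' \<longleftrightarrow> (\<forall>t\<in>{0..1}. (\<gamma> has_vector_derivative \<gamma>' t) (at t within {0..1})) \<and>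
     continuous_on {0..1} \<gamma>' \<and> \<gamma> ` {0..1} \<subseteq> H2"

lemma C1_in_H2_continuous: "C1_in_H2 \<gamma> \<gamma>' \<Longrightarrow> continuous_on {0..1} \<gamma>"
  unfolding C1_in_H2_def continuous_on_eq_continuous_within
  by (blast intro: has_vector_derivative_continuous)

text \<open>The number \<open>I\<close> is the integral of \<open>dx / y\<close> along \<open>\<gamma>\<close>. The derivative \<open>\<gamma>'\<close> is an argument because the
isometries and reversals below transform it explicitly.\<close>

definition C1_turning :: "(real \<Rightarrow> complex) \<Rightarrow> (real \<Rightarrow> complex) \<Rightarrow> real \<Rightarrow> bool" where
  "C1_turning \<gamma> \<gamma>' I \<longleftrightarrow> C1_in_H2 \<gamma> \<gamma>' \<and> ((\<lambda>t. Re (\<gamma>' t) / Im (\<gamma> t)) has_integral I) {0..1}"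

lemma C1_turning_reverse:
  assumes "C1_turning \<gamma> \<gamma>' I"
  shows "C1_turning (\<lambda>t. \<gamma> (1 - t)) (\<lambda>t. - \<gamma>' (1 - t)) (- I)"
proof -
  have c: "C1_in_H2 \<gamma> \<gamma>'" and i: "((\<lambda>t. Re (\<gamma>' t) / Im (\<gamma> t)) has_integral I) {0..1}"
    using assms by (auto simp: C1_turning_def)
  have "((\<lambda>t. \<gamma> (1 - t)) has_vector_derivative - \<gamma>' (1 - t)) (at t within {0..1})" if t: "t \<in> {0..1}" for t
  proof -
    have im: "(\<lambda>t. 1 - t) ` {0..1} = {0..1::real}" by (auto simp: image_iff)
    have "(\<gamma> has_vector_derivative \<gamma>' (1 - t)) (at (1 - t) within (\<lambda>t. 1 - t) ` {0..1})"
      unfolding im using c t by (auto simp: C1_in_H2_def)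
    moreover have "((\<lambda>t. 1 - t) has_vector_derivative - 1) (at t within {0..1})"
      by (auto intro!: derivative_eq_intros)
    ultimately show ?thesis using vector_diff_chain_within[of "\<lambda>t. 1 - t" "-1" t "{0..1}" \<gamma> "\<gamma>' (1 - t)"]
      by (simp add: o_def)
  qed
  moreover have "continuous_on {0..1} (\<lambda>t. - \<gamma>' (1 - t))"
  proof (rule continuous_on_minus, rule continuous_on_compose2[of "{0..1}" \<gamma>'])
    show "continuous_on {0..1} (\<lambda>t::real. 1 - t)" by (intro continuous_intros)
  qed (use c in \<open>auto simp: C1_in_H2_def\<close>)
  moreover have "(\<lambda>t. \<gamma> (1 - t)) ` {0..1} \<subseteq> H2" using c by (auto simp: C1_in_H2_def)
  moreover have "((\<lambda>t. Re (- \<gamma>' (1 - t)) / Im (\<gamma> (1 - t))) has_integral - I) {0..1}"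
    using has_integral_neg[OF has_integral_affinity[OF i[unfolded interval_cbox], of "-1" 1]]
    by (simp add: interval_cbox[symmetric] image_affinity_atLeastAtMost)
  ultimately show ?thesis by (simp add: C1_turning_def C1_in_H2_def)
qed

text \<open>With \<open>m = c z + d\<close> one has \<open>g'(z) Im z / Im (g z) = cnj m / m = 1 - 2 \<i> c Im z / m\<close>. Taking real
parts, the pullback of \<open>dx / y\<close> under \<open>g\<close> is \<open>dx / y + 2 Im (c dz / m)\<close>, and the second term is the
differential of \<open>2 Im (Ln m)\<close>.\<close>

lemma C1_turning_act:
  assumes "C1_turning \<gamma> \<gamma>' I"
  shows "C1_turning (\<lambda>t. act g (\<gamma> t)) (\<lambda>t. deriv (act g) (\<gamma> t) * \<gamma>' t) (I + turn g (\<gamma> 0) (\<gamma> 1))"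
proof -
  have c: "C1_in_H2 \<gamma> \<gamma>'" and i: "((\<lambda>t. Re (\<gamma>' t) / Im (\<gamma> t)) has_integral I) {0..1}"
    using assms by (auto simp: C1_turning_def)
  have H: "\<gamma> t \<in> H2" if "t \<in> {0..1}" for t using c that by (auto simp: C1_in_H2_def)
  have d: "(\<gamma> has_vector_derivative \<gamma>' t) (at t within {0..1})" if "t \<in> {0..1}" for t
    using c that by (simp add: C1_in_H2_def)
  have cont: "continuous_on {0..1} \<gamma>" by (rule C1_in_H2_continuous[OF c])
  have 1: "((\<lambda>t. act g (\<gamma> t)) has_vector_derivative deriv (act g) (\<gamma> t) * \<gamma>' t) (at t within {0..1})"
    if t: "t \<in> {0..1}" for t
    using field_vector_diff_chain_within[OF d[OF t] has_field_derivative_at_within[OF has_field_derivative_act[OF H[OF t]]]]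
    by (simp add: o_def mult.commute)
  have 2: "continuous_on {0..1} (\<lambda>t. deriv (act g) (\<gamma> t) * \<gamma>' t)"
    by (intro continuous_intros continuous_on_deriv_act_comp cont) (use c in \<open>auto simp: C1_in_H2_def\<close>)
  obtain A where A: "A \<in> SL2" "g = abs_psl2 A" by (rule psl2_cases)
  have nz: "denom A (\<gamma> t) \<noteq> 0" if "t \<in> {0..1}" for t by (rule denom_nonzero[OF A(1) H[OF that]])
  define c where "c = A$2$1"
  have "((\<lambda>t. 2 * Im (of_real c * \<gamma>' t / denom A (\<gamma> t))) has_integral
      (turn g (\<gamma> 0) (\<gamma> 1) - turn g (\<gamma> 0) (\<gamma> 0))) {0..1}"
  proof (rule fundamental_theorem_of_calculus)
    fix t :: real assume t: "t \<in> {0..1}"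
    have "((\<lambda>z. Ln (denom A z / denom A (\<gamma> 0))) has_field_derivative of_real c / denom A (\<gamma> t)) (at (\<gamma> t))"
    proof -
      have 0: "denom A (\<gamma> t) / denom A (\<gamma> 0) \<notin> \<real>\<^sub>\<le>\<^sub>0"
        using denom_ratio_not_nonpos[OF H[of 0] H[OF t], of g] by (simp add: A(2) denom_ratio_abs[OF A(1)])
      have "((\<lambda>z. denom A z / denom A (\<gamma> 0)) has_field_derivative of_real c / denom A (\<gamma> 0)) (at (\<gamma> t))"
        using nz[of 0] unfolding denom_def c_def by (auto intro!: derivative_eq_intros)
      from DERIV_chain2[OF has_field_derivative_Ln[OF 0] this]
      show ?thesis using nz[of 0] nz[OF t] by (simp add: field_simps)
    qed
    from field_vector_diff_chain_within[OF d[OF t] has_field_derivative_at_within[OF this]]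
    have "((\<lambda>t. Ln (denom A (\<gamma> t) / denom A (\<gamma> 0))) has_vector_derivative of_real c * \<gamma>' t / denom A (\<gamma> t)) (at t within {0..1})"
      by (simp add: o_def mult.commute)
    from has_vector_derivative_mult_right[OF bounded_linear.has_vector_derivative[OF bounded_linear_Im this], of 2]
    show "((\<lambda>t. turn g (\<gamma> 0) (\<gamma> t)) has_vector_derivative 2 * Im (of_real c * \<gamma>' t / denom A (\<gamma> t))) (at t within {0..1})"
      by (simp add: turn_def A(2) denom_ratio_abs[OF A(1)])
  qed simp
  then have j: "((\<lambda>t. 2 * Im (of_real c * \<gamma>' t / denom A (\<gamma> t))) has_integral turn g (\<gamma> 0) (\<gamma> 1)) {0..1}"
    using turn_refl[OF H[of 0], of g] by simp
  have key: "Re (deriv (act g) z * v) / Im (act g z) = Re v / Im z + 2 * Im (of_real c * v / denom A z)"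
    if z: "z \<in> H2" for z v
  proof -
    let ?m = "denom A z"
    have reR: "Re (of_real r * u) = r * Re u" for r u by simp
    have m0: "?m \<noteq> 0" by (rule denom_nonzero[OF A(1) z])
    have y: "Im z > 0" using z by (simp add: H2_def)
    have cm: "cnj ?m = ?m - 2 * \<i> * of_real (c * Im z)" by (simp add: denom_def c_def complex_eq_iff)
    have n: "of_real ((cmod ?m)\<^sup>2) = ?m * cnj ?m" by (rule complex_norm_square)
    have "Re (deriv (act g) z * v) / Im (act g z) = Re (of_real ((cmod ?m)\<^sup>2) * (v / ?m\<^sup>2)) / Im z"
      unfolding A(2) deriv_act[OF A(1) z] Im_act[OF A(1) z] reR by (simp add: mult.commute)
    also have "of_real ((cmod ?m)\<^sup>2) * (v / ?m\<^sup>2) = v * cnj ?m / ?m"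
      unfolding n using m0 by (simp add: power2_eq_square)
    also have "\<dots> = v - of_real (2 * Im z) * (\<i> * (of_real c * v / ?m))"
      unfolding cm using m0 by (simp add: field_simps)
    also have "Re \<dots> = Re v + 2 * Im z * Im (of_real c * v / ?m)"
      unfolding minus_complex.sel reR Re_i_times by simp
    finally show ?thesis using y by (simp add: field_simps)
  qed
  have "((\<lambda>t. Re (deriv (act g) (\<gamma> t) * \<gamma>' t) / Im (act g (\<gamma> t))) has_integral (I + turn g (\<gamma> 0) (\<gamma> 1))) {0..1}"
    by (rule has_integral_eq[OF _ has_integral_add[OF i j]]) (simp only: key[OF H])
  then show ?thesis using 1 2 H act_H2 unfolding C1_turning_def C1_in_H2_def by auto
qed

lemma hdist_act:
  assumes "z \<in> H2" "w \<in> H2" shows "hdist (act g z) (act g w) = hdist z w"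
proof -
  obtain A where A: "A \<in> SL2" "g = abs_psl2 A" by (rule psl2_cases)
  have nz: "denom A z \<noteq> 0" "denom A w \<noteq> 0" using denom_nonzero[OF A(1)] assms by auto
  have "(act g z - act g w) * (denom A z * denom A w)
      = (of_real (A$1$1) * z + of_real (A$1$2)) * denom A w - (of_real (A$1$1) * w + of_real (A$1$2)) * denom A z"
    unfolding act_num[OF A(1) assms(1)] act_num[OF A(1) assms(2)] A(2) by (simp add: algebra_simps)
  also have "\<dots> = of_real (A$1$1 * A$2$2 - A$1$2 * A$2$1) * (z - w)"
    by (simp add: denom_def algebra_simps)
  finally have "act g z - act g w = (z - w) / (denom A z * denom A w)"
    using nz unfolding SL2_det[OF A(1)] by (simp add: field_simps)
  then have "(cmod (act g z - act g w))\<^sup>2 / (2 * Im (act g z) * Im (act g w)) = (cmod (z - w))\<^sup>2 / (2 * Im z * Im w)"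
    unfolding A(2) Im_act[OF A(1) assms(1)] Im_act[OF A(1) assms(2)]
    using nz by (simp add: norm_divide norm_mult power_divide power_mult_distrib)
  then show ?thesis by (simp add: hdist_def)
qed

text \<open>The unit speed parametrisation of the imaginary axis; \<open>\<i> = iaxis 0\<close> is the base point.\<close>

definition iaxis :: "real \<Rightarrow> complex" where "iaxis s = \<i> * of_real (exp s)"

lemma iaxis_sel [simp]: "Re (iaxis s) = 0" "Im (iaxis s) = exp s"
  by (simp_all add: iaxis_def)

lemma iaxis_H2: "iaxis s \<in> H2"
  by (simp add: H2_def)

lemma hdist_iaxis: "hdist (iaxis s) (iaxis t) = \<bar>s - t\<bar>"
proof -
  have "iaxis s - iaxis t = \<i> * of_real (exp s - exp t)" by (simp add: iaxis_def algebra_simps)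
  then have "(cmod (iaxis s - iaxis t))\<^sup>2 = (exp s - exp t)\<^sup>2" by (simp add: norm_mult del: of_real_diff)
  then have "1 + (cmod (iaxis s - iaxis t))\<^sup>2 / (2 * Im (iaxis s) * Im (iaxis t)) = cosh (s - t)"
    by (simp add: cosh_def exp_diff exp_minus power2_eq_square field_simps)
  also have "\<dots> = cosh \<bar>s - t\<bar>" by simp
  finally show ?thesis unfolding hdist_def by (simp only: arcosh_cosh_real abs_ge_zero)
qed

lemma cosh_hdist:
  assumes "z \<in> H2" "w \<in> H2"
  shows "cosh (hdist z w) = 1 + (cmod (z - w))\<^sup>2 / (2 * Im z * Im w)"
  unfolding hdist_def using assms by (intro cosh_arcosh_real) (auto simp: H2_def)

lemma hdist_eq_0_iff:
  assumes "z \<in> H2" "w \<in> H2" shows "hdist z w = 0 \<longleftrightarrow> z = w"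
proof
  assume "hdist z w = 0"
  then show "z = w" using cosh_hdist[OF assms] assms by (simp add: H2_def)
qed (simp add: hdist_def)

text \<open>Each of the two distances is a linear equation in \<open>|w|\<^sup>2\<close> and \<open>Im w\<close>. The two equations are
independent, and the solution has \<open>|w|\<^sup>2 = (Im w)\<^sup>2\<close>.\<close>

lemma iaxis_unique:
  assumes w: "w \<in> H2" and d: "d \<noteq> 0"
    and "hdist (iaxis 0) w = \<bar>s\<bar>" "hdist w (iaxis d) = \<bar>s - d\<bar>"
  shows "w = iaxis s"
proof -
  define N where "N = (cmod w)\<^sup>2"
  define y where "y = Im w"
  have y: "0 < y" using w by (simp add: y_def H2_def)
  have sq: "(cmod (w - iaxis r))\<^sup>2 = N - 2 * exp r * y + (exp r)\<^sup>2" for r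
    unfolding N_def y_def cmod_power2 by (simp add: power2_eq_square algebra_simps)
  have eq: "N + (exp r)\<^sup>2 = 2 * exp r * y * cosh (s - r)" if "hdist w (iaxis r) = \<bar>s - r\<bar>" for r
  proof -
    have "cosh (s - r) = 1 + (N - 2 * exp r * y + (exp r)\<^sup>2) / (2 * y * exp r)"
      using cosh_hdist[OF w iaxis_H2[of r]] unfolding that sq by (simp add: y_def)
    then show ?thesis using y by (simp add: field_simps)
  qed
  have sym: "hdist w (iaxis 0) = hdist (iaxis 0) w" by (simp add: hdist_def norm_minus_commute mult_ac)
  have e0: "N + 1 = y * (exp s + exp (- s))" using eq[of 0] assms(3) sym by (simp add: cosh_def)
  have "2 * exp d * y * cosh (s - d) = y * (exp s + (exp d)\<^sup>2 * exp (- s))"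
    by (simp add: cosh_def exp_diff exp_minus power2_eq_square field_simps)
  then have e1: "N + (exp d)\<^sup>2 = y * (exp s + (exp d)\<^sup>2 * exp (- s))" using eq[of d] assms(4) by simp
  have "exp d \<noteq> - 1" using exp_gt_zero[of d] by linarith
  then have nz: "(exp d)\<^sup>2 - 1 \<noteq> 0" using d by (simp add: power2_eq_1_iff)
  have "((exp d)\<^sup>2 - 1) * (1 - y * exp (- s)) = 0" using e0 e1 by (simp add: algebra_simps)
  then have "1 - y * exp (- s) = 0" using nz by (simp only: mult_eq_0_iff simp_thms)
  then have ys: "y = exp s" by (simp add: exp_minus field_simps)
  have "N = y\<^sup>2" using e0 unfolding ys by (simp add: exp_minus power2_eq_square field_simps)
  then have "Re w = 0" by (simp add: N_def y_def cmod_power2)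
  then show ?thesis using ys by (simp add: complex_eq_iff y_def)
qed

definition mat2 :: "real \<Rightarrow> real \<Rightarrow> real \<Rightarrow> real \<Rightarrow> real^2^2" where
  "mat2 a b c d = vector [vector [a, b], vector [c, d]]"

lemma mat2_nth [simp]:
  "mat2 a b c d $ 1 $ 1 = a" "mat2 a b c d $ 1 $ 2 = b" "mat2 a b c d $ 2 $ 1 = c" "mat2 a b c d $ 2 $ 2 = d"
  by (simp_all add: mat2_def)

lemma mat2_SL2: "a * d - b * c = 1 \<Longrightarrow> mat2 a b c d \<in> SL2"
  by (simp add: SL2_def det_2)

lemma move_to_i:
  assumes "y \<in> H2" obtains g where "act g (iaxis 0) = y"
proof
  define r where "r = sqrt (Im y)"
  have r: "r > 0" "r * r = Im y" using assms by (auto simp: r_def H2_def)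
  have S: "mat2 r (Re y / r) 0 (1 / r) \<in> SL2" by (rule mat2_SL2) (use r in simp)
  have "act (abs_psl2 (mat2 r (Re y / r) 0 (1 / r))) (iaxis 0) = of_real (r * r) * \<i> + of_real (Re y)"
    unfolding act_abs[OF S] using r(1) by (simp add: denom_def iaxis_def field_simps)
  then show "act (abs_psl2 (mat2 r (Re y / r) 0 (1 / r))) (iaxis 0) = y"
    unfolding r(2) by (simp add: complex_eq_iff)
qed

text \<open>The rotation by \<open>pi / 2\<close> in \<open>SL2\<close> acts as \<open>z \<mapsto> - 1 / z\<close>, which reverses the sign of the real part. By
continuity some rotation in between moves \<open>z\<close> onto the axis.\<close>

lemma rotate_to_axis:
  assumes z: "z \<in> H2" obtains g where "act g (iaxis 0) = iaxis 0" "Re (act g z) = 0"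
proof -
  define M where "M t = mat2 (cos t) (sin t) (- sin t) (cos t)" for t :: real
  have M: "M t \<in> SL2" for t
    unfolding M_def by (rule mat2_SL2) (use sin_cos_squared_add[of t] in \<open>simp add: power2_eq_square algebra_simps\<close>)
  define N where "N t = Re ((of_real (cos t) * z + of_real (sin t)) * cnj (denom (M t) z))" for t
  have "continuous_on {0..pi / 2} N"
    unfolding N_def denom_def M_def by (simp, intro continuous_intros)
  moreover have "N 0 = Re z" "N (pi / 2) = - Re z" by (simp_all add: N_def denom_def M_def)
  ultimately obtain t where t: "N t = 0"
    using IVT'[of N 0 0 "pi / 2"] IVT2'[of N "pi / 2" 0 0] by (cases "Re z \<le> 0") auto
  show thesis
  proof
    show "act (abs_psl2 (M t)) (iaxis 0) = iaxis 0"
    proof -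
      have "of_real (M t $ 1 $ 1) * iaxis 0 + of_real (M t $ 1 $ 2) = iaxis 0 * denom (M t) (iaxis 0)"
        by (simp add: denom_def M_def iaxis_def algebra_simps)
      then show ?thesis using act_num[OF M iaxis_H2, of t 0] denom_nonzero[OF M iaxis_H2, of t 0] by simp
    qed
    have "act (abs_psl2 (M t)) z = (of_real (cos t) * z + of_real (sin t)) * cnj (denom (M t) z) / of_real ((cmod (denom (M t) z))\<^sup>2)"
      unfolding act_abs[OF M] complex_div_cnj[of _ "denom (M t) z"] by (simp add: M_def)
    then show "Re (act (abs_psl2 (M t)) z) = 0" using t by (simp add: N_def Re_divide_of_real del: of_real_power)
  qed
qed

text \<open>This isometry moves a point below \<open>\<i>\<close> on the axis to one above it, which makes the distance \<open>d\<close> in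
the next lemma positive.\<close>

lemma swap_axis: obtains g where "\<And>s. act g (iaxis s) = iaxis (- s)"
proof
  have S: "mat2 0 1 (-1) 0 \<in> SL2" by (rule mat2_SL2) simp
  show "act (abs_psl2 (mat2 0 1 (-1) 0)) (iaxis s) = iaxis (- s)" for s
    unfolding act_abs[OF S] by (simp add: denom_def iaxis_def exp_minus complex_eq_iff Re_divide Im_divide power2_eq_square)
qed

text \<open>This reduces all questions about a segment to the imaginary axis, where distances and directions
are explicit.\<close>

lemma ex_axis_isometry:
  assumes "y \<in> H2" "z \<in> H2" "y \<noteq> z"
  obtains g d where "0 < d" "act g (iaxis 0) = y" "act g (iaxis d) = z"
proof -
  obtain T where T: "act T (iaxis 0) = y" using move_to_i[OF assms(1)] by blast
  define z1 where "z1 = act (inverse T) z"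
  have z1: "z1 \<in> H2" "act T z1 = z" using act_H2[OF assms(2)] act_inverse[OF assms(2)] by (auto simp: z1_def)
  obtain K where K: "act K (iaxis 0) = iaxis 0" "Re (act K z1) = 0" using rotate_to_axis[OF z1(1)] by blast
  define s where "s = ln (Im (act K z1))"
  have "Im (act K z1) > 0" using act_H2[OF z1(1), of K] by (simp add: H2_def)
  then have s: "act K z1 = iaxis s" using K(2) by (simp add: complex_eq_iff s_def)
  have inv: "act (inverse K) (iaxis 0) = iaxis 0" "act (inverse K) (iaxis s) = z1"
    using act_inverse(1)[OF iaxis_H2[of 0], of K] act_inverse(1)[OF z1(1), of K] K(1) s by simp_all
  have g: "act (T * inverse K) (iaxis 0) = y" "act (T * inverse K) (iaxis s) = z"
    using act_mult[OF iaxis_H2] inv T z1 by simp_all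
  have "s \<noteq> 0" using g assms(3) by auto
  show thesis
  proof (cases "s > 0")
    case True then show thesis using g that by blast
  next
    case False
    obtain S where S: "\<And>s. act S (iaxis s) = iaxis (- s)" by (rule swap_axis) blast
    have "act (T * inverse K * S) (iaxis 0) = y" "act (T * inverse K * S) (iaxis (- s)) = z"
      using act_mult[OF iaxis_H2, of "T * inverse K" S] S g by simp_all
    then show thesis using that[of "- s"] False \<open>s \<noteq> 0\<close> by simp
  qed
qed

lemma geodesic_from_to_axis:
  assumes "0 < d" shows "geodesic_from_to (act g (iaxis 0)) (act g (iaxis d)) (\<lambda>t. act g (iaxis (t * d)))"
proof -
  have "\<bar>s * d - t * d\<bar> = \<bar>s - t\<bar> * d" for s t using assms by (simp add: abs_mult left_diff_distrib[symmetric])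
  then show ?thesis
    unfolding geodesic_from_to_def
    using assms by (auto simp: hdist_act[OF iaxis_H2 iaxis_H2] hdist_iaxis intro: act_H2 iaxis_H2)
qed

lemma geodesic_from_to_unique:
  assumes "0 < d" "act g (iaxis 0) = y" "act g (iaxis d) = z" and c: "geodesic_from_to y z c" and t: "t \<in> {0..1}"
  shows "c t = act g (iaxis (t * d))"
proof -
  have yz: "hdist y z = d"
    using assms hdist_act[OF iaxis_H2 iaxis_H2, of g 0 d] by (simp add: hdist_iaxis)
  have H: "c s \<in> H2" if "s \<in> {0..1}" for s using c that by (auto simp: geodesic_from_to_def)
  have c01: "c 0 = y" "c 1 = z" using c by (auto simp: geodesic_from_to_def)
  have ds: "hdist (c r) (c s) = \<bar>r - s\<bar> * d" if "r \<in> {0..1}" "s \<in> {0..1}" for r s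
    using c that yz by (auto simp: geodesic_from_to_def)
  define w where "w = act (inverse g) (c t)"
  have w: "w \<in> H2" "act g w = c t" using act_H2[OF H[OF t]] act_inverse[OF H[OF t]] by (auto simp: w_def)
  have "hdist (iaxis 0) w = \<bar>t * d\<bar>"
    using hdist_act[OF iaxis_H2 w(1), of g 0] ds[of 0 t] t c01 assms(1,2) w(2) by (simp add: abs_mult)
  moreover have "hdist w (iaxis d) = \<bar>t * d - d\<bar>"
  proof -
    have "t * d - d = (t - 1) * d" by (simp add: algebra_simps)
    then show ?thesis
      using hdist_act[OF w(1) iaxis_H2, of g d] ds[of t 1] t c01 assms(1,3) w(2) by (simp add: abs_mult)
  qed
  ultimately have "w = iaxis (t * d)" using iaxis_unique[OF w(1), of d "t * d"] assms(1) by simp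
  then show ?thesis using w(2) by simp
qed

lemma geodesic_is_geodesic:
  assumes "y \<in> H2" "z \<in> H2" "y \<noteq> z" shows "geodesic_from_to y z (geodesic y z)"
proof -
  obtain g d where "0 < d" "act g (iaxis 0) = y" "act g (iaxis d) = z" using ex_axis_isometry[OF assms] by blast
  then have "geodesic_from_to y z (\<lambda>t. act g (iaxis (t * d)))" using geodesic_from_to_axis by blast
  then show ?thesis unfolding geodesic_def by (rule someI[of "geodesic_from_to y z"])
qed

lemma C1_turning_axis: "C1_turning (\<lambda>t. iaxis (t * d)) (\<lambda>t. of_real d * iaxis (t * d)) 0"
proof -
  have "((\<lambda>t. iaxis (t * d)) has_vector_derivative of_real d * iaxis (t * d)) (at t within {0..1})" for t
  proof -
    have "((\<lambda>t. exp (t * d)) has_vector_derivative d * exp (t * d)) (at t within {0..1})"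
      unfolding has_real_derivative_iff_has_vector_derivative[symmetric]
      by (auto intro!: derivative_eq_intros)
    from has_vector_derivative_mult_right[OF bounded_linear.has_vector_derivative[OF bounded_linear_of_real this], of \<i>]
    show ?thesis by (simp add: iaxis_def mult_ac)
  qed
  moreover have "continuous_on {0..1} (\<lambda>t. of_real d * iaxis (t * d))"
    unfolding iaxis_def by (intro continuous_intros)
  moreover have "(\<lambda>t. iaxis (t * d)) ` {0..1} \<subseteq> H2" using iaxis_H2 by auto
  ultimately show ?thesis by (simp add: C1_turning_def C1_in_H2_def)
qed

lemma C1_turning_cong:
  assumes "C1_turning \<gamma> \<gamma>' I" "\<And>t. t \<in> {0..1} \<Longrightarrow> \<delta> t = \<gamma> t"
  shows "C1_turning \<delta> \<gamma>' I"
proof -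
  have "(\<delta> has_vector_derivative \<gamma>' t) (at t within {0..1})" if "t \<in> {0..1}" for t
    using assms that by (intro has_vector_derivative_transform[OF that, of \<delta> \<gamma>]) (auto simp: C1_turning_def C1_in_H2_def)
  moreover have "((\<lambda>t. Re (\<gamma>' t) / Im (\<delta> t)) has_integral I) {0..1}"
    using assms by (auto simp: C1_turning_def intro: has_integral_eq)
  moreover have "\<delta> ` {0..1} = \<gamma> ` {0..1}" using assms(2) by auto
  ultimately show ?thesis using assms(1) by (simp add: C1_turning_def C1_in_H2_def)
qed

section \<open>The twist of a commutator\<close>

text \<open>A continuous argument of a path differs from the imaginary part of a continuous logarithm by
a continuous function with values in \<open>2 pi \<int>\<close>. This makes the change of argument accessible to the
homotopy invariance of winding numbers.\<close>

lemma angle_change_winding_number: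
  assumes h: "path h" and a: "continuous_on {0..1} a"
    and eq: "\<And>t. t \<in> {0..1} \<Longrightarrow> h t = of_real (r t) * cis (a t)" and r: "\<And>t. t \<in> {0..1} \<Longrightarrow> 0 < r t"
  shows "a 1 - a 0 = 2 * pi * Re (winding_number h 0)"
proof -
  have "0 \<notin> path_image h" unfolding path_image_def using eq r by force
  then obtain q where q: "path q" "pathfinish q - pathstart q = 2 * of_real pi * \<i> * winding_number h 0"
    "\<And>t. t \<in> {0..1} \<Longrightarrow> h t = 0 + exp (q t)"
    using winding_number_as_continuous_log[OF h] by metis
  define d where "d t = Im (q t) - a t" for t
  have cont: "continuous_on {0..1} d" unfolding d_def using q(1) a by (auto simp: path_def intro!: continuous_intros)
  have int: "\<exists>n::int. d t = 2 * pi * of_int n" if t: "t \<in> {0..1}" for t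
  proof -
    have "of_real (exp (Re (q t))) * cis (Im (q t)) = of_real (r t) * cis (a t)"
      using q(3)[OF t] eq[OF t] by (simp add: exp_eq_polar)
    then have "sgn (of_real (exp (Re (q t))) * cis (Im (q t))) = sgn (of_real (r t) * cis (a t))" by simp
    then have "cis (Im (q t)) = cis (a t)" using r[OF t] by (simp add: sgn_mult sgn_of_real)
    then have "cis (d t) = 1" by (simp add: d_def cis_divide[symmetric])
    then have "cos (d t) = 1" by (simp add: complex_eq_iff)
    then show ?thesis by (auto simp: cos_one_2pi_int mult_ac)
  qed
  have "d constant_on {0..1}"
  proof (rule continuous_discrete_range_constant[OF _ cont])
    fix x :: real assume x: "x \<in> {0..1}"
    show "\<exists>e>0. \<forall>y. y \<in> {0..1} \<and> d y \<noteq> d x \<longrightarrow> e \<le> norm (d y - d x)"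
    proof (intro exI[of _ "2 * pi"] conjI allI impI)
      fix y assume y: "y \<in> {0..1} \<and> d y \<noteq> d x"
      obtain m n :: int where mn: "d y = 2 * pi * of_int m" "d x = 2 * pi * of_int n" using int x y by metis
      then have "m \<noteq> n" using y by auto
      then have "1 \<le> \<bar>real_of_int (m - n)\<bar>" by linarith
      moreover have "d y - d x = 2 * pi * real_of_int (m - n)" by (simp add: mn algebra_simps)
      ultimately show "2 * pi \<le> norm (d y - d x)" by (simp add: abs_mult)
    qed simp
  qed simp
  then have "d 1 = d 0" unfolding constant_on_def by force
  then have "a 1 - a 0 = Im (q 1 - q 0)" by (simp add: d_def)
  also have "q 1 - q 0 = 2 * of_real pi * \<i> * winding_number h 0" using q(2) by (simp add: pathfinish_def pathstart_def)
  finally show ?thesis by simp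
qed

lemma angle_change_homotopic:
  assumes hom: "homotopic_paths (- {0}) h h'"
    and "continuous_on {0..1} a" "continuous_on {0..1} a'"
    and "\<And>t. t \<in> {0..1} \<Longrightarrow> h t = of_real (r t) * cis (a t)" "\<And>t. t \<in> {0..1} \<Longrightarrow> 0 < r t"
    and "\<And>t. t \<in> {0..1} \<Longrightarrow> h' t = of_real (r' t) * cis (a' t)" "\<And>t. t \<in> {0..1} \<Longrightarrow> 0 < r' t"
  shows "a 1 - a 0 = a' 1 - a' 0"
  using angle_change_winding_number[of h a r] angle_change_winding_number[of h' a' r']
    homotopic_paths_imp_path[OF hom] winding_number_homotopic_paths[OF hom] assms by simp

text \<open>The geodesic is the image of the imaginary axis under \<open>g\<close>, and the axis has constant direction
\<open>\<i>\<close>. So the direction of the image is \<open>\<i>\<close> times the direction of \<open>g'\<close>.\<close>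

lemma ref_direction_geodesic:
  assumes gd: "0 < d" "act g (iaxis 0) = y" "act g (iaxis d) = z" and c: "geodesic_from_to y z c"
  obtains \<rho> where "\<And>t. t \<in> {0..1} \<Longrightarrow> ref_direction c e t = cis (\<rho> - turn g (iaxis 0) (iaxis (t * d)))"
proof -
  have eq: "c t = act g (iaxis (t * d))" if "t \<in> {0..1}" for t by (rule geodesic_from_to_unique[OF gd c that])
  define D where "D t = deriv (act g) (iaxis (t * d))" for t
  have "C1_turning (\<lambda>t. act g (iaxis (t * d))) (\<lambda>t. D t * (of_real d * iaxis (t * d))) (turn g (iaxis 0) (iaxis d))"
    using C1_turning_act[OF C1_turning_axis[of d], of g] by (simp add: D_def)
  from C1_turning_cong[OF this eq]
  have der: "(c has_vector_derivative D t * (of_real d * iaxis (t * d))) (at t within {0..1})" if "t \<in> {0..1}" for t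
    using that by (simp add: C1_turning_def C1_in_H2_def)
  have "iaxis 0 \<noteq> iaxis d" using gd(1) by (simp add: complex_eq_iff)
  then have "y \<noteq> z" using gd act_inj[OF iaxis_H2 iaxis_H2] by metis
  then have ne: "c 0 \<noteq> c 1" using c by (simp add: geodesic_from_to_def)
  have D0: "D t \<noteq> 0" for t unfolding D_def by (rule deriv_act_nonzero[OF iaxis_H2])
  define \<rho> where "\<rho> = Arg (D 0) + pi / 2"
  have "ref_direction c e t = cis (\<rho> - turn g (iaxis 0) (iaxis (t * d)))" if t: "t \<in> {0..1}" for t
  proof -
    have "vector_derivative c (at t within {0..1}) = D t * (of_real d * iaxis (t * d))"
      using vector_derivative_within_cbox[of 0 1 t c] der[OF t] t by (simp add: cbox_interval)
    then have "ref_direction c e t = sgn (D t) * sgn (of_real (d * exp (t * d)) * \<i>)"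
      using ne by (simp add: ref_direction_def sgn_mult iaxis_def mult_ac)
    also have "sgn (of_real (d * exp (t * d)) * \<i>) = \<i>"
    proof -
      have "sgn (complex_of_real (d * exp (t * d))) = 1"
        using gd(1) unfolding sgn_of_real by (simp add: sgn_mult)
      moreover have "sgn \<i> = \<i>" by (simp add: sgn_eq)
      ultimately show ?thesis unfolding sgn_mult by simp
    qed
    also have "sgn (D t) = sgn (D 0) * cis (- turn g (iaxis 0) (iaxis (t * d)))"
    proof -
      have "D 0 / D t = of_real (cmod (D 0 / D t)) * cis (turn g (iaxis 0) (iaxis (t * d)))"
        using cis_turn[OF iaxis_H2 iaxis_H2, of g 0 "t * d"] by (simp add: D_def)
      from arg_cong[OF this, of sgn]
      have "sgn (D 0) / sgn (D t) = cis (turn g (iaxis 0) (iaxis (t * d)))"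
        using D0 by (simp add: sgn_mult sgn_divide sgn_of_real)
      then show ?thesis using D0[of t] by (simp add: field_simps sgn_zero_iff cis_mult mult.assoc)
    qed
    also have "sgn (D 0) * cis (- turn g (iaxis 0) (iaxis (t * d))) * \<i> = cis (\<rho> - turn g (iaxis 0) (iaxis (t * d)))"
    proof -
      have "sgn (D 0) * \<i> = cis \<rho>"
        using cis_Arg[OF D0[of 0]] cis_mult[of "Arg (D 0)" "pi / 2"] by (simp add: \<rho>_def)
      then have "sgn (D 0) * cis (- turn g (iaxis 0) (iaxis (t * d))) * \<i> = cis \<rho> * cis (- turn g (iaxis 0) (iaxis (t * d)))"
        by (simp add: mult_ac)
      then show ?thesis by (simp add: cis_mult)
    qed
    finally show ?thesis .
  qed
  then show thesis by (rule that)
qed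

lemma represents_homotopic:
  assumes "represents g G" "represents h G" shows "homotopic_paths UNIV g h"
proof -
  have r: "psl2_path_rel g g" "psl2_path_rel h h" using assms by (auto simp: represents_def psl2_path_rel_def)
  have "abs_psl2_cover g = abs_psl2_cover h" using assms by (simp add: represents_def)
  then have "psl2_path_rel g h"
    using Quotient_rel[OF Quotient_psl2_cover, of g h] r by blast
  then show ?thesis by (simp add: psl2_path_rel_def)
qed

lemma ex_represents: obtains g where "represents g G"
proof
  have "psl2_path_rel (rep_psl2_cover G) (rep_psl2_cover G)"
    using Quotient_rep_reflp[OF Quotient_psl2_cover] .
  then show "represents (rep_psl2_cover G) G"
    using Quotient_abs_rep[OF Quotient_psl2_cover, of G]
    by (auto simp: represents_def psl2_path_rel_def dest: homotopic_paths_imp_path)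
qed

lemma represents_iff: "represents g G \<longleftrightarrow> psl2_path_rel g g \<and> abs_psl2_cover g = G"
  by (auto simp: represents_def psl2_path_rel_def dest: homotopic_paths_imp_path)

lemma represents_times:
  assumes "represents g G" "represents h H" shows "represents (\<lambda>t. g t * h t) (G * H)"
  using assms psl2_path_rel_times[of g g h h] times_psl2_cover.abs_eq[of g h] by (auto simp: represents_iff)

lemma represents_inverse:
  assumes "represents g G" shows "represents (\<lambda>t. inverse (g t)) (inverse G)"
  using assms psl2_path_rel_inverse[of g g] inverse_psl2_cover.abs_eq[of g] by (auto simp: represents_iff)

lemma unit_tangent_of_angle: "z \<in> H2 \<Longrightarrow> (z, of_real (Im z) * cis a) \<in> UTH2"
  by (simp add: UTH2_def H2_def norm_mult)

text \<open>A witness is obtained by moving the base points of the frames \<open>Dg\<^sub>t(u)\<close> to the geodesic along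
straight segments while keeping their euclidean angles. Conversely, the vectors of any witness are
homotopic in the punctured plane to the derivatives of \<open>g\<^sub>t\<close> applied to \<open>u\<close>, hence have the
same total change of argument.\<close>

theorem Tw_eq:
  assumes y: "y \<in> H2" and g: "represents g G"
    and hd: "0 < d" "act h (iaxis 0) = y" "act h (iaxis d) = act (g 1) y"
    and a: "continuous_on {0..1} a"
      "\<And>t. t \<in> {0..1} \<Longrightarrow> deriv (act (g t)) y = of_real (cmod (deriv (act (g t)) y)) * cis (a t)"
  shows "Tw G y = a 1 - a 0 + turn h (iaxis 0) (iaxis d)"
proof -
  define T where "T t = turn h (iaxis 0) (iaxis (t * d))" for t
  have T: "T 0 = 0" "T 1 = turn h (iaxis 0) (iaxis d)" using turn_refl[OF iaxis_H2] by (simp_all add: T_def)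
  have "continuous_on {0..1} (\<lambda>t. iaxis (t * d))" unfolding iaxis_def by (intro continuous_intros)
  then have contT: "continuous_on {0..1} T" unfolding T_def
    by (intro continuous_on_turn_comp continuous_on_const) (use iaxis_H2 in auto)
  have gp: "continuous_on {0..1} g" "g 0 = 1" using g by (auto simp: represents_def path_def pathstart_def)
  have proj: "cover_proj G = g 1" by (rule cover_proj_represents[OF g])
  let ?z = "act (g 1) y"
  let ?c = "\<lambda>t. act h (iaxis (t * d))"
  have "twist_witness G y (a 1 - a 0 + turn h (iaxis 0) (iaxis d))"
  proof -
    have c: "geodesic_from_to y ?z ?c" using geodesic_from_to_axis[OF hd(1), of h] hd by simp
    define u where "u = complex_of_real (Im y)"
    have u: "(y, u) \<in> UTH2" using y by (simp add: UTH2_def u_def H2_def)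
    obtain \<rho> where \<rho>: "\<And>t. t \<in> {0..1} \<Longrightarrow> ref_direction ?c u t = cis (\<rho> - T t)"
      using ref_direction_geodesic[OF hd c] unfolding T_def by blast
    define V where "V t = (?c t, of_real (Im (?c t)) * cis (a t))" for t
    define w where "w t = act (g t) y" for t
    have contc: "continuous_on {0..1} ?c"
      using C1_in_H2_continuous[of ?c] C1_turning_act[OF C1_turning_axis[of d], of h] by (auto simp: C1_turning_def)
    have contw: "continuous_on {0..1} w" unfolding w_def
      by (intro continuous_on_act_comp gp continuous_intros) (use y in auto)
    have tang: "tangent_act (g t) (y, u) = (w t, of_real (Im (w t)) * cis (a t))" if t: "t \<in> {0..1}" for t
    proof -
      have "deriv (act (g t)) y * u = of_real (Im (w t) / Im y) * cis (a t) * of_real (Im y)"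
        using a(2)[OF t] norm_deriv_act[OF y, of "g t"] by (simp add: u_def w_def)
      then show ?thesis using y by (simp add: tangent_act_def w_def H2_def)
    qed
    have ends: "w 0 = y" "w 1 = ?z" "?c 0 = y" "?c 1 = ?z" using gp hd by (simp_all add: w_def act_one)
    have hom: "homotopic_paths UTH2 V (\<lambda>t. tangent_act (g t) (y, u))"
      unfolding homotopic_paths
    proof (intro exI conjI ballI)
      let ?b = "\<lambda>p. (1 - fst p) *\<^sub>R ?c (snd p) + fst p *\<^sub>R w (snd p)"
      let ?k = "\<lambda>p. (?b p, complex_of_real (Im (?b p)) * cis (a (snd p)))"
      have b: "continuous_on ({0..1} \<times> {0..1}) ?b"
        by (intro continuous_intros continuous_on_compose2[OF contc] continuous_on_compose2[OF contw]) auto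
      have "continuous_on ({0..1} \<times> {0..1}) (\<lambda>p. a (snd p))"
        by (intro continuous_on_compose2[OF a(1)] continuous_intros) auto
      then show "continuous_on ({0..1} \<times> {0..1}) ?k"
        by (intro continuous_on_Pair b continuous_intros)
      have "?b p \<in> H2" if "p \<in> {0..1} \<times> {0..1}" for p
      proof -
        have "convex H2" unfolding H2_def by (rule convex_halfspace_Im_gt)
        moreover have "?c (snd p) \<in> H2" "w (snd p) \<in> H2" unfolding w_def by (auto intro: act_H2 iaxis_H2 y)
        ultimately show ?thesis using that unfolding convex_alt by auto
      qed
      then show "?k \<in> {0..1} \<times> {0..1} \<rightarrow> UTH2"
        by (intro funcsetI unit_tangent_of_angle)
      show "?k (0, t) = V t" if "t \<in> {0..1}" for t using that by (simp add: V_def)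
      show "?k (1, t) = tangent_act (g t) (y, u)" if "t \<in> {0..1}" for t using that by (simp add: tang)
      fix s :: real assume "s \<in> {0..1}"
      show "pathstart (?k \<circ> Pair s) = pathstart V" "pathfinish (?k \<circ> Pair s) = pathfinish V"
        using ends by (simp_all add: pathstart_def pathfinish_def V_def algebra_simps)
    qed
    show ?thesis
      unfolding twist_witness_def
    proof (intro exI conjI ballI)
      show "represents g G" by (rule g)
      show "geodesic_from_to y (act (cover_proj G) y) ?c" unfolding proj by (rule c)
      show "(y, u) \<in> UTH2" "(y, u) \<in> UTH2" by (rule u)+
      show "homotopic_paths UTH2 V (\<lambda>t. tangent_act (g t) (y, u))" by (rule hom)
      show "fst (V t) = ?c t" for t by (simp add: V_def)
      show "continuous_on {0..1} (\<lambda>t. a t - \<rho> + T t)" by (intro continuous_intros a contT)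
      show "snd (V t) = of_real (Im (?c t)) * cis (a t - \<rho> + T t) * ref_direction ?c u t" if "t \<in> {0..1}" for t
        using \<rho>[OF that] by (simp add: V_def cis_mult mult.assoc)
      show "a 1 - a 0 + turn h (iaxis 0) (iaxis d) = (a 1 - \<rho> + T 1) - (a 0 - \<rho> + T 0)" using T by simp
    qed
  qed
  moreover have "\<tau> = a 1 - a 0 + turn h (iaxis 0) (iaxis d)" if \<tau>: "twist_witness G y \<tau>" for \<tau>
  proof -
    obtain g' c u V e \<theta> where w: "represents g' G" "geodesic_from_to y ?z c" "(y, u) \<in> UTH2"
      "homotopic_paths UTH2 V (\<lambda>t. tangent_act (g' t) (y, u))" "\<And>t. t \<in> {0..1} \<Longrightarrow> fst (V t) = c t"
      "continuous_on {0..1} \<theta>"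
      "\<And>t. t \<in> {0..1} \<Longrightarrow> snd (V t) = of_real (Im (c t)) * cis (\<theta> t) * ref_direction c e t" "\<tau> = \<theta> 1 - \<theta> 0"
      using \<tau> unfolding twist_witness_def proj by blast
    obtain \<rho> where \<rho>: "\<And>t. t \<in> {0..1} \<Longrightarrow> ref_direction c e t = cis (\<rho> - T t)"
      using ref_direction_geodesic[OF hd w(2)] unfolding T_def by blast
    have u0: "u \<noteq> 0" using w(3) by (auto simp: UTH2_def H2_def)
    have "homotopic_paths (- {0}) (snd \<circ> V) (snd \<circ> (\<lambda>t. tangent_act (g' t) (y, u)))"
      by (rule homotopic_paths_continuous_image[OF w(4)]) (auto intro!: continuous_intros simp: UTH2_def H2_def)
    then have h1: "homotopic_paths (- {0}) (snd \<circ> V) (\<lambda>t. deriv (act (g' t)) y * u)"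
      by (simp add: o_def tangent_act_def)
    have "homotopic_paths (- {0}) ((\<lambda>g. deriv (act g) y * u) \<circ> g') ((\<lambda>g. deriv (act g) y * u) \<circ> g)"
    proof (rule homotopic_paths_continuous_image[OF represents_homotopic[OF w(1) g]])
      show "continuous_on UNIV (\<lambda>g. deriv (act g) y * u)"
        by (intro continuous_intros continuous_on_deriv_act_comp) (use y in auto)
      show "(\<lambda>g. deriv (act g) y * u) \<in> UNIV \<rightarrow> - {0}" using u0 deriv_act_nonzero[OF y] by auto
    qed
    then have hom: "homotopic_paths (- {0}) (snd \<circ> V) (\<lambda>t. deriv (act (g t)) y * u)"
      using homotopic_paths_trans[OF h1] by (simp add: o_def)
    have "(\<theta> 1 + \<rho> - T 1) - (\<theta> 0 + \<rho> - T 0) = (a 1 + Arg u) - (a 0 + Arg u)"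
    proof (rule angle_change_homotopic[OF hom])
      show "continuous_on {0..1} (\<lambda>t. \<theta> t + \<rho> - T t)" by (intro continuous_intros w(6) contT)
      show "continuous_on {0..1} (\<lambda>t. a t + Arg u)" by (intro continuous_intros a)
      fix t :: real assume t: "t \<in> {0..1}"
      show "(snd \<circ> V) t = of_real (Im (c t)) * cis (\<theta> t + \<rho> - T t)"
        using w(7)[OF t] \<rho>[OF t] by (simp add: cis_mult mult.assoc add_diff_eq)
      have "c t \<in> H2" using w(2) t by (auto simp: geodesic_from_to_def)
      then show "0 < Im (c t)" by (simp add: H2_def)
      have ueq: "u = of_real (cmod u) * cis (Arg u)" using rcis_cmod_Arg[of u] by (simp add: rcis_def)
      show "deriv (act (g t)) y * u = of_real (cmod (deriv (act (g t)) y) * cmod u) * cis (a t + Arg u)"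
        unfolding of_real_mult cis_mult[symmetric]
        using arg_cong2[OF a(2)[OF t] ueq, of "(*)"] by (simp only: mult_ac)
      show "0 < cmod (deriv (act (g t)) y) * cmod u" using u0 deriv_act_nonzero[OF y] by simp
    qed
    then show ?thesis using w(8) T by simp
  qed
  ultimately show ?thesis unfolding Tw_def by (rule the_equality)
qed

text \<open>With \<open>w\<^sub>1 = b p\<close>, \<open>w\<^sub>3 = b\<^sup>-\<^sup>1 a b p\<close> and \<open>w\<^sub>4 = a\<^sup>-\<^sup>1 b\<^sup>-\<^sup>1 a b p\<close> the chain rule gives the derivative
\<open>(b'(p) / b'(w\<^sub>3)) (a'(w\<^sub>1) / a'(w\<^sub>4))\<close> at \<open>p\<close>. The turns of the two quotients vanish at the start
of the path, where both isometries are trivial, and depend only on \<open>\<alpha>\<close> and \<open>\<beta>\<close> at its end.\<close>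

theorem Tw_commutator:
  assumes p: "p \<in> H2" and "cover_proj A = \<alpha>" "cover_proj B = \<beta>"
    and q: "q = act (inverse \<alpha> * inverse \<beta> * \<alpha> * \<beta>) p"
    and hd: "0 < d" "act h (iaxis 0) = p" "act h (iaxis d) = q"
  shows "Tw (comm (inverse A) (inverse B)) p = turn h (iaxis 0) (iaxis d)
     + turn \<beta> p (act (inverse \<beta> * \<alpha> * \<beta>) p) + turn \<alpha> (act \<beta> p) q"
proof -
  obtain a where a: "represents a A" by (rule ex_represents)
  obtain b where b: "represents b B" by (rule ex_represents)
  have ab1: "a 1 = \<alpha>" "b 1 = \<beta>" using cover_proj_represents[OF a] cover_proj_represents[OF b] assms by simp_all
  have ab0: "a 0 = 1" "b 0 = 1" using a b by (auto simp: represents_def pathstart_def)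
  have cont: "continuous_on {0..1} a" "continuous_on {0..1} b" using a b by (auto simp: represents_def path_def)
  define g where "g t = inverse (a t) * inverse (b t) * a t * b t" for t
  have g: "represents g (comm (inverse A) (inverse B))"
    using represents_times[OF represents_times[OF represents_times[OF represents_inverse[OF a] represents_inverse[OF b]]
        represents_inverse[OF represents_inverse[OF a]]] represents_inverse[OF represents_inverse[OF b]]]
    by (simp add: comm_def g_def[abs_def] inverse_inverse_psl2)
  define w1 where "w1 t = act (b t) p" for t
  define w3 where "w3 t = act (inverse (b t) * a t * b t) p" for t
  define w4 where "w4 t = act (g t) p" for t
  have H: "w1 t \<in> H2" "w3 t \<in> H2" "w4 t \<in> H2" for t by (simp_all add: w1_def w3_def w4_def act_H2[OF p])
  have rel: "act (a t) (w4 t) = w3 t" "act (b t) (w3 t) = act (a t) (w1 t)" for t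
  proof -
    have "a t * g t = inverse (b t) * a t * b t" by (simp add: g_def mult.assoc[symmetric] psl2_inverse)
    then show "act (a t) (w4 t) = w3 t" by (simp add: w3_def w4_def act_mult[OF p, symmetric])
    have "b t * (inverse (b t) * a t * b t) = a t * b t" by (simp add: mult.assoc[symmetric] psl2_inverse)
    then show "act (b t) (w3 t) = act (a t) (w1 t)" by (simp add: w1_def w3_def act_mult[OF p, symmetric])
  qed
  define \<theta> where "\<theta> t = turn (b t) p (w3 t) + turn (a t) (w1 t) (w4 t)" for t
  have c1: "continuous_on {0..1} w1" unfolding w1_def
    by (intro continuous_on_act_comp cont continuous_intros) (use p in auto)
  have ci: "continuous_on {0..1} (\<lambda>t. inverse (b t))" "continuous_on {0..1} (\<lambda>t. inverse (a t))"
    by (rule continuous_on_compose2[OF continuous_on_inverse_psl2]; use cont in auto)+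
  have c3: "continuous_on {0..1} w3" unfolding w3_def
    by (intro continuous_on_act_comp continuous_on_mult' cont ci continuous_intros) (use p in auto)
  have c4: "continuous_on {0..1} w4" unfolding w4_def g_def
    by (intro continuous_on_act_comp continuous_on_mult' cont ci continuous_intros) (use p in auto)
  have "Tw (comm (inverse A) (inverse B)) p = \<theta> 1 - \<theta> 0 + turn h (iaxis 0) (iaxis d)"
  proof (rule Tw_eq[OF p g])
    show "0 < d" "act h (iaxis 0) = p" "act h (iaxis d) = act (g 1) p"
      using hd by (simp_all add: q g_def ab1)
    show "continuous_on {0..1} \<theta>" unfolding \<theta>_def
      by (intro continuous_on_add continuous_on_turn_comp cont c1 c3 c4 continuous_on_const) (use H p in auto)
    fix t
    have "deriv (act (g t)) p = deriv (act (inverse (a t))) (w3 t) * deriv (act (inverse (b t) * a t * b t)) p"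
      using deriv_act_mult[OF p, of "inverse (a t)" "inverse (b t) * a t * b t"] by (simp add: g_def w3_def mult.assoc)
    also have "deriv (act (inverse (b t) * a t * b t)) p = deriv (act (inverse (b t))) (act (a t) (w1 t)) * (deriv (act (a t)) (w1 t) * deriv (act (b t)) p)"
      using deriv_act_mult[OF p, of "inverse (b t)" "a t * b t"] deriv_act_mult[OF p, of "a t" "b t"]
      by (simp add: w1_def act_mult[OF p] mult.assoc)
    also have "deriv (act (inverse (a t))) (w3 t) = 1 / deriv (act (a t)) (w4 t)"
      using deriv_act_inverse[OF H(3), of "a t" t] rel by simp
    also have "deriv (act (inverse (b t))) (act (a t) (w1 t)) = 1 / deriv (act (b t)) (w3 t)"
      using deriv_act_inverse[OF H(2), of "b t" t] rel by simp
    finally have D: "deriv (act (g t)) p = (deriv (act (b t)) p / deriv (act (b t)) (w3 t)) * (deriv (act (a t)) (w1 t) / deriv (act (a t)) (w4 t))"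
      by (simp add: mult_ac)
    show "deriv (act (g t)) p = of_real (cmod (deriv (act (g t)) p)) * cis (\<theta> t)"
      unfolding D norm_mult of_real_mult \<theta>_def cis_mult[symmetric]
      using arg_cong2[OF cis_turn[OF p H(2)[of t], of "b t"] cis_turn[OF H(1)[of t] H(3)[of t], of "a t"], of "(*)"]
      by (simp only: mult_ac)
  qed
  moreover have "\<theta> 0 = 0" by (simp add: \<theta>_def ab0 turn_def denom_ratio_one)
  moreover have "\<theta> 1 = turn \<beta> p (act (inverse \<beta> * \<alpha> * \<beta>) p) + turn \<alpha> (act \<beta> p) q"
    by (simp add: \<theta>_def ab1 w1_def w3_def w4_def g_def q)
  ultimately show ?thesis by simp
qed

section \<open>Primitives of a density and their coboundaries\<close>

text \<open>The form \<open>- V dx\<close> with \<open>V = column_integral q\<close> is a primitive of \<open>q dx \<and> dy\<close>.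
The base height 0 lies below the half-plane.\<close>

definition column_integral :: "(complex \<Rightarrow> real) \<Rightarrow> real \<Rightarrow> real \<Rightarrow> real" where
  "column_integral q x y = integral {0..y} (\<lambda>s. q (Complex x s))"

definition box_integral :: "(complex \<Rightarrow> real) \<Rightarrow> real \<Rightarrow> real \<Rightarrow> real \<Rightarrow> real" where
  "box_integral q a x y = integral {a..x} (\<lambda>u. column_integral q u y)"

lemma continuous_on_Complex_slice:
  assumes "continuous_on UNIV q"
  shows "continuous_on S (\<lambda>s. q (Complex x s))"
  by (rule continuous_on_compose2[OF assms]) (auto intro!: continuous_intros)

lemma column_integral_diff:
  assumes q: "continuous_on UNIV q" and y: "0 \<le> y1" "y1 \<le> y2"
  shows "column_integral q x y2 - column_integral q x y1 = integral {y1..y2} (\<lambda>s. q (Complex x s))"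
proof -
  have "(\<lambda>s. q (Complex x s)) integrable_on {0..y2}"
    by (intro integrable_continuous_real continuous_on_Complex_slice q)
  from Henstock_Kurzweil_Integration.integral_combine[OF y this] show ?thesis
    by (simp add: column_integral_def)
qed

text \<open>Substituting \<open>s y\<close> for \<open>s\<close> moves \<open>y\<close> from the limit of integration into the integrand.\<close>

lemma continuous_on_column_integral:
  assumes q: "continuous_on UNIV q"
  shows "continuous_on (UNIV \<times> {0..}) (\<lambda>(x, y). column_integral q x y)"
proof -
  have eq: "column_integral q x y = y * integral (cbox 0 1) (\<lambda>s. q (Complex x (s * y)))" if "0 \<le> y" for x y
  proof (cases "y = 0")
    case False
    then have y: "y > 0" using that by simp
    have "((\<lambda>s. q (Complex x s)) has_integral column_integral q x y) (cbox 0 y)"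
      unfolding column_integral_def cbox_interval
      by (intro integrable_integral integrable_continuous_real continuous_on_Complex_slice q)
    from has_integral_affinity[OF this, of y 0] y
    have "((\<lambda>s. q (Complex x (s * y))) has_integral column_integral q x y / y) (cbox 0 1)"
      by (simp add: image_affinity_atLeastAtMost_div mult.commute field_simps)
    then have "integral (cbox 0 1) (\<lambda>s. q (Complex x (s * y))) = column_integral q x y / y" by (rule integral_unique)
    then show ?thesis using y by simp
  qed (simp add: column_integral_def)
  have "continuous_on UNIV (\<lambda>z. integral (cbox 0 1) (\<lambda>s. q (Complex (fst z) (s * snd z))))"
    by (rule integral_continuous_on_param)
      (auto intro!: continuous_on_compose2[OF q] continuous_intros simp: case_prod_unfold)
  then have "continuous_on (UNIV \<times> {0..}) (\<lambda>z. snd z * integral (cbox 0 1) (\<lambda>s. q (Complex (fst z) (s * snd z))))"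
    by (intro continuous_intros) (rule continuous_on_subset, auto)
  then show ?thesis
    by (rule continuous_on_eq) (auto simp: eq)
qed

lemma continuous_on_column_integral_comp:
  assumes q: "continuous_on UNIV q" and "continuous_on S g" "continuous_on S h" "\<And>s. s \<in> S \<Longrightarrow> 0 \<le> h s"
  shows "continuous_on S (\<lambda>s. column_integral q (g s) (h s))"
  using continuous_on_compose2[OF continuous_on_column_integral[OF q], of S "\<lambda>s. (g s, h s)"] assms
  by (auto intro!: continuous_intros)

lemma box_integral_diff:
  assumes q: "continuous_on UNIV q" and x: "a \<le> x1" "x1 \<le> x2" and "0 \<le> y"
  shows "box_integral q a x2 y - box_integral q a x1 y = integral {x1..x2} (\<lambda>u. column_integral q u y)"
proof -
  have "(\<lambda>u. column_integral q u y) integrable_on {a..x2}"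
    by (intro integrable_continuous_real continuous_on_column_integral_comp q continuous_intros) (use assms in auto)
  from Henstock_Kurzweil_Integration.integral_combine[OF x this] show ?thesis
    by (simp add: box_integral_def)
qed

text \<open>For \<open>H = box_integral q a\<close> this is the integral of \<open>q\<close> over the rectangle with corners \<open>(x, y)\<close> and
\<open>(x', y')\<close>, with a sign when the corners are not ordered.\<close>

definition mixed_diff :: "(real \<Rightarrow> real \<Rightarrow> real) \<Rightarrow> real \<Rightarrow> real \<Rightarrow> real \<Rightarrow> real \<Rightarrow> real" where
  "mixed_diff H x x' y y' = H x' y' - H x y' - H x' y + H x y"

lemma mixed_diff_box_integral_ordered:
  assumes q: "continuous_on UNIV q" and x: "a \<le> x1" "x1 \<le> x2" and y: "0 \<le> y1" "y1 \<le> y2"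
    and bd: "\<And>u v. u \<in> {x1..x2} \<Longrightarrow> v \<in> {y1..y2} \<Longrightarrow> \<bar>q (Complex u v) - \<kappa>\<bar> \<le> \<epsilon>"
  shows "\<bar>mixed_diff (box_integral q a) x1 x2 y1 y2 - \<kappa> * (x2 - x1) * (y2 - y1)\<bar> \<le> \<epsilon> * (x2 - x1) * (y2 - y1)"
proof -
  have sl: "\<bar>(column_integral q u y2 - column_integral q u y1) - \<kappa> * (y2 - y1)\<bar> \<le> \<epsilon> * (y2 - y1)" if "u \<in> {x1..x2}" for u
  proof -
    have i: "((\<lambda>s. q (Complex u s)) has_integral (column_integral q u y2 - column_integral q u y1)) {y1..y2}"
      unfolding column_integral_diff[OF q y]
      by (intro integrable_integral integrable_continuous_real continuous_on_Complex_slice q)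
    have "((\<lambda>s. \<kappa>) has_integral (\<kappa> * (y2 - y1))) {y1..y2}"
      using has_integral_const_real[of \<kappa> y1 y2] y by (simp add: mult.commute)
    from has_integral_diff[OF i this]
    have j: "((\<lambda>s. q (Complex u s) - \<kappa>) has_integral (column_integral q u y2 - column_integral q u y1 - \<kappa> * (y2 - y1))) {y1..y2}" .
    have "0 \<le> \<epsilon>" using bd[OF that, of y1] y by auto
    from has_integral_bound_real[OF this finite.emptyI j, of ] bd[OF that] y
    show ?thesis by auto
  qed
  have v: "((\<lambda>u. column_integral q u y) has_integral (box_integral q a x2 y - box_integral q a x1 y)) {x1..x2}" if "0 \<le> y" for y
    unfolding box_integral_diff[OF q x that]
    by (intro integrable_integral integrable_continuous_real continuous_on_column_integral_comp q continuous_intros)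
      (use that in auto)
  have k: "((\<lambda>s. \<kappa> * (y2 - y1)) has_integral (\<kappa> * (x2 - x1) * (y2 - y1))) {x1..x2}"
    using has_integral_const_real[of "\<kappa> * (y2 - y1)" x1 x2] x by (simp add: mult_ac)
  have m: "((\<lambda>u. column_integral q u y2 - column_integral q u y1 - \<kappa> * (y2 - y1)) has_integral
      (box_integral q a x2 y2 - box_integral q a x1 y2 - (box_integral q a x2 y1 - box_integral q a x1 y1) - \<kappa> * (x2 - x1) * (y2 - y1))) {x1..x2}"
    by (intro has_integral_diff v k) (use y in auto)
  have "0 \<le> \<epsilon> * (y2 - y1)" using sl[of x1] x by auto
  from has_integral_bound_real[OF this finite.emptyI m] sl x
  show ?thesis by (auto simp: mixed_diff_def algebra_simps)
qed

lemma mixed_diff_swap: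
  "mixed_diff H x' x y y' = - mixed_diff H x x' y y'"
  "mixed_diff H x x' y' y = - mixed_diff H x x' y y'"
  by (simp_all add: mixed_diff_def)

lemma mixed_diff_box_integral:
  assumes q: "continuous_on UNIV q" and x: "a \<le> x1" "a \<le> x2" and y: "0 \<le> y1" "0 \<le> y2"
    and bd: "\<And>u v. u \<in> closed_segment x1 x2 \<Longrightarrow> v \<in> closed_segment y1 y2 \<Longrightarrow> \<bar>q (Complex u v) - \<kappa>\<bar> \<le> \<epsilon>"
  shows "\<bar>mixed_diff (box_integral q a) x1 x2 y1 y2 - \<kappa> * (x2 - x1) * (y2 - y1)\<bar> \<le> \<epsilon> * \<bar>x2 - x1\<bar> * \<bar>y2 - y1\<bar>"
proof -
  have *: "\<bar>mixed_diff (box_integral q a) (min x1 x2) (max x1 x2) (min y1 y2) (max y1 y2)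
      - \<kappa> * (max x1 x2 - min x1 x2) * (max y1 y2 - min y1 y2)\<bar>
      \<le> \<epsilon> * (max x1 x2 - min x1 x2) * (max y1 y2 - min y1 y2)"
  proof (rule mixed_diff_box_integral_ordered[OF q])
    fix u v assume "u \<in> {min x1 x2..max x1 x2}" "v \<in> {min y1 y2..max y1 y2}"
    then have "u \<in> closed_segment x1 x2" "v \<in> closed_segment y1 y2"
      by (auto simp: closed_segment_eq_real_ivl min_def max_def split: if_splits)
    then show "\<bar>q (Complex u v) - \<kappa>\<bar> \<le> \<epsilon>" by (rule bd)
  qed (use x y in auto)
  show ?thesis
  proof (cases "x1 \<le> x2"; cases "y1 \<le> y2")
    show ?thesis if "x1 \<le> x2" "y1 \<le> y2" using * that by simp
    show ?thesis if "x1 \<le> x2" "\<not> y1 \<le> y2"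
      using * that by (simp add: mixed_diff_swap(2)[of _ x1 x2 y1 y2] algebra_simps)
    show ?thesis if "\<not> x1 \<le> x2" "y1 \<le> y2"
      using * that by (simp add: mixed_diff_swap(1)[of _ x1 x2 y1 y2] algebra_simps)
    show ?thesis if "\<not> x1 \<le> x2" "\<not> y1 \<le> y2"
      using * that by (simp add: mixed_diff_swap(1)[of _ x1 x2 y2 y1] mixed_diff_swap(2)[of _ x1 x2 y1 y2]
          mixed_diff_swap(1)[of _ x1 x2 y1 y2] algebra_simps)
  qed
qed

text \<open>For \<open>H = box_integral q a\<close> this is the integral of \<open>- V dx\<close> along the path from \<open>w\<close> to \<open>w'\<close> that runs
horizontally first and then vertically; the vertical part contributes nothing. Such paths make
edge terms differences of values of \<open>H\<close>.\<close>

definition edge_term :: "(real \<Rightarrow> real \<Rightarrow> real) \<Rightarrow> complex \<Rightarrow> complex \<Rightarrow> real" where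
  "edge_term H w w' = H (Re w) (Im w) - H (Re w') (Im w)"

text \<open>The corners are listed anticlockwise. The \<open>edge_term\<close> of a reversed edge is not the negative of the
original one. Hence all edges run in the direction of increasing grid index, and those on the top and on
the left are subtracted; then the common edges of neighbouring cells cancel exactly.\<close>

definition cell_term :: "(real \<Rightarrow> real \<Rightarrow> real) \<Rightarrow> complex \<Rightarrow> complex \<Rightarrow> complex \<Rightarrow> complex \<Rightarrow> real" where
  "cell_term H a b c d = edge_term H a b + edge_term H b c - edge_term H d c - edge_term H a d"

lemma cell_term_eq_mixed_diff:
  "cell_term H a b c d = mixed_diff H (Re d) (Re c) (Im a) (Im d) - mixed_diff H (Re b) (Re c) (Im a) (Im b)"
  by (simp add: cell_term_def edge_term_def mixed_diff_def)

lemma sum_cell_terms: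
  "(\<Sum>j<n. \<Sum>k<n. cell_term H (Z j k) (Z (Suc j) k) (Z (Suc j) (Suc k)) (Z j (Suc k))) =
     (\<Sum>j<n. edge_term H (Z j 0) (Z (Suc j) 0)) + (\<Sum>k<n. edge_term H (Z n k) (Z n (Suc k)))
   - (\<Sum>j<n. edge_term H (Z j n) (Z (Suc j) n)) - (\<Sum>k<n. edge_term H (Z 0 k) (Z 0 (Suc k)))"
proof -
  let ?h = "\<lambda>j k. edge_term H (Z j k) (Z (Suc j) k)" and ?v = "\<lambda>j k. edge_term H (Z j k) (Z j (Suc k))"
  have "(\<Sum>j<n. \<Sum>k<n. cell_term H (Z j k) (Z (Suc j) k) (Z (Suc j) (Suc k)) (Z j (Suc k)))
      = (\<Sum>j<n. \<Sum>k<n. (?v (Suc j) k - ?v j k)) - (\<Sum>j<n. \<Sum>k<n. (?h j (Suc k) - ?h j k))"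
    unfolding sum_subtractf[symmetric] by (intro sum.cong refl) (simp add: cell_term_def)
  also have "(\<Sum>j<n. \<Sum>k<n. (?v (Suc j) k - ?v j k)) = (\<Sum>k<n. ?v n k - ?v 0 k)"
    by (subst sum.swap) (intro sum.cong refl, rule sum_lessThan_telescope[of "\<lambda>j. ?v j _"])
  also have "(\<Sum>j<n. \<Sum>k<n. (?h j (Suc k) - ?h j k)) = (\<Sum>j<n. ?h j n - ?h j 0)"
    by (intro sum.cong refl, rule sum_lessThan_telescope[of "?h _"])
  finally show ?thesis by (simp add: sum_subtractf)
qed

text \<open>The values \<open>\<kappa> = 0\<close> and \<open>\<epsilon> = 0\<close> are allowed: a cell whose image lies where \<open>q\<close> vanishes contributes
exactly zero, however wild the image is. Otherwise the expression next to \<open>\<kappa>\<close> approximates the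
oriented area of the image.\<close>

lemma cell_term_estimate:
  assumes q: "continuous_on UNIV q"
    and dom: "\<And>w. w \<in> {a, b, c, d} \<Longrightarrow> x0 \<le> Re w \<and> 0 \<le> Im w"
    and near: "b \<in> cball a \<rho>" "c \<in> cball a \<rho>" "d \<in> cball a \<rho>"
    and bd: "\<And>w. w \<in> cball a (2 * \<rho>) \<Longrightarrow> \<bar>q w - \<kappa>\<bar> \<le> \<epsilon>"
  shows "\<bar>cell_term (box_integral q x0) a b c d
      - \<kappa> * ((Re c - Re d) * (Im d - Im a) - (Re c - Re b) * (Im b - Im a))\<bar>
    \<le> \<epsilon> * (cmod (c - d) * cmod (d - a) + cmod (c - b) * cmod (b - a))"
proof -
  have \<rho>: "0 \<le> \<rho>" using near(1) by (meson mem_cball zero_le_dist order_trans)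
  have \<epsilon>: "0 \<le> \<epsilon>" using bd[of a] \<rho> by auto
  have co: "\<bar>Re w - Re a\<bar> \<le> \<rho> \<and> \<bar>Im w - Im a\<bar> \<le> \<rho>" if "w \<in> {b, c, d}" for w
    using that near abs_Re_le_cmod[of "w - a"] abs_Im_le_cmod[of "w - a"]
    by (auto simp: dist_norm norm_minus_commute)
  have box: "Complex u v \<in> cball a (2 * \<rho>)" if "\<bar>u - Re a\<bar> \<le> \<rho>" "\<bar>v - Im a\<bar> \<le> \<rho>" for u v
    using that cmod_le[of "Complex u v - a"] by (simp add: dist_norm norm_minus_commute)
  have seg: "\<bar>u - z\<bar> \<le> \<rho>" if "u \<in> closed_segment x y" "\<bar>x - z\<bar> \<le> \<rho>" "\<bar>y - z\<bar> \<le> \<rho>" for u x y z :: real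
    using that by (auto simp: closed_segment_eq_real_ivl split: if_splits)
  have *: "\<bar>mixed_diff (box_integral q x0) (Re w) (Re c) (Im a) (Im w) - \<kappa> * (Re c - Re w) * (Im w - Im a)\<bar>
      \<le> \<epsilon> * (cmod (c - w) * cmod (w - a))" if w: "w \<in> {b, d}" for w
  proof -
    have "\<bar>mixed_diff (box_integral q x0) (Re w) (Re c) (Im a) (Im w) - \<kappa> * (Re c - Re w) * (Im w - Im a)\<bar>
      \<le> \<epsilon> * \<bar>Re c - Re w\<bar> * \<bar>Im w - Im a\<bar>"
    proof (rule mixed_diff_box_integral[OF q])
      fix u v assume "u \<in> closed_segment (Re w) (Re c)" "v \<in> closed_segment (Im a) (Im w)"
      then have "\<bar>u - Re a\<bar> \<le> \<rho>" "\<bar>v - Im a\<bar> \<le> \<rho>"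
        using seg[of u "Re w" "Re c" "Re a"] seg[of v "Im a" "Im w" "Im a"] co[of w] co[of c] w \<rho> by auto
      then show "\<bar>q (Complex u v) - \<kappa>\<bar> \<le> \<epsilon>" by (intro bd box)
    qed (use dom w in auto)
    also have "\<dots> \<le> \<epsilon> * (cmod (c - w) * cmod (w - a))"
      unfolding mult.assoc
      by (intro mult_left_mono mult_mono \<epsilon>)
        (use abs_Re_le_cmod[of "c - w"] abs_Im_le_cmod[of "w - a"] in auto)
    finally show ?thesis .
  qed
  from *[of b] *[of d] show ?thesis
    unfolding cell_term_eq_mixed_diff by (simp add: algebra_simps)
qed

lemma abs_mult_diff_le:
  fixes x y x0 y0 :: real
  shows "\<bar>x * y - x0 * y0\<bar> \<le> \<bar>x - x0\<bar> * \<bar>y\<bar> + \<bar>x0\<bar> * \<bar>y - y0\<bar>"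
proof -
  have "x * y - x0 * y0 = (x - x0) * y + x0 * (y - y0)" by (simp add: algebra_simps)
  then show ?thesis by (metis abs_mult abs_triangle_ineq)
qed

text \<open>The vectors \<open>U\<close> and \<open>V\<close> are the partial derivatives of a map at the first corner of a square of side
\<open>h\<close>, and \<open>\<eta>\<close> is its relative linearisation error on the square.\<close>

lemma cell_term_smooth_estimate:
  assumes q: "continuous_on UNIV q"
    and dom: "\<And>w. w \<in> {a, b, c, d} \<Longrightarrow> x0 \<le> Re w \<and> 0 \<le> Im w"
    and near: "b \<in> cball a \<rho>" "c \<in> cball a \<rho>" "d \<in> cball a \<rho>"
    and bd: "\<And>w. w \<in> cball a (2 * \<rho>) \<Longrightarrow> \<bar>q w - \<kappa>\<bar> \<le> \<epsilon>"
    and lin: "cmod (b - a - h *\<^sub>R U) \<le> \<eta> * h" "cmod (d - a - h *\<^sub>R V) \<le> \<eta> * h"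
      "cmod (c - a - h *\<^sub>R (U + V)) \<le> 2 * \<eta> * h"
    and M: "cmod U \<le> M" "cmod V \<le> M" and \<eta>: "0 \<le> \<eta>" "\<eta> \<le> 1" and h: "0 \<le> h"
  shows "\<bar>cell_term (box_integral q x0) a b c d - \<kappa> * (Re U * Im V - Re V * Im U) * h\<^sup>2\<bar>
    \<le> (\<bar>\<kappa>\<bar> * (8 * M + 6) * \<eta> + 2 * (M + 3) * (M + 1) * \<epsilon>) * h\<^sup>2"
proof -
  have M0: "0 \<le> M" using M(1) norm_ge_zero order_trans by blast
  have \<rho>: "0 \<le> \<rho>" using near(1) by (meson mem_cball zero_le_dist order_trans)
  have \<epsilon>: "0 \<le> \<epsilon>" using bd[of a] \<rho> by auto
  have cd: "cmod (c - d - h *\<^sub>R U) \<le> 3 * \<eta> * h"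
  proof -
    have eq: "c - d - h *\<^sub>R U = (c - a - h *\<^sub>R (U + V)) - (d - a - h *\<^sub>R V)" by (simp add: algebra_simps)
    then show ?thesis using norm_triangle_ineq4[of "c - a - h *\<^sub>R (U + V)" "d - a - h *\<^sub>R V"] lin unfolding eq by linarith
  qed
  have cb: "cmod (c - b - h *\<^sub>R V) \<le> 3 * \<eta> * h"
  proof -
    have eq: "c - b - h *\<^sub>R V = (c - a - h *\<^sub>R (U + V)) - (b - a - h *\<^sub>R U)" by (simp add: algebra_simps)
    then show ?thesis using norm_triangle_ineq4[of "c - a - h *\<^sub>R (U + V)" "b - a - h *\<^sub>R U"] lin unfolding eq by linarith
  qed
  have sz: "cmod z \<le> (M + k * \<eta>) * h" if "cmod (z - h *\<^sub>R W) \<le> k * \<eta> * h" "cmod W \<le> M" for z W k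
  proof -
    have "cmod z \<le> cmod (z - h *\<^sub>R W) + cmod (h *\<^sub>R W)" by (metis diff_add_cancel norm_triangle_ineq)
    also have "cmod (h *\<^sub>R W) \<le> h * M" using h that(2) by (simp add: mult_left_mono)
    finally show ?thesis using that(1) by (simp add: algebra_simps)
  qed
  have pr: "\<bar>Re z * Im w - Re Z * Im W * h\<^sup>2\<bar> \<le> (4 * M + 3) * \<eta> * h\<^sup>2"
    if z: "cmod (z - h *\<^sub>R Z) \<le> 3 * \<eta> * h" "cmod Z \<le> M" and w: "cmod (w - h *\<^sub>R W) \<le> \<eta> * h" "cmod W \<le> M"
    for z w Z W
  proof -
    have "\<bar>Re z * Im w - (h * Re Z) * (h * Im W)\<bar>
        \<le> \<bar>Re z - h * Re Z\<bar> * \<bar>Im w\<bar> + \<bar>h * Re Z\<bar> * \<bar>Im w - h * Im W\<bar>" by (rule abs_mult_diff_le)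
    also have "\<dots> \<le> (3 * \<eta> * h) * ((M + \<eta>) * h) + (h * M) * (\<eta> * h)"
    proof (intro add_mono mult_mono)
      show "\<bar>Re z - h * Re Z\<bar> \<le> 3 * \<eta> * h" using z(1) abs_Re_le_cmod[of "z - h *\<^sub>R Z"] by simp
      show "\<bar>Im w - h * Im W\<bar> \<le> \<eta> * h" using w(1) abs_Im_le_cmod[of "w - h *\<^sub>R W"] by simp
      show "\<bar>Im w\<bar> \<le> (M + \<eta>) * h" using sz[of w W 1] w abs_Im_le_cmod[of w] by simp
      show "\<bar>h * Re Z\<bar> \<le> h * M" using h z(2) abs_Re_le_cmod[of Z] by (simp add: abs_mult mult_left_mono)
    qed (use h \<eta> M0 in auto)
    also have "\<dots> = (4 * M + 3 * \<eta>) * (\<eta> * h\<^sup>2)" by (simp add: algebra_simps power2_eq_square)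
    also have "\<dots> \<le> (4 * M + 3) * (\<eta> * h\<^sup>2)" using \<eta> by (intro mult_right_mono) auto
    finally show ?thesis by (simp add: algebra_simps power2_eq_square)
  qed
  define E where "E = (Re c - Re d) * (Im d - Im a) - (Re c - Re b) * (Im b - Im a)"
  define J where "J = Re U * Im V - Re V * Im U"
  have 1: "\<bar>cell_term (box_integral q x0) a b c d - \<kappa> * E\<bar> \<le> \<epsilon> * (2 * (M + 3) * (M + 1) * h\<^sup>2)"
  proof -
    have "\<bar>cell_term (box_integral q x0) a b c d - \<kappa> * E\<bar> \<le> \<epsilon> * (cmod (c - d) * cmod (d - a) + cmod (c - b) * cmod (b - a))"
      unfolding E_def by (rule cell_term_estimate[OF q dom near bd])
    also have "\<dots> \<le> \<epsilon> * (((M + 3 * \<eta>) * h) * ((M + 1 * \<eta>) * h) + ((M + 3 * \<eta>) * h) * ((M + 1 * \<eta>) * h))"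
      by (intro mult_left_mono add_mono mult_mono sz[OF cd] sz[OF cb] sz[of "d - a" V] sz[of "b - a" U])
        (use lin M \<epsilon> h \<eta> M0 in auto)
    also have "\<dots> \<le> \<epsilon> * (((M + 3) * h) * ((M + 1) * h) + ((M + 3) * h) * ((M + 1) * h))"
      by (intro mult_left_mono add_mono mult_mono mult_right_mono) (use \<epsilon> h \<eta> M0 in auto)
    finally show ?thesis by (simp add: algebra_simps power2_eq_square)
  qed
  have 2: "\<bar>E - J * h\<^sup>2\<bar> \<le> (8 * M + 6) * \<eta> * h\<^sup>2"
    using pr[OF cd M(1), of "d - a" V] pr[OF cb M(2), of "b - a" U] lin M
    unfolding E_def J_def by (simp add: algebra_simps)
  have "\<bar>\<kappa> * E - \<kappa> * J * h\<^sup>2\<bar> = \<bar>\<kappa>\<bar> * \<bar>E - J * h\<^sup>2\<bar>" by (simp add: abs_mult[symmetric] algebra_simps)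
  also have "\<dots> \<le> \<bar>\<kappa>\<bar> * ((8 * M + 6) * \<eta> * h\<^sup>2)" by (intro mult_left_mono 2) auto
  finally show ?thesis using 1 unfolding J_def[symmetric] by (simp add: algebra_simps)
qed

lemma riemann_sum_error:
  fixes g :: "real \<Rightarrow> real"
  assumes "continuous_on {a..a + real n * h} g" "0 \<le> h"
    and "\<And>x x'. x \<in> {a..a + real n * h} \<Longrightarrow> x' \<in> {a..a + real n * h} \<Longrightarrow> \<bar>x - x'\<bar> \<le> h \<Longrightarrow> \<bar>g x - g x'\<bar> \<le> \<epsilon>"
  shows "\<bar>(\<Sum>j<n. g (a + real j * h) * h) - integral {a..a + real n * h} g\<bar> \<le> \<epsilon> * (real n * h)"
  using assms
proof (induction n)
  case (Suc n)
  let ?b = "a + real n * h" and ?c = "a + real (Suc n) * h"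
  have bc: "a \<le> ?b" "?b \<le> ?c" using Suc.prems(2) by (auto simp: algebra_simps)
  have cb: "?c - ?b = h" by (simp add: algebra_simps)
  have IH: "\<bar>(\<Sum>j<n. g (a + real j * h) * h) - integral {a..?b} g\<bar> \<le> \<epsilon> * (real n * h)"
  proof (rule Suc.IH)
    show "continuous_on {a..?b} g" by (rule continuous_on_subset[OF Suc.prems(1)]) (use bc in auto)
    show "\<bar>g x - g x'\<bar> \<le> \<epsilon>" if "x \<in> {a..?b}" "x' \<in> {a..?b}" "\<bar>x - x'\<bar> \<le> h" for x x'
      using that order_trans[OF _ bc(2)] by (intro Suc.prems(3)) (simp_all only: atLeastAtMost_iff)
  qed (rule Suc.prems(2))
  have gi: "g integrable_on {a..?c}" by (rule integrable_continuous_real[OF Suc.prems(1)])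
  have eq: "integral {a..?c} g = integral {a..?b} g + integral {?b..?c} g"
    using Henstock_Kurzweil_Integration.integral_combine[OF bc gi] by simp
  have cont: "continuous_on {?b..?c} g" by (rule continuous_on_subset[OF Suc.prems(1)]) (use bc in auto)
  have "integral {?b..?c} (\<lambda>x. g x - g ?b) = integral {?b..?c} g - g ?b * h"
    using bc cb integral_diff[OF integrable_continuous_real[OF cont] integrable_const_ivl, of "g ?b"] by (simp add: mult.commute)
  moreover have "norm (integral {?b..?c} (\<lambda>x. g x - g ?b)) \<le> \<epsilon> * (?c - ?b)"
  proof (rule integral_bound)
    fix t assume t: "t \<in> {?b..?c}"
    have "t \<in> {a..?c}" "?b \<in> {a..?c}"
      using t bc order_trans[OF bc(1), of t] by (simp_all only: atLeastAtMost_iff simp_thms)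
    moreover have "\<bar>t - ?b\<bar> \<le> h" using t cb by (simp only: atLeastAtMost_iff) linarith
    ultimately have "\<bar>g t - g ?b\<bar> \<le> \<epsilon>" by (rule Suc.prems(3))
    then show "norm (g t - g ?b) \<le> \<epsilon>" by simp
  qed (rule bc(2), rule continuous_on_diff[OF cont continuous_on_const])
  ultimately have "\<bar>integral {?b..?c} g - g ?b * h\<bar> \<le> \<epsilon> * h" unfolding cb by simp
  with IH show ?case unfolding eq by (simp add: algebra_simps)
qed simp

lemma iterated_riemann_sum_error:
  fixes G :: "complex \<Rightarrow> real"
  assumes G: "continuous_on UNIV G" and n: "0 < n" and h: "h = 2 / real n"
    and mod: "\<And>z w. z \<in> cball 0 2 \<Longrightarrow> w \<in> cball 0 2 \<Longrightarrow> dist z w \<le> h \<Longrightarrow> \<bar>G z - G w\<bar> \<le> \<epsilon>"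
  shows "\<bar>(\<Sum>j<n. \<Sum>k<n. G (Complex (-1 + real j * h) (-1 + real k * h)) * h\<^sup>2)
      - integral {-1..1} (\<lambda>x. integral {-1..1} (\<lambda>y. G (Complex x y)))\<bar> \<le> 8 * \<epsilon>"
proof -
  have nh: "real n * h = 2" and h0: "0 < h" using n h by auto
  have e1: "(-1::real) + real n * h = 1" using nh by simp
  have sq: "Complex x y \<in> cball 0 2" if "x \<in> {-1..1}" "y \<in> {-1..1}" for x y
    using that cmod_le[of "Complex x y"] by (auto simp: abs_if split: if_splits)
  define J where "J x = integral {-1..1} (\<lambda>y. G (Complex x y))" for x
  have sl: "continuous_on S (\<lambda>y. G (Complex x y))" for S x
    by (rule continuous_on_Complex_slice[OF G])
  have contJ: "continuous_on UNIV J"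
    unfolding J_def interval_cbox
    by (rule integral_continuous_on_param) (auto intro!: continuous_on_compose2[OF G] continuous_intros simp: case_prod_unfold)
  have Jmod: "\<bar>J x - J x'\<bar> \<le> 2 * \<epsilon>" if "x \<in> {-1..1}" "x' \<in> {-1..1}" "\<bar>x - x'\<bar> \<le> h" for x x'
  proof -
    have "J x - J x' = integral {-1..1} (\<lambda>y. G (Complex x y) - G (Complex x' y))"
      unfolding J_def by (subst integral_diff) (auto intro!: integrable_continuous_real sl)
    moreover have "norm (integral {-1..1} (\<lambda>y. G (Complex x y) - G (Complex x' y))) \<le> \<epsilon> * (1 - (-1))"
      by (rule integral_bound)
        (use that in \<open>auto intro!: continuous_intros sl mod sq simp del: mem_cball simp: dist_norm cmod_def\<close>)
    ultimately show ?thesis by simp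
  qed
  have row: "\<bar>(\<Sum>k<n. G (Complex x (-1 + real k * h)) * h) - J x\<bar> \<le> 2 * \<epsilon>" if x: "x \<in> {-1..1}" for x
  proof -
    have "\<bar>(\<Sum>k<n. G (Complex x (-1 + real k * h)) * h) - integral {-1..-1 + real n * h} (\<lambda>y. G (Complex x y))\<bar> \<le> \<epsilon> * (real n * h)"
      by (rule riemann_sum_error) (use h0 e1 x in \<open>auto intro!: sl mod sq simp del: mem_cball simp: dist_norm cmod_def\<close>)
    then show ?thesis unfolding e1 nh J_def by simp
  qed
  have col: "\<bar>(\<Sum>j<n. J (-1 + real j * h) * h) - integral {-1..1} J\<bar> \<le> 4 * \<epsilon>"
  proof -
    have "\<bar>(\<Sum>j<n. J (-1 + real j * h) * h) - integral {-1..-1 + real n * h} J\<bar> \<le> (2 * \<epsilon>) * (real n * h)"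
      by (rule riemann_sum_error) (use h0 e1 in \<open>auto intro!: continuous_on_subset[OF contJ] Jmod\<close>)
    then show ?thesis unfolding e1 nh by simp
  qed
  have "\<bar>(\<Sum>j<n. \<Sum>k<n. G (Complex (-1 + real j * h) (-1 + real k * h)) * h\<^sup>2) - (\<Sum>j<n. J (-1 + real j * h) * h)\<bar>
     = \<bar>\<Sum>j<n. ((\<Sum>k<n. G (Complex (-1 + real j * h) (-1 + real k * h)) * h) - J (-1 + real j * h)) * h\<bar>"
    by (simp add: sum_subtractf sum_distrib_right left_diff_distrib power2_eq_square mult.assoc)
  also have "\<dots> \<le> (\<Sum>j<n. 2 * \<epsilon> * h)"
  proof (rule order_trans[OF sum_abs], rule sum_mono)
    fix j assume "j \<in> {..<n}"
    then have "real j * h \<le> real n * h" using h0 by (intro mult_right_mono) auto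
    then have "-1 + real j * h \<in> {-1..1}" using nh h0 by auto
    then show "\<bar>((\<Sum>k<n. G (Complex (-1 + real j * h) (-1 + real k * h)) * h) - J (-1 + real j * h)) * h\<bar> \<le> 2 * \<epsilon> * h"
      unfolding abs_mult using row[of "-1 + real j * h"] h0 by simp
  qed
  also have "\<dots> = 4 * \<epsilon>" using nh by (simp add: algebra_simps)
  finally show ?thesis using col unfolding J_def by linarith
qed

text \<open>Fubini's theorem, transferred along the isometry between pairs of reals and complex numbers.\<close>

lemma integral_complex_square:
  fixes G :: "complex \<Rightarrow> real"
  assumes G: "continuous_on UNIV G"
  shows "(G has_integral integral {-1..1} (\<lambda>x. integral {-1..1} (\<lambda>y. G (Complex x y))))
    (cbox (Complex (-1) (-1)) (Complex 1 1))"
proof -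
  define C where "C = (\<lambda>p. Complex (fst p) (snd p))"
  define D where "D = (\<lambda>z. (Re z, Im z))"
  have CD: "C (D z) = z" and DC: "D (C p) = p" for z p by (simp_all add: C_def D_def)
  have boxC: "C ` cbox u v = cbox (C u) (C v)" for u v
  proof (intro set_eqI iffI)
    fix z assume "z \<in> cbox (C u) (C v)"
    then have "D z \<in> cbox u v"
      by (cases u; cases v) (auto simp: C_def D_def in_cbox_complex_iff cbox_Pair_eq)
    then show "z \<in> C ` cbox u v" by (metis CD imageI)
  qed (cases u; cases v; auto simp: C_def in_cbox_complex_iff cbox_Pair_eq)
  have boxD: "D ` cbox u v = cbox (D u) (D v)" for u v
    using boxC[of "D u" "D v"] by (metis (no_types, lifting) CD DC image_image image_cong image_ident)
  have cont: "measure lborel (D ` cbox u v) = 1 * measure lborel (cbox u v)" for u v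
    unfolding boxD unfolding D_def content_Pair
    by (auto simp: content_cbox_if[of u v] Basis_complex_def box_eq_empty content_real_if)
  define G' where "G' p = G (C p)" for p
  have cG': "continuous_on S G'" for S unfolding G'_def C_def
    by (intro continuous_on_compose2[OF G] continuous_intros) auto
  have "(G' has_integral integral (cbox (-1, -1) (1, 1)) G') (cbox (-1, -1) (1, 1))"
    by (intro integrable_integral integrable_continuous cG')
  then have "(G' has_integral integral {-1..1} (\<lambda>x. integral {-1..1} (\<lambda>y. G (Complex x y)))) (cbox (-1, -1) (1, 1))"
    by (subst (asm) integral_prod_continuous[OF cG']) (simp add: G'_def C_def cbox_interval)
  from has_integral_twiddle[of 1 C D, OF _ CD DC _ _ _ _ this]
  have "((\<lambda>z. G' (D z)) has_integral (1/1) *\<^sub>R integral {-1..1} (\<lambda>x. integral {-1..1} (\<lambda>y. G (Complex x y)))) (C ` cbox (-1, -1) (1, 1))"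
    using boxC boxD cont by (auto simp: D_def intro!: continuous_intros)
  then show ?thesis unfolding boxC G'_def CD by (simp add: C_def)
qed

section \<open>Green's formula for densities vanishing near the boundary\<close>

text \<open>The mean value inequality on small balls: the derivative varies little there, uniformly for
centres in a compact disc, because its two columns are uniformly continuous on a slightly larger
disc.\<close>

lemma uniform_linearization:
  fixes f :: "complex \<Rightarrow> complex"
  assumes diff: "\<And>z. z \<in> ball 0 1 \<Longrightarrow> f differentiable (at z)"
    and cont: "\<And>v. continuous_on (ball 0 1) (\<lambda>z. frechet_derivative f (at z) v)"
    and r: "0 < r" "r < 1" and \<eta>: "0 < \<eta>"
  obtains \<delta> where "0 < \<delta>" "\<delta> \<le> 1 - r"
    "\<And>z w. z \<in> cball 0 r \<Longrightarrow> dist w z < \<delta> \<Longrightarrow>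
      cmod (f w - f z - frechet_derivative f (at z) (w - z)) \<le> \<eta> * cmod (w - z)"
proof -
  define D where "D z = frechet_derivative f (at z)" for z
  define r' where "r' = (1 + r) / 2"
  have r': "r < r'" "r' < 1" using r by (auto simp: r'_def)
  have sub: "cball 0 r' \<subseteq> ball (0::complex) 1" using r' by auto
  have uc: "uniformly_continuous_on (cball 0 r') (\<lambda>z. D z v)" for v
    unfolding D_def
    by (rule compact_uniformly_continuous[OF continuous_on_subset[OF cont sub] compact_cball])
  obtain \<delta>1 where \<delta>1: "\<delta>1 > 0" "\<And>z w. z \<in> cball 0 r' \<Longrightarrow> w \<in> cball 0 r' \<Longrightarrow> dist w z < \<delta>1 \<Longrightarrow> dist (D w 1) (D z 1) < \<eta> / 2"
    using uc[of 1] \<eta> unfolding uniformly_continuous_on_def by (meson half_gt_zero)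
  obtain \<delta>2 where \<delta>2: "\<delta>2 > 0" "\<And>z w. z \<in> cball 0 r' \<Longrightarrow> w \<in> cball 0 r' \<Longrightarrow> dist w z < \<delta>2 \<Longrightarrow> dist (D w \<i>) (D z \<i>) < \<eta> / 2"
    using uc[of \<i>] \<eta> unfolding uniformly_continuous_on_def by (meson half_gt_zero)
  define \<delta> where "\<delta> = min (min \<delta>1 \<delta>2) (r' - r)"
  have lin: "linear (D z)" if "z \<in> ball 0 1" for z
    unfolding D_def using diff[OF that] by (rule linear_frechet_derivative)
  show thesis
  proof
    show "0 < \<delta>" using \<delta>1 \<delta>2 r' by (simp add: \<delta>_def)
    show "\<delta> \<le> 1 - r" using r' by (simp add: \<delta>_def)
    fix z w :: complex assume z: "z \<in> cball 0 r" and w: "dist w z < \<delta>"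
    have in': "x \<in> cball 0 r'" if "x \<in> ball z \<delta>" for x
    proof -
      have "cmod x \<le> cmod z + dist z x" by (metis dist_0_norm dist_triangle)
      then show ?thesis using that z by (auto simp: \<delta>_def)
    qed
    have "norm (f w - f z - D z (w - z)) \<le> norm (w - z) * \<eta>"
    proof (rule differentiable_bound_linearization[where f' = D and ?x0.0 = z])
      show "z + t *\<^sub>R (w - z) \<in> ball z \<delta>" if "t \<in> {0..1}" for t
      proof -
        have "dist z (z + t *\<^sub>R (w - z)) = t * cmod (w - z)" using that by (simp add: dist_norm)
        also have "\<dots> \<le> 1 * cmod (w - z)" using that by (intro mult_right_mono) auto
        finally show ?thesis using w by (simp add: dist_norm)
      qed
      show "z \<in> ball z \<delta>" using \<delta>1 \<delta>2 r' by (simp add: \<delta>_def)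
      fix x assume x: "x \<in> ball z \<delta>"
      then have x1: "x \<in> ball 0 1" using in' sub by blast
      show "(f has_derivative D x) (at x within ball z \<delta>)"
        unfolding D_def using diff[OF x1] frechet_derivative_works has_derivative_at_withinI by blast
      have z1: "z \<in> ball 0 1" using z r by auto
      show "onorm (D x - D z) \<le> \<eta>"
      proof (rule onorm_le)
        fix v :: complex
        have "v = Re v *\<^sub>R 1 + Im v *\<^sub>R \<i>" by (simp add: complex_eq_iff)
        then have ev: "D y v = Re v *\<^sub>R D y 1 + Im v *\<^sub>R D y \<i>" if "y \<in> ball 0 1" for y
          using lin[OF that] by (metis linear_add linear_scale)
        have eq: "(D x - D z) v = Re v *\<^sub>R (D x 1 - D z 1) + Im v *\<^sub>R (D x \<i> - D z \<i>)"
          using ev[OF x1] ev[OF z1] by (simp add: algebra_simps)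
        have "norm ((D x - D z) v) \<le> \<bar>Re v\<bar> * norm (D x 1 - D z 1) + \<bar>Im v\<bar> * norm (D x \<i> - D z \<i>)"
          unfolding eq by (rule order_trans[OF norm_triangle_ineq]) simp
        also have "\<dots> \<le> cmod v * (\<eta> / 2) + cmod v * (\<eta> / 2)"
        proof (intro add_mono mult_mono abs_Re_le_cmod abs_Im_le_cmod)
          have zx: "z \<in> cball 0 r'" "x \<in> cball 0 r'" "dist x z < \<delta>"
            using z r' in'[OF x] x by (auto simp: dist_commute)
          show "norm (D x 1 - D z 1) \<le> \<eta> / 2" "norm (D x \<i> - D z \<i>) \<le> \<eta> / 2"
            using \<delta>1(2)[OF zx(1,2)] \<delta>2(2)[OF zx(1,2)] zx(3) by (auto simp: \<delta>_def dist_norm)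
        qed auto
        finally show "norm ((D x - D z) v) \<le> \<eta> * norm v" by (simp add: mult.commute)
      qed
    qed
    then show "cmod (f w - f z - frechet_derivative f (at z) (w - z)) \<le> \<eta> * cmod (w - z)"
      by (simp add: D_def mult.commute)
  qed
qed

text \<open>No continuity of \<open>\<gamma>'\<close> is asked for: measurability follows from the fundamental theorem of calculus,
and together with boundedness this suffices for all integrals along \<open>\<gamma>\<close>.\<close>

definition piecewise_C1 :: "(real \<Rightarrow> complex) \<Rightarrow> (real \<Rightarrow> complex) \<Rightarrow> bool" where
  "piecewise_C1 \<gamma> \<gamma>' \<longleftrightarrow> continuous_on {0..1} \<gamma> \<and> bounded (\<gamma>' ` {0..1}) \<and>
     (\<exists>S. finite S \<and> (\<forall>t\<in>{0<..<1} - S. (\<gamma> has_vector_derivative \<gamma>' t) (at t)))"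

lemma piecewise_C1_Re_integrable:
  assumes "piecewise_C1 \<gamma> \<gamma>'"
  shows "(\<lambda>t. Re (\<gamma>' t)) absolutely_integrable_on {0..1}"
proof -
  obtain S where S: "finite S" "\<And>t. t \<in> {0<..<1} - S \<Longrightarrow> (\<gamma> has_vector_derivative \<gamma>' t) (at t)"
    using assms unfolding piecewise_C1_def by blast
  obtain B where B: "\<And>t. t \<in> {0..1} \<Longrightarrow> cmod (\<gamma>' t) \<le> B"
    using assms unfolding piecewise_C1_def bounded_iff by blast
  have "(\<gamma>' has_integral (\<gamma> 1 - \<gamma> 0)) {0..1}"
    by (rule fundamental_theorem_of_calculus_interior_strong[OF S(1) _ S(2)])
      (use assms in \<open>auto simp: piecewise_C1_def\<close>)
  from has_integral_Re[OF this] have "(\<lambda>t. Re (\<gamma>' t)) integrable_on {0..1}" by blast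
  then have "(\<lambda>t. Re (\<gamma>' t)) \<in> borel_measurable (lebesgue_on {0..1})"
    by (rule integrable_imp_measurable)
  then show ?thesis
    by (rule measurable_bounded_by_integrable_imp_absolutely_integrable[where g = "\<lambda>_. B"])
      (use B in \<open>auto intro: order_trans[OF abs_Re_le_cmod] simp: integrable_on_const\<close>)
qed

lemma piecewise_C1_dx_integrable:
  fixes P :: "real \<Rightarrow> real"
  assumes "piecewise_C1 \<gamma> \<gamma>'" and P: "continuous_on {0..1} P"
  shows "(\<lambda>t. P t * Re (\<gamma>' t)) absolutely_integrable_on {0..1}"
proof (rule absolutely_integrable_bounded_measurable_product_real)
  show "P \<in> borel_measurable (lebesgue_on {0..1})"
    by (intro continuous_imp_measurable_on_sets_lebesgue P) auto
  show "bounded (P ` {0..1})" by (intro compact_imp_bounded compact_continuous_image P) auto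
qed (use piecewise_C1_Re_integrable[OF assms(1)] in auto)

lemma box_integral_has_derivative:
  assumes q: "continuous_on UNIV q" and "x0 < x" "0 \<le> y"
  shows "((\<lambda>x. box_integral q x0 x y) has_real_derivative column_integral q x y) (at x)"
proof -
  have "((\<lambda>x. box_integral q x0 x y) has_real_derivative column_integral q x y) (at x within {x0..x + 1})"
    unfolding box_integral_def
    by (rule integral_has_real_derivative)
      (use assms in \<open>auto intro!: continuous_on_column_integral_comp continuous_intros\<close>)
  moreover have "at x within {x0..x + 1} = at x"
    by (rule at_within_interior) (use assms in auto)
  ultimately show ?thesis by simp
qed

lemma box_integral_curve_has_integral:
  assumes q: "continuous_on UNIV q" and \<gamma>: "piecewise_C1 \<gamma> \<gamma>'" and s: "0 \<le> s" "s \<le> s'" "s' \<le> 1"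
    and x0: "\<And>t. t \<in> {0..1} \<Longrightarrow> x0 < Re (\<gamma> t)" and y: "0 \<le> y"
  shows "((\<lambda>t. column_integral q (Re (\<gamma> t)) y * Re (\<gamma>' t)) has_integral
     (box_integral q x0 (Re (\<gamma> s')) y - box_integral q x0 (Re (\<gamma> s)) y)) {s..s'}"
proof -
  obtain S where S: "finite S" "\<And>t. t \<in> {0<..<1} - S \<Longrightarrow> (\<gamma> has_vector_derivative \<gamma>' t) (at t)"
    using \<gamma> unfolding piecewise_C1_def by blast
  have cont\<gamma>: "continuous_on {s..s'} \<gamma>" using \<gamma> s unfolding piecewise_C1_def by (auto intro: continuous_on_subset)
  show ?thesis
  proof (rule fundamental_theorem_of_calculus_interior_strong[OF S(1) s(2)])
    fix t assume t: "t \<in> {s<..<s'} - S"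
    have "(\<gamma> has_vector_derivative \<gamma>' t) (at t)" using t s by (intro S(2)) auto
    then have "((\<lambda>t. Re (\<gamma> t)) has_real_derivative Re (\<gamma>' t)) (at t)"
      unfolding has_real_derivative_iff_has_vector_derivative by (rule bounded_linear.has_vector_derivative[OF bounded_linear_Re])
    from DERIV_chain2[OF box_integral_has_derivative[OF q x0 y] this] t s
    show "((\<lambda>t. box_integral q x0 (Re (\<gamma> t)) y) has_vector_derivative column_integral q (Re (\<gamma> t)) y * Re (\<gamma>' t)) (at t)"
      unfolding has_real_derivative_iff_has_vector_derivative[symmetric] by auto
  next
    have "isCont (\<lambda>x. box_integral q x0 x y) x" if "x0 < x" for x
      using box_integral_has_derivative[OF q that y] by (rule DERIV_isCont)
    then have "continuous_on {x0<..} (\<lambda>x. box_integral q x0 x y)" by (intro continuous_at_imp_continuous_on) auto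
    then show "continuous_on {s..s'} (\<lambda>t. box_integral q x0 (Re (\<gamma> t)) y)"
      by (rule continuous_on_compose2) (use x0 s in \<open>auto intro!: continuous_intros cont\<gamma>\<close>)
  qed
qed

definition dx_integral :: "(complex \<Rightarrow> real) \<Rightarrow> (real \<Rightarrow> complex) \<Rightarrow> (real \<Rightarrow> complex) \<Rightarrow> real \<Rightarrow> real" where
  "dx_integral P \<gamma> \<gamma>' s = integral {0..s} (\<lambda>t. P (\<gamma> t) * Re (\<gamma>' t))"

text \<open>Along the curve, \<open>H(x, y)\<close> with frozen \<open>y\<close> has derivative \<open>V(x, y) dx\<close>. Freezing \<open>y\<close> at a nearby point
of the curve changes \<open>V\<close> little, by uniform continuity. The error is proportional to the length of
the parameter interval, so it stays small after summation.\<close>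

lemma edge_term_curve:
  assumes q: "continuous_on UNIV q" and \<gamma>: "piecewise_C1 \<gamma> \<gamma>'"
    and x0: "\<And>t. t \<in> {0..1} \<Longrightarrow> x0 < Re (\<gamma> t) \<and> 0 \<le> Im (\<gamma> t)" and \<epsilon>: "0 < \<epsilon>"
  defines "\<Phi> \<equiv> dx_integral (\<lambda>w. column_integral q (Re w) (Im w)) \<gamma> \<gamma>'"
  obtains \<delta> where "0 < \<delta>" "\<And>s s'. s \<in> {0..1} \<Longrightarrow> s' \<in> {0..1} \<Longrightarrow> \<bar>s - s'\<bar> < \<delta> \<Longrightarrow>
     \<bar>edge_term (box_integral q x0) (\<gamma> s) (\<gamma> s') + (\<Phi> s' - \<Phi> s)\<bar> \<le> \<epsilon> * \<bar>s' - s\<bar>"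
proof -
  obtain B where B: "0 < B" "\<And>t. t \<in> {0..1} \<Longrightarrow> cmod (\<gamma>' t) \<le> B"
    using \<gamma> unfolding piecewise_C1_def bounded_pos by auto
  have cont\<gamma>: "continuous_on {0..1} \<gamma>" using \<gamma> by (simp add: piecewise_C1_def)
  let ?I = "{0..1::real} \<times> {0..1::real}"
  have "continuous_on ?I (\<lambda>p. column_integral q (Re (\<gamma> (fst p))) (Im (\<gamma> (snd p))))"
    by (intro continuous_on_column_integral_comp q continuous_intros continuous_on_compose2[OF cont\<gamma>]) (use x0 in auto)
  then have uc: "uniformly_continuous_on ?I (\<lambda>p. column_integral q (Re (\<gamma> (fst p))) (Im (\<gamma> (snd p))))"
    by (rule compact_uniformly_continuous) (intro compact_Times compact_Icc)
  have "0 < \<epsilon> / B" using \<epsilon> B(1) by simp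
  with uc obtain \<delta> where \<delta>: "\<delta> > 0" "\<And>p p'. p \<in> ?I \<Longrightarrow> p' \<in> ?I \<Longrightarrow> dist p' p < \<delta> \<Longrightarrow>
      dist (column_integral q (Re (\<gamma> (fst p'))) (Im (\<gamma> (snd p')))) (column_integral q (Re (\<gamma> (fst p))) (Im (\<gamma> (snd p)))) < \<epsilon> / B"
    unfolding uniformly_continuous_on_def by blast
  have V: "\<bar>column_integral q (Re (\<gamma> u)) (Im (\<gamma> r)) - column_integral q (Re (\<gamma> u)) (Im (\<gamma> u))\<bar> \<le> \<epsilon> / B"
    if "u \<in> {0..1}" "r \<in> {0..1}" "\<bar>u - r\<bar> < \<delta>" for u r
    using \<delta>(2)[of "(u, u)" "(u, r)"] that by (auto simp: dist_Pair_Pair dist_real_def abs_minus_commute)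
  have "continuous_on {0..1} (\<lambda>t. column_integral q (Re (\<gamma> t)) (Im (\<gamma> t)))"
    by (intro continuous_on_column_integral_comp q continuous_intros cont\<gamma>) (use x0 in auto)
  from piecewise_C1_dx_integrable[OF \<gamma> this]
  have int: "(\<lambda>t. column_integral q (Re (\<gamma> t)) (Im (\<gamma> t)) * Re (\<gamma>' t)) integrable_on {0..1}"
    by (rule set_lebesgue_integral_eq_integral(1))
  have main: "\<bar>box_integral q x0 (Re (\<gamma> s')) (Im (\<gamma> r)) - box_integral q x0 (Re (\<gamma> s)) (Im (\<gamma> r)) - (\<Phi> s' - \<Phi> s)\<bar> \<le> \<epsilon> * (s' - s)"
    if s: "0 \<le> s" "s \<le> s'" "s' \<le> 1" "s' - s < \<delta>" and r: "r \<in> {s..s'}" for s s' r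
  proof -
    have i1: "((\<lambda>t. column_integral q (Re (\<gamma> t)) (Im (\<gamma> r)) * Re (\<gamma>' t)) has_integral
       (box_integral q x0 (Re (\<gamma> s')) (Im (\<gamma> r)) - box_integral q x0 (Re (\<gamma> s)) (Im (\<gamma> r)))) {s..s'}"
      by (rule box_integral_curve_has_integral[OF q \<gamma>]) (use s r x0 in auto)
    have j: "(\<lambda>t. column_integral q (Re (\<gamma> t)) (Im (\<gamma> t)) * Re (\<gamma>' t)) integrable_on {0..s'}"
      "(\<lambda>t. column_integral q (Re (\<gamma> t)) (Im (\<gamma> t)) * Re (\<gamma>' t)) integrable_on {s..s'}"
      by (rule integrable_on_subinterval[OF int]; use s in auto)+
    have "\<Phi> s' - \<Phi> s = integral {s..s'} (\<lambda>t. column_integral q (Re (\<gamma> t)) (Im (\<gamma> t)) * Re (\<gamma>' t))"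
      using Henstock_Kurzweil_Integration.integral_combine[OF s(1,2) j(1)] by (simp add: \<Phi>_def dx_integral_def)
    with integrable_integral[OF j(2)]
    have i2: "((\<lambda>t. column_integral q (Re (\<gamma> t)) (Im (\<gamma> t)) * Re (\<gamma>' t)) has_integral (\<Phi> s' - \<Phi> s)) {s..s'}" by simp
    have "norm (box_integral q x0 (Re (\<gamma> s')) (Im (\<gamma> r)) - box_integral q x0 (Re (\<gamma> s)) (Im (\<gamma> r)) - (\<Phi> s' - \<Phi> s))
      \<le> \<epsilon> * measure lborel {s..s'}"
    proof (rule has_integral_bound_real[OF _ finite.emptyI has_integral_diff[OF i1 i2]])
      fix t assume "t \<in> {s..s'} - {}"
      then have t: "t \<in> {0..1}" "\<bar>t - r\<bar> < \<delta>" using s r by auto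
      have "\<bar>column_integral q (Re (\<gamma> t)) (Im (\<gamma> r)) - column_integral q (Re (\<gamma> t)) (Im (\<gamma> t))\<bar> * \<bar>Re (\<gamma>' t)\<bar> \<le> \<epsilon> / B * B"
        by (intro mult_mono V t order_trans[OF abs_Re_le_cmod B(2)[OF t(1)]]) (use r s B(1) \<epsilon> in auto)
      then show "norm (column_integral q (Re (\<gamma> t)) (Im (\<gamma> r)) * Re (\<gamma>' t) - column_integral q (Re (\<gamma> t)) (Im (\<gamma> t)) * Re (\<gamma>' t)) \<le> \<epsilon>"
        using B(1) by (simp add: left_diff_distrib[symmetric] abs_mult)
    qed (use \<epsilon> in auto)
    then show ?thesis using s by simp
  qed
  show thesis
  proof
    show "0 < \<delta>" by (rule \<delta>(1))
    fix s s' :: real assume s: "s \<in> {0..1}" "s' \<in> {0..1}" "\<bar>s - s'\<bar> < \<delta>"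
    show "\<bar>edge_term (box_integral q x0) (\<gamma> s) (\<gamma> s') + (\<Phi> s' - \<Phi> s)\<bar> \<le> \<epsilon> * \<bar>s' - s\<bar>"
    proof (cases "s \<le> s'")
      case True then show ?thesis using main[of s s' s] s by (auto simp: edge_term_def)
    next
      case False then show ?thesis using main[of s' s s] s by (auto simp: edge_term_def)
    qed
  qed
qed

text \<open>The error of each edge is proportional to the increment of the parameter. As \<open>\<sigma>\<close> is monotone with
values in the unit interval, the absolute increments add up to at most 1.\<close>

lemma edge_terms_tendsto:
  assumes q: "continuous_on UNIV q" and \<gamma>: "piecewise_C1 \<gamma> \<gamma>'"
    and x0: "\<And>t. t \<in> {0..1} \<Longrightarrow> x0 < Re (\<gamma> t) \<and> 0 \<le> Im (\<gamma> t)"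
    and \<sigma>: "continuous_on {a..b} \<sigma>" "\<sigma> ` {a..b} \<subseteq> {0..1}" "a \<le> b"
    and mono: "mono_on {a..b} \<sigma> \<or> antimono_on {a..b} \<sigma>"
  defines "\<Phi> \<equiv> dx_integral (\<lambda>w. column_integral q (Re w) (Im w)) \<gamma> \<gamma>'"
  shows "(\<lambda>n. \<Sum>k<n. edge_term (box_integral q x0) (\<gamma> (\<sigma> (a + real k * ((b - a) / real n))))
            (\<gamma> (\<sigma> (a + real (Suc k) * ((b - a) / real n))))) \<longlonglongrightarrow> \<Phi> (\<sigma> a) - \<Phi> (\<sigma> b)"
proof (rule LIMSEQ_I)
  fix r :: real assume r: "0 < r"
  obtain \<delta> where \<delta>: "0 < \<delta>" "\<And>s s'. s \<in> {0..1} \<Longrightarrow> s' \<in> {0..1} \<Longrightarrow> \<bar>s - s'\<bar> < \<delta> \<Longrightarrow>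
     \<bar>edge_term (box_integral q x0) (\<gamma> s) (\<gamma> s') + (\<Phi> s' - \<Phi> s)\<bar> \<le> r / 2 * \<bar>s' - s\<bar>"
    using edge_term_curve[OF q \<gamma> x0, of "r / 2"] r unfolding \<Phi>_def by auto
  have "uniformly_continuous_on {a..b} \<sigma>" by (rule compact_uniformly_continuous[OF \<sigma>(1) compact_Icc])
  then obtain d where d: "d > 0" "\<And>x x'. x \<in> {a..b} \<Longrightarrow> x' \<in> {a..b} \<Longrightarrow> dist x' x < d \<Longrightarrow> dist (\<sigma> x') (\<sigma> x) < \<delta>"
    using \<delta>(1) unfolding uniformly_continuous_on_def by meson
  obtain N where N: "(b - a) / d < real N" using reals_Archimedean2 by blast
  show "\<exists>no. \<forall>n\<ge>no. norm ((\<Sum>k<n. edge_term (box_integral q x0) (\<gamma> (\<sigma> (a + real k * ((b - a) / real n))))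
            (\<gamma> (\<sigma> (a + real (Suc k) * ((b - a) / real n))))) - (\<Phi> (\<sigma> a) - \<Phi> (\<sigma> b))) < r"
  proof (intro exI[of _ "Suc N"] allI impI)
    fix n assume n: "Suc N \<le> n"
    define h where "h = (b - a) / real n"
    define x where "x k = a + real k * h" for k
    have npos: "0 < real n" using n by simp
    have h0: "0 \<le> h" using \<sigma>(3) by (simp add: h_def)
    have "b - a < real N * d" using N d(1) by (simp add: field_simps)
    also have "\<dots> \<le> real n * d" using n d(1) by (intro mult_right_mono) auto
    finally have hd: "h < d" using npos by (simp add: h_def field_simps)
    have xn: "x n = b" "x 0 = a" using npos by (simp_all add: x_def h_def)
    have xmono: "x k \<le> x l" if "k \<le> l" for k l
      using that h0 by (simp add: x_def mult_right_mono)
    have xin: "x k \<in> {a..b}" if "k \<le> n" for k using xmono[of 0 k] xmono[OF that] xn by simp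
    have st: "\<bar>x (Suc k) - x k\<bar> < d" for k using hd h0 by (simp add: x_def algebra_simps)
    have \<sigma>in: "\<sigma> (x k) \<in> {0..1}" if "k \<le> n" for k using \<sigma>(2) xin[OF that] by blast
    have var: "(\<Sum>k<n. \<bar>\<sigma> (x (Suc k)) - \<sigma> (x k)\<bar>) \<le> 1"
      using mono
    proof
      assume "mono_on {a..b} \<sigma>"
      then have "\<bar>\<sigma> (x (Suc k)) - \<sigma> (x k)\<bar> = \<sigma> (x (Suc k)) - \<sigma> (x k)" if "k < n" for k
        using mono_onD[of "{a..b}" \<sigma> "x k" "x (Suc k)"] xin[of k] xin[of "Suc k"] xmono[of k "Suc k"] that by simp
      then have "(\<Sum>k<n. \<bar>\<sigma> (x (Suc k)) - \<sigma> (x k)\<bar>) = \<sigma> (x n) - \<sigma> (x 0)"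
        by (simp add: sum_lessThan_telescope[of "\<lambda>k. \<sigma> (x k)"])
      then show ?thesis using \<sigma>in[of n] \<sigma>in[of 0] by simp
    next
      assume "antimono_on {a..b} \<sigma>"
      then have "\<bar>\<sigma> (x (Suc k)) - \<sigma> (x k)\<bar> = \<sigma> (x k) - \<sigma> (x (Suc k))" if "k < n" for k
        using monotone_onD[of "{a..b}" "(\<le>)" "(\<ge>)" \<sigma> "x k" "x (Suc k)"] xin[of k] xin[of "Suc k"] xmono[of k "Suc k"] that by simp
      then have "(\<Sum>k<n. \<bar>\<sigma> (x (Suc k)) - \<sigma> (x k)\<bar>) = \<sigma> (x 0) - \<sigma> (x n)"
        by (simp add: sum_lessThan_telescope'[of "\<lambda>k. \<sigma> (x k)"])
      then show ?thesis using \<sigma>in[of n] \<sigma>in[of 0] by simp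
    qed
    have tel: "(\<Sum>k<n. \<Phi> (\<sigma> (x (Suc k))) - \<Phi> (\<sigma> (x k))) = \<Phi> (\<sigma> b) - \<Phi> (\<sigma> a)"
      using sum_lessThan_telescope[of "\<lambda>k. \<Phi> (\<sigma> (x k))" n] xn by simp
    have "\<bar>(\<Sum>k<n. edge_term (box_integral q x0) (\<gamma> (\<sigma> (x k))) (\<gamma> (\<sigma> (x (Suc k))))) - (\<Phi> (\<sigma> a) - \<Phi> (\<sigma> b))\<bar>
       = \<bar>\<Sum>k<n. edge_term (box_integral q x0) (\<gamma> (\<sigma> (x k))) (\<gamma> (\<sigma> (x (Suc k)))) + (\<Phi> (\<sigma> (x (Suc k))) - \<Phi> (\<sigma> (x k)))\<bar>"
      unfolding sum.distrib tel by simp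
    also have "\<dots> \<le> (\<Sum>k<n. r / 2 * \<bar>\<sigma> (x (Suc k)) - \<sigma> (x k)\<bar>)"
    proof (rule order_trans[OF sum_abs], rule sum_mono)
      fix k assume "k \<in> {..<n}"
      then have k: "k \<le> n" "Suc k \<le> n" by auto
      have "dist (\<sigma> (x k)) (\<sigma> (x (Suc k))) < \<delta>"
        using d(2)[OF xin[OF k(2)] xin[OF k(1)]] st[of k] by (simp add: dist_real_def abs_minus_commute)
      then show "\<bar>edge_term (box_integral q x0) (\<gamma> (\<sigma> (x k))) (\<gamma> (\<sigma> (x (Suc k)))) + (\<Phi> (\<sigma> (x (Suc k))) - \<Phi> (\<sigma> (x k)))\<bar>
        \<le> r / 2 * \<bar>\<sigma> (x (Suc k)) - \<sigma> (x k)\<bar>"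
        using \<sigma>in k by (intro \<delta>(2)) (auto simp: dist_real_def)
    qed
    also have "\<dots> \<le> r / 2 * 1" unfolding sum_distrib_left[symmetric] using r by (intro mult_left_mono var) auto
    also have "\<dots> < r" using r by simp
    finally show "norm ((\<Sum>k<n. edge_term (box_integral q x0) (\<gamma> (\<sigma> (a + real k * ((b - a) / real n))))
            (\<gamma> (\<sigma> (a + real (Suc k) * ((b - a) / real n))))) - (\<Phi> (\<sigma> a) - \<Phi> (\<sigma> b))) < r"
      unfolding x_def h_def by simp
  qed
qed

text \<open>The radial retraction of the plane onto the closed unit disc. Composing with it extends \<open>f\<close>
continuously to the square that is cut into cells.\<close>

definition disc_clamp :: "complex \<Rightarrow> complex" where
  "disc_clamp z = z /\<^sub>R max 1 (cmod z)"

lemma disc_clamp_in: "disc_clamp z \<in> cball 0 1"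
  by (auto simp: disc_clamp_def divide_simps max_def)

lemma disc_clamp_id: "cmod z \<le> 1 \<Longrightarrow> disc_clamp z = z"
  by (simp add: disc_clamp_def)

lemma norm_disc_clamp: "cmod (disc_clamp z) = min 1 (cmod z)"
  by (auto simp: disc_clamp_def max_def min_def divide_simps)

lemma continuous_on_disc_clamp: "continuous_on S disc_clamp"
  unfolding disc_clamp_def by (intro continuous_intros) (auto simp: max_def)

definition grid_point :: "nat \<Rightarrow> nat \<Rightarrow> nat \<Rightarrow> complex" where
  "grid_point n j k = Complex (-1 + real j * (2 / real n)) (-1 + real k * (2 / real n))"

text \<open>Outside a smaller disc of radius \<open>r0 < 1\<close> the density vanishes around the image by uniform
continuity of \<open>f\<close>, so a cell starting there contributes zero. If the grid is fine, a cell starting in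
the smaller disc stays in the open unit disc, and the linearisation of \<open>f\<close> at its first corner is
uniformly good on it.\<close>

lemma cell_terms_tendsto:
  fixes f :: "complex \<Rightarrow> complex" and q :: "complex \<Rightarrow> real"
  assumes f: "continuous_on (cball 0 1) f"
    and diff: "\<And>z. z \<in> ball 0 1 \<Longrightarrow> f differentiable (at z)"
    and contD: "\<And>v. continuous_on (ball 0 1) (\<lambda>z. frechet_derivative f (at z) v)"
    and dom: "\<And>z. z \<in> cball 0 1 \<Longrightarrow> x0 \<le> Re (f z) \<and> 0 \<le> Im (f z)"
    and q: "continuous_on UNIV q"
    and \<eta>: "0 < \<eta>" "\<And>z w. z \<in> sphere 0 1 \<Longrightarrow> w \<in> ball (f z) \<eta> \<Longrightarrow> q w = 0"
  defines "G \<equiv> \<lambda>z. if z \<in> ball 0 1 then q (f z) * jacobian f z else 0"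
    and "F \<equiv> \<lambda>z. f (disc_clamp z)"
  shows "continuous_on UNIV G"
    and "(\<lambda>n. \<Sum>j<n. \<Sum>k<n. cell_term (box_integral q x0) (F (grid_point n j k)) (F (grid_point n (Suc j) k))
              (F (grid_point n (Suc j) (Suc k))) (F (grid_point n j (Suc k))))
         \<longlonglongrightarrow> integral {-1..1} (\<lambda>x. integral {-1..1} (\<lambda>y. G (Complex x y)))"
proof -
  define D where "D z = frechet_derivative f (at z)" for z
  have linD: "linear (D z)" if "z \<in> ball 0 1" for z
    unfolding D_def using diff[OF that] by (rule linear_frechet_derivative)
  have contDv: "continuous_on S (\<lambda>z. D z v)" if "S \<subseteq> ball 0 1" for S v
    unfolding D_def by (rule continuous_on_subset[OF contD that])
  have jac: "jacobian f z = Re (D z 1) * Im (D z \<i>) - Re (D z \<i>) * Im (D z 1)" for z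
    by (simp add: jacobian_def D_def Let_def)
  have "uniformly_continuous_on (cball 0 1) f" by (rule compact_uniformly_continuous[OF f compact_cball])
  then obtain \<delta>0 where \<delta>0: "\<delta>0 > 0" "\<And>z w. z \<in> cball 0 1 \<Longrightarrow> w \<in> cball 0 1 \<Longrightarrow> dist w z < \<delta>0 \<Longrightarrow> dist (f w) (f z) < \<eta> / 2"
    using \<eta>(1) unfolding uniformly_continuous_on_def by (meson half_gt_zero)
  define r0 where "r0 = max (1/2) (1 - \<delta>0 / 2)"
  have r0: "0 < r0" "r0 < 1" using \<delta>0(1) by (auto simp: r0_def)
  have van: "q w = 0" if z: "z \<in> cball 0 1" "r0 < cmod z" and w: "w \<in> ball (f z) (\<eta> / 2)" for z w
  proof -
    have z0: "0 < cmod z" using z r0 by linarith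
    have "dist (sgn z) z = cmod ((1 / cmod z - 1) *\<^sub>R z)"
      by (simp add: dist_norm sgn_div_norm scaleR_diff_left divide_inverse)
    also have "\<dots> = (1 / cmod z - 1) * cmod z" using z z0 by (simp add: field_simps)
    also have "\<dots> = 1 - cmod z" using z0 by (simp add: field_simps)
    finally have "dist (sgn z) z < \<delta>0" using z by (auto simp: r0_def)
    moreover have sz: "sgn z \<in> sphere 0 1" using z0 by (simp add: norm_sgn)
    ultimately have "dist (f (sgn z)) (f z) < \<eta> / 2" using z by (intro \<delta>0(2)) auto
    then have "w \<in> ball (f (sgn z)) \<eta>" using w dist_triangle[of "f (sgn z)" w "f z"]
      by (simp add: dist_commute)
    then show ?thesis by (rule \<eta>(2)[OF sz])
  qed
  have G0: "G z = 0" if "z \<notin> cball 0 r0" for z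
    using van[of z "f z"] that \<eta>(1) by (auto simp: G_def)
  have qf: "continuous_on S (\<lambda>z. q (f z))" if "S \<subseteq> cball 0 1" for S
    by (rule continuous_on_compose2[OF q continuous_on_subset[OF f that]]) auto
  show contG: "continuous_on UNIV G"
  proof -
    have "continuous_on (ball 0 1) (\<lambda>z. q (f z) * jacobian f z)"
      unfolding jac by (intro continuous_intros qf contDv) auto
    then have "continuous_on (ball 0 1) G" by (rule continuous_on_eq) (auto simp: G_def)
    moreover have "continuous_on (- cball 0 r0) G"
      by (rule continuous_on_eq[OF continuous_on_const[of _ 0]]) (use G0 in auto)
    ultimately have "continuous_on (ball 0 1 \<union> - cball 0 r0) G" by (intro continuous_on_open_Un) auto
    moreover have "ball 0 1 \<union> - cball 0 r0 = (UNIV :: complex set)" using r0 by auto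
    ultimately show ?thesis by simp
  qed
  have Fb: "F z = f z" if "z \<in> ball 0 1" for z using that by (simp add: F_def disc_clamp_id)
  have contF: "continuous_on S F" for S
    unfolding F_def by (rule continuous_on_compose2[OF f continuous_on_disc_clamp]) (use disc_clamp_in in auto)
  have domF: "x0 \<le> Re (F z) \<and> 0 \<le> Im (F z)" for z
    unfolding F_def by (rule dom[OF disc_clamp_in])
  show "(\<lambda>n. \<Sum>j<n. \<Sum>k<n. cell_term (box_integral q x0) (F (grid_point n j k)) (F (grid_point n (Suc j) k))
              (F (grid_point n (Suc j) (Suc k))) (F (grid_point n j (Suc k))))
         \<longlonglongrightarrow> integral {-1..1} (\<lambda>x. integral {-1..1} (\<lambda>y. G (Complex x y)))" (is "?S \<longlonglongrightarrow> ?L")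
  proof (rule LIMSEQ_I)
    fix r :: real assume r: "0 < r"
    have bdc: "\<exists>M>0. \<forall>z\<in>cball 0 r0. norm (g z) \<le> M" if "continuous_on (cball 0 r0) g" for g :: "complex \<Rightarrow> 'a::real_normed_vector"
      using compact_imp_bounded[OF compact_continuous_image[OF that compact_cball]]
      unfolding bounded_pos by (metis imageI)
    have sub: "cball 0 r0 \<subseteq> ball (0::complex) 1" using r0 by auto
    obtain M1 where M1: "M1 > 0" "\<And>z. z \<in> cball 0 r0 \<Longrightarrow> cmod (D z 1) \<le> M1" using bdc[OF contDv[OF sub, of 1]] by blast
    obtain M2 where M2: "M2 > 0" "\<And>z. z \<in> cball 0 r0 \<Longrightarrow> cmod (D z \<i>) \<le> M2" using bdc[OF contDv[OF sub, of \<i>]] by blast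
    define M where "M = max M1 M2"
    have M: "M > 0" "\<And>z. z \<in> cball 0 r0 \<Longrightarrow> cmod (D z 1) \<le> M" "\<And>z. z \<in> cball 0 r0 \<Longrightarrow> cmod (D z \<i>) \<le> M"
      using M1 M2 by (force simp: M_def)+
    have "cball 0 r0 \<subseteq> cball (0::complex) 1" using r0 by auto
    from bdc[OF qf[OF this]] obtain K where K: "K > 0" "\<And>z. z \<in> cball 0 r0 \<Longrightarrow> \<bar>q (f z)\<bar> \<le> K" by auto
    \<comment> \<open>The square has area 4, so errors \<open>2 * e1 * h\<^sup>2\<close> per cell_term add up to \<open>8 * e1\<close>. The Riemann sum contributes
      another \<open>8 * e1\<close>, which leaves a factor 2 for the strict inequality.\<close>
    define e1 where "e1 = r / 32"
    have e1: "0 < e1" using r by (simp add: e1_def)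
    define \<eta>' where "\<eta>' = min 1 (e1 / (K * (8 * M + 6)))"
    have \<eta>': "0 < \<eta>'" "\<eta>' \<le> 1" "K * (8 * M + 6) * \<eta>' \<le> e1"
    proof -
      define C where "C = K * (8 * M + 6)"
      have C: "0 < C" using K M by (simp add: C_def)
      have "\<eta>' \<le> e1 / C" by (simp add: \<eta>'_def C_def)
      then show "K * (8 * M + 6) * \<eta>' \<le> e1"
        unfolding C_def[symmetric] using C by (simp add: pos_le_divide_eq mult.commute)
      show "0 < \<eta>'" "\<eta>' \<le> 1" using e1 C by (simp_all add: \<eta>'_def C_def[symmetric])
    qed
    define \<epsilon> where "\<epsilon> = e1 / (2 * (M + 3) * (M + 1))"
    have \<epsilon>: "0 < \<epsilon>" "2 * (M + 3) * (M + 1) * \<epsilon> = e1" using e1 M(1) by (simp_all add: \<epsilon>_def)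
    obtain \<delta>1 where \<delta>1: "0 < \<delta>1" "\<delta>1 \<le> 1 - r0"
      "\<And>z w. z \<in> cball 0 r0 \<Longrightarrow> dist w z < \<delta>1 \<Longrightarrow> cmod (f w - f z - D z (w - z)) \<le> \<eta>' * cmod (w - z)"
      using uniform_linearization[OF diff contD r0 \<eta>'(1)] unfolding D_def by blast
    obtain R where R: "R > 0" "\<And>z. z \<in> cball 0 1 \<Longrightarrow> cmod (f z) \<le> R"
      using compact_imp_bounded[OF compact_continuous_image[OF f compact_cball]]
      unfolding bounded_pos by (metis imageI)
    have "uniformly_continuous_on (cball 0 (R + 1)) q"
      by (rule compact_uniformly_continuous[OF continuous_on_subset[OF q] compact_cball]) auto
    then obtain \<rho>0 where \<rho>0: "\<rho>0 > 0" "\<And>z w. z \<in> cball 0 (R + 1) \<Longrightarrow> w \<in> cball 0 (R + 1) \<Longrightarrow> dist w z < \<rho>0 \<Longrightarrow> dist (q w) (q z) < \<epsilon>"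
      using \<epsilon>(1) unfolding uniformly_continuous_on_def by meson
    define \<rho> where "\<rho> = min (\<eta> / 8) (min (\<rho>0 / 4) (1 / 2))"
    have \<rho>: "0 < \<rho>" "2 * \<rho> < \<eta> / 2" "2 * \<rho> < \<rho>0" "2 * \<rho> \<le> 1" using \<eta>(1) \<rho>0(1) by (auto simp: \<rho>_def)
    have "uniformly_continuous_on (cball 0 2) F" by (rule compact_uniformly_continuous[OF contF compact_cball])
    then obtain \<delta>2 where \<delta>2: "\<delta>2 > 0" "\<And>z w. z \<in> cball 0 2 \<Longrightarrow> w \<in> cball 0 2 \<Longrightarrow> dist w z < \<delta>2 \<Longrightarrow> dist (F w) (F z) < \<rho>"
      using \<rho>(1) unfolding uniformly_continuous_on_def by meson
    have "uniformly_continuous_on (cball 0 2) G"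
      by (rule compact_uniformly_continuous[OF continuous_on_subset[OF contG] compact_cball]) auto
    then obtain \<delta>3 where \<delta>3: "\<delta>3 > 0" "\<And>z w. z \<in> cball 0 2 \<Longrightarrow> w \<in> cball 0 2 \<Longrightarrow> dist w z < \<delta>3 \<Longrightarrow> dist (G w) (G z) < e1"
      using e1 unfolding uniformly_continuous_on_def by meson
    define \<delta> where "\<delta> = min \<delta>1 (min \<delta>2 \<delta>3)"
    have \<delta>: "0 < \<delta>" using \<delta>1 \<delta>2 \<delta>3 by (simp add: \<delta>_def)
    obtain N where N: "4 / \<delta> < real N" using reals_Archimedean2 by blast
    show "\<exists>no. \<forall>n\<ge>no. norm (?S n - ?L) < r"
    proof (intro exI[of _ "Suc N"] allI impI)
      fix n assume n: "Suc N \<le> n"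
      define h where "h = 2 / real n"
      have n0: "0 < n" "0 < real n" using n by auto
      have h0: "0 < h" using n0 by (simp add: h_def)
      have nh: "real n * h = 2" using n0 by (simp add: h_def)
      have "4 < real N * \<delta>" using N \<delta> by (simp add: field_simps)
      also have "\<dots> \<le> real n * \<delta>" using n \<delta> by (intro mult_right_mono) auto
      finally have h\<delta>: "2 * h < \<delta>" using n0 by (simp add: h_def field_simps)
      let ?p = "grid_point n"
      have pS: "?p (Suc j) k = ?p j k + of_real h" "?p j (Suc k) = ?p j k + of_real h * \<i>" for j k
        by (simp_all add: grid_point_def complex_eq_iff h_def[symmetric] algebra_simps)
      have pin: "?p j k \<in> cball 0 2" if "j \<le> n" "k \<le> n" for j k
      proof -
        have *: "\<bar>-1 + real i * h\<bar> \<le> 1" if "i \<le> n" for i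
        proof -
          have "real i * h \<le> real n * h" using that h0 by (intro mult_right_mono) auto
          then show ?thesis using nh h0 by (auto simp: abs_le_iff)
        qed
        show ?thesis using cmod_le[of "?p j k"] *[OF that(1)] *[OF that(2)]
          by (simp add: grid_point_def h_def[symmetric])
      qed
      have cellest: "\<bar>cell_term (box_integral q x0) (F (?p j k)) (F (?p (Suc j) k)) (F (?p (Suc j) (Suc k))) (F (?p j (Suc k)))
          - G (?p j k) * h\<^sup>2\<bar> \<le> 2 * e1 * h\<^sup>2" if jk: "j < n" "k < n" for j k
      proof -
        define z where "z = ?p j k"
        define zb where "zb = z + of_real h"
        define zd where "zd = z + of_real h * \<i>"
        define zc where "zc = z + of_real h * (1 + \<i>)"
        have pts: "?p (Suc j) k = zb" "?p j (Suc k) = zd" "?p (Suc j) (Suc k) = zc"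
          by (simp_all add: pS zb_def zd_def zc_def z_def algebra_simps)
        \<comment> \<open>The diagonal of a cell_term is bounded crudely by \<open>2 * h\<close>.\<close>
        have "cmod (1 + \<i>) \<le> 2" using norm_triangle_ineq[of 1 \<i>] by simp
        then have c2: "h * cmod (1 + \<i>) \<le> 2 * h" using h0 by simp
        have dst: "dist zb z \<le> 2 * h" "dist zd z \<le> 2 * h" "dist zc z \<le> 2 * h"
          using h0 c2 by (auto simp: zb_def zd_def zc_def dist_norm norm_mult)
        have sq: "z \<in> cball 0 2" "zb \<in> cball 0 2" "zc \<in> cball 0 2" "zd \<in> cball 0 2"
          using pin[of j k] pin[of "Suc j" k] pin[of j "Suc k"] pin[of "Suc j" "Suc k"] jk
          unfolding pts z_def by auto
        have near: "F zb \<in> cball (F z) \<rho>" "F zc \<in> cball (F z) \<rho>" "F zd \<in> cball (F z) \<rho>"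
          using \<delta>2(2)[OF sq(1,2)] \<delta>2(2)[OF sq(1,3)] \<delta>2(2)[OF sq(1,4)] dst h\<delta>
          by (auto simp: \<delta>_def dist_commute)
        have dm: "x0 \<le> Re w \<and> 0 \<le> Im w" if "w \<in> {F z, F zb, F zc, F zd}" for w
          using that domF by auto
        show ?thesis
        proof (cases "z \<in> cball 0 r0")
          case False
          have "cmod (disc_clamp z) > r0" using False r0 by (simp add: norm_disc_clamp)
          then have v: "q w = 0" if "w \<in> ball (F z) (\<eta> / 2)" for w
            using van[OF disc_clamp_in] that unfolding F_def by blast
          have "\<bar>cell_term (box_integral q x0) (F z) (F zb) (F zc) (F zd)
            - 0 * ((Re (F zc) - Re (F zd)) * (Im (F zd) - Im (F z)) - (Re (F zc) - Re (F zb)) * (Im (F zb) - Im (F z)))\<bar>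
            \<le> 0 * (cmod (F zc - F zd) * cmod (F zd - F z) + cmod (F zc - F zb) * cmod (F zb - F z))"
          proof (rule cell_term_estimate[OF q dm near])
            fix w assume "w \<in> cball (F z) (2 * \<rho>)"
            then have "w \<in> ball (F z) (\<eta> / 2)" using \<rho>(2) by simp
            then show "\<bar>q w - 0\<bar> \<le> 0" using v by simp
          qed
          then show ?thesis using G0[OF False] e1 h0 unfolding pts z_def[symmetric] by simp
        next
          case True
          have zb1: "w \<in> ball 0 1" if "dist w z \<le> 2 * h" for w
          proof -
            have "cmod w \<le> cmod z + dist w z" by (metis dist_0_norm dist_triangle dist_commute)
            then show ?thesis using that h\<delta> \<delta>1(2) True by (simp add: \<delta>_def)
          qed
          have Fz: "F z = f z" "F zb = f zb" "F zc = f zc" "F zd = f zd"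
            using zb1[of z] zb1[OF dst(1)] zb1[OF dst(2)] zb1[OF dst(3)] h0 by (auto intro!: Fb)
          have z1: "z \<in> ball 0 1" using zb1[of z] h0 by simp
          have Dlin: "D z (of_real h) = h *\<^sub>R D z 1" "D z (of_real h * \<i>) = h *\<^sub>R D z \<i>"
            "D z (of_real h * (1 + \<i>)) = h *\<^sub>R (D z 1 + D z \<i>)"
            using linear_scale[OF linD[OF z1], of h 1] linear_scale[OF linD[OF z1], of h \<i>]
              linear_scale[OF linD[OF z1], of h "1 + \<i>"] linear_add[OF linD[OF z1], of 1 \<i>]
            by (simp_all add: scaleR_conv_of_real)
          have L: "cmod (f w - f z - D z (w - z)) \<le> \<eta>' * cmod (w - z)" if "dist w z \<le> 2 * h" for w
            by (rule \<delta>1(3)[OF True]) (use that h\<delta> in \<open>simp add: \<delta>_def\<close>)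
          have "\<bar>cell_term (box_integral q x0) (F z) (F zb) (F zc) (F zd) - q (f z) * (Re (D z 1) * Im (D z \<i>) - Re (D z \<i>) * Im (D z 1)) * h\<^sup>2\<bar>
            \<le> (\<bar>q (f z)\<bar> * (8 * M + 6) * \<eta>' + 2 * (M + 3) * (M + 1) * \<epsilon>) * h\<^sup>2"
          proof (rule cell_term_smooth_estimate[OF q dm near])
            fix w assume w: "w \<in> cball (F z) (2 * \<rho>)"
            have "cmod (f z) \<le> R" using R(2) z1 by simp
            moreover have "cmod w \<le> cmod (f z) + dist (f z) w" by (metis dist_0_norm dist_triangle)
            ultimately have "dist (q w) (q (f z)) < \<epsilon>"
              using w \<rho> unfolding Fz by (intro \<rho>0(2)) (auto simp: dist_commute)
            then show "\<bar>q w - q (f z)\<bar> \<le> \<epsilon>" by (simp add: dist_real_def)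
          next
            show "cmod (F zb - F z - h *\<^sub>R D z 1) \<le> \<eta>' * h"
              using L[OF dst(1)] h0 unfolding Fz by (simp add: zb_def Dlin)
            show "cmod (F zd - F z - h *\<^sub>R D z \<i>) \<le> \<eta>' * h"
              using L[OF dst(2)] h0 unfolding Fz by (simp add: zd_def Dlin norm_mult)
            have "\<eta>' * (h * cmod (1 + \<i>)) \<le> \<eta>' * (2 * h)" using c2 \<eta>'(1) by (intro mult_left_mono) auto
            then show "cmod (F zc - F z - h *\<^sub>R (D z 1 + D z \<i>)) \<le> 2 * \<eta>' * h"
              using L[OF dst(3)] h0 unfolding Fz by (simp add: zc_def Dlin norm_mult)
          qed (use M True \<eta>' h0 in auto)
          also have "\<dots> \<le> (2 * e1) * h\<^sup>2"
          proof (rule mult_right_mono)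
            have "\<bar>q (f z)\<bar> * ((8 * M + 6) * \<eta>') \<le> K * ((8 * M + 6) * \<eta>')"
              using K(2)[OF True] M(1) \<eta>'(1) by (intro mult_right_mono) auto
            then show "\<bar>q (f z)\<bar> * (8 * M + 6) * \<eta>' + 2 * (M + 3) * (M + 1) * \<epsilon> \<le> 2 * e1"
              using \<eta>'(3) \<epsilon>(2) by (simp add: mult.assoc)
          qed simp
          finally show ?thesis using z1 unfolding pts z_def[symmetric] G_def jac by simp
        qed
      qed
      have riem: "\<bar>(\<Sum>j<n. \<Sum>k<n. G (?p j k) * h\<^sup>2) - ?L\<bar> \<le> 8 * e1"
        unfolding grid_point_def h_def[symmetric]
      proof (rule iterated_riemann_sum_error[OF contG n0(1) h_def])
        fix z w :: complex assume zw: "z \<in> cball 0 2" "w \<in> cball 0 2" "dist z w \<le> h"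
        then have "dist (G z) (G w) < e1" using h\<delta> h0 by (intro \<delta>3(2)) (auto simp: \<delta>_def)
        then show "\<bar>G z - G w\<bar> \<le> e1" by (simp add: dist_real_def)
      qed
      have "\<bar>?S n - (\<Sum>j<n. \<Sum>k<n. G (?p j k) * h\<^sup>2)\<bar> \<le> (\<Sum>j<n. \<Sum>k<n. 2 * e1 * h\<^sup>2)"
        unfolding sum_subtractf[symmetric]
        by (intro order_trans[OF sum_abs] sum_mono cellest) auto
      also have "\<dots> = 2 * e1 * (real n * h)\<^sup>2" by (simp add: power2_eq_square algebra_simps)
      also have "\<dots> = 8 * e1" unfolding nh by simp
      finally have "\<bar>?S n - ?L\<bar> \<le> 16 * e1" using riem by linarith
      then show "norm (?S n - ?L) < r" using r by (simp add: e1_def)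
    qed
  qed
qed

lemma disc_clamp_unit_mult: "cmod u = 1 \<Longrightarrow> disc_clamp (u * z) = u * disc_clamp z"
  by (simp add: disc_clamp_def norm_mult)

lemma disc_clamp_right: "disc_clamp (Complex 1 \<tau>) = cis (arctan \<tau>)"
proof -
  have "1 \<le> cmod (Complex 1 \<tau>)" by (simp add: complex_norm)
  then show ?thesis
    by (simp add: disc_clamp_def max_absorb2 complex_eq_iff cos_arctan sin_arctan complex_norm divide_inverse mult.commute)
qed

text \<open>The sides of the square arise from the right hand one by multiplication with powers of \<open>\<i>\<close>, which
commutes with the retraction.\<close>

lemma disc_clamp_sides:
  "disc_clamp (Complex \<tau> (-1)) = cis (3 / 2 * pi + arctan \<tau>)"
  "disc_clamp (Complex \<tau> 1) = cis (pi / 2 - arctan \<tau>)"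
  "disc_clamp (Complex (-1) \<tau>) = cis (pi - arctan \<tau>)"
proof -
  have c: "cis (3 * pi / 2) = - \<i>"
    using cis_mult[of pi "pi / 2"] by (simp add: field_simps)
  have "Complex \<tau> (-1) = - \<i> * Complex 1 \<tau>" by (simp add: complex_eq_iff)
  then show "disc_clamp (Complex \<tau> (-1)) = cis (3 / 2 * pi + arctan \<tau>)"
    using disc_clamp_unit_mult[of "- \<i>" "Complex 1 \<tau>"] by (simp add: disc_clamp_right cis_mult[symmetric] c)
  have "Complex \<tau> 1 = \<i> * Complex 1 (- \<tau>)" by (simp add: complex_eq_iff)
  then show "disc_clamp (Complex \<tau> 1) = cis (pi / 2 - arctan \<tau>)"
    using disc_clamp_unit_mult[of "\<i>" "Complex 1 (- \<tau>)"] cis_mult[of "pi / 2" "- arctan \<tau>"]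
    by (simp add: disc_clamp_right arctan_minus)
  have "Complex (-1) \<tau> = (- 1) * Complex 1 (- \<tau>)" by (simp add: complex_eq_iff)
  then show "disc_clamp (Complex (-1) \<tau>) = cis (pi - arctan \<tau>)"
    using disc_clamp_unit_mult[of "-1" "Complex 1 (- \<tau>)"] cis_mult[of pi "- arctan \<tau>"]
    by (simp add: disc_clamp_right arctan_minus)
qed

text \<open>The sum of all cell terms reduces to the boundary of the square. On each side the retraction is
\<open>\<tau> \<mapsto> cis (c \<plusminus> arctan \<tau>)\<close> for a constant \<open>c\<close>, a monotone reparametrisation of an arc of the circle. The angle
0 is in the middle of the right hand side, which is therefore divided into two halves; this
is the reason for using an even number of cells in each direction. The arcs run from angle
\<open>- pi / 4\<close> in steps of \<open>pi / 2\<close>, and in units of the full angle the corners are at \<open>1/8, 3/8, 5/8, 7/8\<close>.\<close>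

theorem green_cutoff:
  fixes f :: "complex \<Rightarrow> complex" and q :: "complex \<Rightarrow> real"
  assumes f: "continuous_on (cball 0 1) f"
    and diff: "\<And>z. z \<in> ball 0 1 \<Longrightarrow> f differentiable (at z)"
    and contD: "\<And>v. continuous_on (ball 0 1) (\<lambda>z. frechet_derivative f (at z) v)"
    and dom: "\<And>z. z \<in> cball 0 1 \<Longrightarrow> 0 \<le> Im (f z)"
    and q: "continuous_on UNIV q"
    and \<eta>: "0 < \<eta>" "\<And>z w. z \<in> sphere 0 1 \<Longrightarrow> w \<in> ball (f z) \<eta> \<Longrightarrow> q w = 0"
    and \<gamma>: "piecewise_C1 \<gamma> \<gamma>'"
    and \<phi>: "continuous_on {0..1} \<phi>" "mono_on {0..1} \<phi>" "\<phi> 0 = 0" "\<phi> 1 = 1"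
    and bd: "\<And>t. t \<in> {0..1} \<Longrightarrow> f (cis (2 * pi * t)) = \<gamma> (\<phi> t)"
  shows "((\<lambda>z. q (f z) * jacobian f z) has_integral
    - dx_integral (\<lambda>w. column_integral q (Re w) (Im w)) \<gamma> \<gamma>' 1) (ball 0 1)"
proof -
  obtain R where R: "\<And>z. z \<in> cball 0 1 \<Longrightarrow> cmod (f z) \<le> R"
    using compact_imp_bounded[OF compact_continuous_image[OF f compact_cball]]
    unfolding bounded_iff by blast
  \<comment> \<open>A base point strictly to the left of the image, so that \<open>box_integral\<close> is differentiable on it.\<close>
  define x0 where "x0 = - R - 1"
  have dom': "x0 < Re (f z) \<and> 0 \<le> Im (f z)" if "z \<in> cball 0 1" for z
    using dom[OF that] R[OF that] abs_Re_le_cmod[of "f z"] by (simp add: x0_def)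
  define F where "F z = f (disc_clamp z)" for z
  define G where "G z = (if z \<in> ball 0 1 then q (f z) * jacobian f z else 0)" for z
  define \<Phi> where "\<Phi> = dx_integral (\<lambda>w. column_integral q (Re w) (Im w)) \<gamma> \<gamma>'"
  let ?c = "edge_term (box_integral q x0)"
  have \<phi>in: "\<phi> t \<in> {0..1}" if "t \<in> {0..1}" for t
    using mono_onD[OF \<phi>(2), of 0 t] mono_onD[OF \<phi>(2), of t 1] that \<phi>(3,4) by auto
  have \<gamma>in: "x0 < Re (\<gamma> s) \<and> 0 \<le> Im (\<gamma> s)" if s: "s \<in> {0..1}" for s
  proof -
    obtain t where "t \<in> {0..1}" "\<phi> t = s"
      using IVT'[of \<phi> 0 s 1] s \<phi> by auto
    then show ?thesis using bd[of t] dom'[of "cis (2 * pi * t)"] by simp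
  qed
  define ang where "ang \<tau> = arctan \<tau> / (2 * pi)" for \<tau>
  have ang_vals: "ang 0 = 0" "ang 1 = 1 / 8" "ang (-1) = - 1 / 8"
    by (simp_all add: ang_def arctan_one arctan_minus)
  have ang_mono: "ang \<tau> \<le> ang \<tau>'" if "\<tau> \<le> \<tau>'" for \<tau> \<tau>'
    using that by (simp add: ang_def divide_right_mono arctan_monotone')
  have ang_bd: "\<bar>ang \<tau>\<bar> \<le> 1 / 8" if "\<tau> \<in> {-1..1}" for \<tau>
    using ang_mono[of "-1" \<tau>] ang_mono[of \<tau> 1] that ang_vals by auto
  have cont_ang: "continuous_on S ang" for S unfolding ang_def by (intro continuous_intros) auto
  define P where "P c s \<tau> = f (cis (2 * pi * (c + s * ang \<tau>)))" for c s \<tau>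
  define S where "S c s a b n = (\<Sum>k<n. ?c (P c s (a + real k * ((b - a) / real n)))
      (P c s (a + real (Suc k) * ((b - a) / real n))))" for c s a b n
  have arc: "S c s a b \<longlonglongrightarrow> \<Phi> (\<phi> (c + s * ang a)) - \<Phi> (\<phi> (c + s * ang b))"
    if ab: "-1 \<le> a" "a \<le> b" "b \<le> 1" and s: "s = 1 \<or> s = -1"
      and in01: "\<And>\<tau>. \<tau> \<in> {a..b} \<Longrightarrow> c + s * ang \<tau> \<in> {0..1}" for a b c s
  proof -
    define \<sigma> where "\<sigma> \<tau> = \<phi> (c + s * ang \<tau>)" for \<tau>
    have "(\<lambda>n. \<Sum>k<n. ?c (\<gamma> (\<sigma> (a + real k * ((b - a) / real n)))) (\<gamma> (\<sigma> (a + real (Suc k) * ((b - a) / real n)))))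
      \<longlonglongrightarrow> \<Phi> (\<sigma> a) - \<Phi> (\<sigma> b)"
      unfolding \<Phi>_def
    proof (rule edge_terms_tendsto[OF q \<gamma> \<gamma>in])
      show "continuous_on {a..b} \<sigma>" unfolding \<sigma>_def
        by (rule continuous_on_compose2[OF \<phi>(1)]) (use in01 in \<open>auto intro!: continuous_intros cont_ang\<close>)
      show "\<sigma> ` {a..b} \<subseteq> {0..1}" using \<phi>in in01 unfolding \<sigma>_def by blast
      show "mono_on {a..b} \<sigma> \<or> antimono_on {a..b} \<sigma>"
        using s
      proof
        assume s1: "s = 1"
        have "mono_on {a..b} \<sigma>" unfolding \<sigma>_def
          by (intro mono_onI mono_onD[OF \<phi>(2)] in01) (use s1 ang_mono in auto)
        then show ?thesis ..
      next
        assume s1: "s = -1"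
        have "antimono_on {a..b} \<sigma>" unfolding \<sigma>_def
          by (intro monotone_onI mono_onD[OF \<phi>(2)] in01) (use s1 ang_mono in auto)
        then show ?thesis ..
      qed
    qed (use ab in auto)
    moreover have "(\<Sum>k<n. ?c (\<gamma> (\<sigma> (a + real k * ((b - a) / real n)))) (\<gamma> (\<sigma> (a + real (Suc k) * ((b - a) / real n)))))
      = S c s a b n" for n
      unfolding S_def
    proof (rule sum.cong[OF refl])
      fix k assume k: "k \<in> {..<n}"
      have inab: "a + real i * ((b - a) / real n) \<in> {a..b}" if "i \<le> n" for i
      proof -
        have "0 < real n" using k by auto
        moreover have "real i * (b - a) \<le> real n * (b - a)" using that ab by (intro mult_right_mono) auto
        ultimately have "real i * ((b - a) / real n) \<le> b - a" by (simp add: field_simps)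
        then show ?thesis using ab by auto
      qed
      have "\<gamma> (\<sigma> \<tau>) = P c s \<tau>" if "\<tau> \<in> {a..b}" for \<tau>
        using bd[OF in01[OF that]] by (simp add: \<sigma>_def P_def)
      then show "?c (\<gamma> (\<sigma> (a + real k * ((b - a) / real n)))) (\<gamma> (\<sigma> (a + real (Suc k) * ((b - a) / real n))))
        = ?c (P c s (a + real k * ((b - a) / real n))) (P c s (a + real (Suc k) * ((b - a) / real n)))"
        using inab[of k] inab[of "Suc k"] k by simp
    qed
    ultimately show ?thesis unfolding \<sigma>_def by simp
  qed
  have cis_shift: "cis (2 * pi * (1 + x)) = cis (2 * pi * x)" for x
    by (simp add: cis_mult[symmetric] distrib_left)
  have Fside: "F (Complex 1 \<tau>) = P 0 1 \<tau>" "F (Complex 1 \<tau>) = P 1 1 \<tau>" "F (Complex \<tau> (-1)) = P (3 / 4) 1 \<tau>"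
    "F (Complex \<tau> 1) = P (1 / 4) (-1) \<tau>" "F (Complex (-1) \<tau>) = P (1 / 2) (-1) \<tau>" for \<tau>
    unfolding F_def P_def disc_clamp_right disc_clamp_sides cis_shift
    by (simp_all add: ang_def algebra_simps)
  let ?B = "\<lambda>n. \<Sum>j<n. ?c (F (grid_point n j 0)) (F (grid_point n (Suc j) 0))"
  let ?R = "\<lambda>n. \<Sum>k<n. ?c (F (grid_point n n k)) (F (grid_point n n (Suc k)))"
  let ?T = "\<lambda>n. \<Sum>j<n. ?c (F (grid_point n j n)) (F (grid_point n (Suc j) n))"
  let ?L = "\<lambda>n. \<Sum>k<n. ?c (F (grid_point n 0 k)) (F (grid_point n 0 (Suc k)))"
  \<comment> \<open>The letters stand for the bottom, right, top and left side of the square.\<close>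
  have sub: "strict_mono (\<lambda>m::nat. 2 * m)" by (simp add: strict_mono_def)
  have side: "(\<lambda>m. C (2 * m)) \<longlonglongrightarrow> \<Phi> (\<phi> (c + s * (- 1 / 8))) - \<Phi> (\<phi> (c + s * (1 / 8)))"
    if C: "\<And>n. C n = S c s (-1) 1 n" and cs: "s = 1 \<or> s = -1" "1 / 8 \<le> c" "c \<le> 7 / 8" for C c s
  proof -
    have "S c s (-1) 1 \<longlonglongrightarrow> \<Phi> (\<phi> (c + s * ang (-1))) - \<Phi> (\<phi> (c + s * ang 1))"
    proof (rule arc)
      show "c + s * ang \<tau> \<in> {0..1}" if "\<tau> \<in> {-1..1}" for \<tau>
        using ang_bd[OF that] cs by (auto simp: abs_le_iff)
    qed (use cs in auto)
    then have "C \<longlonglongrightarrow> \<Phi> (\<phi> (c + s * ang (-1))) - \<Phi> (\<phi> (c + s * ang 1))" unfolding C[abs_def] by simp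
    from LIMSEQ_subseq_LIMSEQ[OF this sub] show ?thesis unfolding ang_vals o_def .
  qed
  have eqs: "?B n = S (3 / 4) 1 (-1) 1 n" "?T n = S (1 / 4) (-1) (-1) 1 n" "?L n = S (1 / 2) (-1) (-1) 1 n" for n
    unfolding S_def by (rule sum.cong[OF refl]; auto simp: grid_point_def Fside)+
  have B: "(\<lambda>m. ?B (2 * m)) \<longlonglongrightarrow> \<Phi> (\<phi> (5 / 8)) - \<Phi> (\<phi> (7 / 8))"
    using side[of ?B, OF eqs(1)] by simp
  have T: "(\<lambda>m. ?T (2 * m)) \<longlonglongrightarrow> \<Phi> (\<phi> (3 / 8)) - \<Phi> (\<phi> (1 / 8))"
    using side[of ?T, OF eqs(2)] by simp
  have L: "(\<lambda>m. ?L (2 * m)) \<longlonglongrightarrow> \<Phi> (\<phi> (5 / 8)) - \<Phi> (\<phi> (3 / 8))"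
    using side[of ?L, OF eqs(3)] by simp
  have R: "(\<lambda>m. ?R (2 * m)) \<longlonglongrightarrow> (\<Phi> (\<phi> (7 / 8)) - \<Phi> (\<phi> 1)) + (\<Phi> (\<phi> 0) - \<Phi> (\<phi> (1 / 8)))"
  proof -
    have le0: "ang \<tau> \<le> 0" if "\<tau> \<le> 0" for \<tau> using ang_mono[OF that] ang_vals by simp
    have ge0: "0 \<le> ang \<tau>" if "0 \<le> \<tau>" for \<tau> using ang_mono[OF that] ang_vals by simp
    have "S 1 1 (-1) 0 \<longlonglongrightarrow> \<Phi> (\<phi> (1 + 1 * ang (-1))) - \<Phi> (\<phi> (1 + 1 * ang 0))"
      by (rule arc) (use ang_bd le0 in \<open>force simp: abs_le_iff\<close>)+
    moreover have "S 0 1 0 1 \<longlonglongrightarrow> \<Phi> (\<phi> (0 + 1 * ang 0)) - \<Phi> (\<phi> (0 + 1 * ang 1))"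
    proof (rule arc)
      show "0 + 1 * ang \<tau> \<in> {0..1}" if "\<tau> \<in> {0..1}" for \<tau>
        using ge0[of \<tau>] ang_mono[of \<tau> 1] ang_vals that by auto
    qed auto
    ultimately have "(\<lambda>m. S 1 1 (-1) 0 m + S 0 1 0 1 m) \<longlonglongrightarrow> (\<Phi> (\<phi> (1 + 1 * ang (-1))) - \<Phi> (\<phi> (1 + 1 * ang 0)))
        + (\<Phi> (\<phi> (0 + 1 * ang 0)) - \<Phi> (\<phi> (0 + 1 * ang 1)))"
      by (rule tendsto_add)
    moreover have "?R (2 * m) = S 1 1 (-1) 0 m + S 0 1 0 1 m" for m
    proof (cases "m = 0")
      case False
      let ?t = "\<lambda>k. ?c (F (grid_point (2 * m) (2 * m) k)) (F (grid_point (2 * m) (2 * m) (Suc k)))"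
      have gp: "grid_point (2 * m) (2 * m) k = Complex 1 (-1 + real k / real m)" for k
        using False by (simp add: grid_point_def)
      have "{..<2 * m} = {..<m} \<union> {m..<m + m}" "{..<m} \<inter> {m..<m + m} = {}" by auto
      then have "?R (2 * m) = (\<Sum>k<m. ?t k) + (\<Sum>k\<in>{m..<m + m}. ?t k)"
        by (simp only: sum.union_disjoint finite_lessThan finite_atLeastLessThan)
      also have "(\<Sum>k\<in>{m..<m + m}. ?t k) = (\<Sum>k<m. ?t (k + m))"
        using sum.shift_bounds_nat_ivl[of ?t 0 m m] by (simp add: atLeast0LessThan)
      also have "\<dots> = S 0 1 0 1 m"
        unfolding S_def
      proof (rule sum.cong[OF refl])
        fix k
        have "-1 + real (k + m) / real m = 0 + real k * ((1 - 0) / real m)"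
          "-1 + real (Suc (k + m)) / real m = 0 + real (Suc k) * ((1 - 0) / real m)"
          using False by (simp_all add: field_simps)
        then show "?t (k + m) = ?c (P 0 1 (0 + real k * ((1 - 0) / real m))) (P 0 1 (0 + real (Suc k) * ((1 - 0) / real m)))"
          unfolding gp by (simp only: Fside(1))
      qed
      also have "(\<Sum>k<m. ?t k) = S 1 1 (-1) 0 m"
        unfolding S_def gp by (rule sum.cong[OF refl]) (simp add: Fside(2))
      finally show ?thesis .
    qed (simp add: S_def)
    ultimately show ?thesis unfolding ang_vals by simp
  qed
  have cells: "(\<lambda>n. \<Sum>j<n. \<Sum>k<n. cell_term (box_integral q x0) (F (grid_point n j k)) (F (grid_point n (Suc j) k))
              (F (grid_point n (Suc j) (Suc k))) (F (grid_point n j (Suc k))))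
         \<longlonglongrightarrow> integral {-1..1} (\<lambda>x. integral {-1..1} (\<lambda>y. G (Complex x y)))"
    and contG: "continuous_on UNIV G"
    using cell_terms_tendsto[OF f diff contD _ q \<eta>, of x0] dom' unfolding F_def G_def
    by (auto simp: less_imp_le)
  from LIMSEQ_subseq_LIMSEQ[OF cells sub]
  have "(\<lambda>m. ?B (2 * m) + ?R (2 * m) - ?T (2 * m) - ?L (2 * m))
      \<longlonglongrightarrow> integral {-1..1} (\<lambda>x. integral {-1..1} (\<lambda>y. G (Complex x y)))"
    unfolding o_def sum_cell_terms[of "box_integral q x0" "\<lambda>j k. F (grid_point _ j k)"] .
  moreover have "(\<lambda>m. ?B (2 * m) + ?R (2 * m) - ?T (2 * m) - ?L (2 * m)) \<longlonglongrightarrow>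
      (\<Phi> (\<phi> (5 / 8)) - \<Phi> (\<phi> (7 / 8))) + ((\<Phi> (\<phi> (7 / 8)) - \<Phi> (\<phi> 1)) + (\<Phi> (\<phi> 0) - \<Phi> (\<phi> (1 / 8))))
      - (\<Phi> (\<phi> (3 / 8)) - \<Phi> (\<phi> (1 / 8))) - (\<Phi> (\<phi> (5 / 8)) - \<Phi> (\<phi> (3 / 8)))"
    by (intro tendsto_add tendsto_diff B R T L)
  ultimately have "integral {-1..1} (\<lambda>x. integral {-1..1} (\<lambda>y. G (Complex x y))) = \<Phi> (\<phi> 0) - \<Phi> (\<phi> 1)"
    using LIMSEQ_unique by fastforce
  also have "\<dots> = - \<Phi> 1" unfolding \<phi>(3,4) by (simp add: \<Phi>_def dx_integral_def)
  finally have "(G has_integral - \<Phi> 1) (cbox (Complex (-1) (-1)) (Complex 1 1))"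
    using integral_complex_square[OF contG] by simp
  then have "((\<lambda>z. q (f z) * jacobian f z) has_integral - \<Phi> 1) (ball 0 1 \<inter> cbox (Complex (-1) (-1)) (Complex 1 1))"
    unfolding G_def by (simp only: has_integral_restrict_Int)
  moreover have "ball 0 1 \<inter> cbox (Complex (-1) (-1)) (Complex 1 1) = ball 0 1"
  proof -
    have "z \<in> cbox (Complex (-1) (-1)) (Complex 1 1)" if "z \<in> ball 0 1" for z
      using that abs_Re_le_cmod[of z] abs_Im_le_cmod[of z] by (auto simp: in_cbox_complex_iff abs_le_iff)
    then show ?thesis by blast
  qed
  ultimately show ?thesis by (simp add: \<Phi>_def)
qed

section \<open>The area of an immersed disc as a boundary integral\<close>

lemma dominated_convergence_ae:
  fixes f :: "nat \<Rightarrow> real \<Rightarrow> real"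
  assumes f: "\<And>k. (f k) integrable_on S" and h: "h integrable_on S"
    and le: "\<And>k x. x \<in> S \<Longrightarrow> \<bar>f k x\<bar> \<le> h x" and N: "negligible N"
    and conv: "\<And>x. x \<in> S - N \<Longrightarrow> (\<lambda>k. f k x) \<longlonglongrightarrow> g x"
  shows "(\<lambda>k. integral S (f k)) \<longlonglongrightarrow> integral S g"
proof -
  define f' where "f' k x = (if x \<in> N then 0 else f k x)" for k x
  define g' where "g' x = (if x \<in> N then 0 else g x)" for x
  have "f' k integrable_on S" for k
    by (rule integrable_spike[OF f[of k] N]) (simp add: f'_def)
  then have "(\<lambda>k. integral S (f' k)) \<longlonglongrightarrow> integral S g'"
  proof (rule dominated_convergence(2)[OF _ h])
    show "norm (f' k x) \<le> h x" if "x \<in> S" for k x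
      using le[OF that, of k] order_trans[OF abs_ge_zero le[OF that, of k]] by (simp add: f'_def)
    show "(\<lambda>k. f' k x) \<longlonglongrightarrow> g' x" if "x \<in> S" for x
      using conv[of x] that by (cases "x \<in> N") (simp_all add: f'_def g'_def)
  qed
  moreover have "integral S (f' k) = integral S (f k)" for k
    by (rule integral_spike[OF N]) (simp add: f'_def)
  moreover have "integral S g' = integral S g"
    by (rule integral_spike[OF N]) (simp add: g'_def)
  ultimately show ?thesis by simp
qed

lemma negligible_piecewise_C1_image:
  assumes "piecewise_C1 \<gamma> \<gamma>'"
  shows "negligible (\<gamma> ` {0..1})"
proof -
  obtain S where S: "finite S" "\<And>t. t \<in> {0<..<1} - S \<Longrightarrow> (\<gamma> has_vector_derivative \<gamma>' t) (at t)"
    using assms unfolding piecewise_C1_def by blast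
  have "negligible (\<gamma> ` ({0<..<1} - S))"
  proof (rule negligible_differentiable_image_lowdim)
    show "\<gamma> differentiable_on ({0<..<1} - S)"
      unfolding differentiable_on_def
      using S(2) by (meson differentiableI_vector differentiable_at_withinI)
  qed simp
  moreover have "negligible (\<gamma> ` (S \<union> {0, 1}))" by (intro negligible_finite finite_imageI) (use S in auto)
  ultimately have "negligible (\<gamma> ` ({0<..<1} - S) \<union> \<gamma> ` (S \<union> {0, 1}))" by (rule negligible_Un)
  then show ?thesis by (rule negligible_subset) force
qed

text \<open>Where the horizontal velocity is nonzero, the map \<open>t \<mapsto> Re (\<gamma> t)\<close> pulls back null sets to null
sets.\<close>

lemma negligible_crossing_abscissae:
  assumes "piecewise_C1 \<gamma> \<gamma>'" "finite E"
  shows "negligible {t \<in> {0..1}. Re (\<gamma> t) \<in> E \<and> Re (\<gamma>' t) \<noteq> 0}"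
proof -
  obtain S where S: "finite S" "\<And>t. t \<in> {0<..<1} - S \<Longrightarrow> (\<gamma> has_vector_derivative \<gamma>' t) (at t)"
    using assms unfolding piecewise_C1_def by blast
  let ?A = "{t \<in> {0<..<1} - S. Re (\<gamma>' t) \<noteq> 0}"
  have "negligible {t \<in> ?A. Re (\<gamma> t) \<in> E}"
  proof (rule negligible_differentiable_vimage[where f' = "\<lambda>t h. h *\<^sub>R Re (\<gamma>' t)"])
    show "negligible E" using assms(2) by (rule negligible_finite)
    fix t assume t: "t \<in> ?A"
    then show "inj (\<lambda>h. h *\<^sub>R Re (\<gamma>' t))" by (auto simp: inj_def)
    have "(\<gamma> has_vector_derivative \<gamma>' t) (at t within ?A)" using S(2)[of t] t by (auto intro: has_vector_derivative_at_within)
    from bounded_linear.has_vector_derivative[OF bounded_linear_Re this]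
    show "((\<lambda>t. Re (\<gamma> t)) has_derivative (\<lambda>h. h *\<^sub>R Re (\<gamma>' t))) (at t within ?A)"
      by (simp add: has_vector_derivative_def)
  qed
  moreover have "negligible (S \<union> {0, 1})" by (intro negligible_finite) (use S in auto)
  ultimately have "negligible ({t \<in> ?A. Re (\<gamma> t) \<in> E} \<union> (S \<union> {0, 1}))" by (rule negligible_Un)
  then show ?thesis by (rule negligible_subset) force
qed

lemma inj_frechet_derivative_if_jacobian:
  assumes "f differentiable (at z)" "jacobian f z \<noteq> 0"
  shows "inj (frechet_derivative f (at z))"
proof -
  let ?D = "frechet_derivative f (at z)"
  have lin: "linear ?D" by (rule linear_frechet_derivative[OF assms(1)])
  have "v = 0" if "?D v = 0" for v
  proof -
    have "v = Re v *\<^sub>R 1 + Im v *\<^sub>R \<i>" by (simp add: complex_eq_iff)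
    then have "?D v = ?D (Re v *\<^sub>R 1 + Im v *\<^sub>R \<i>)" by (rule arg_cong)
    also have "\<dots> = Re v *\<^sub>R ?D 1 + Im v *\<^sub>R ?D \<i>"
      by (simp only: linear_add[OF lin] linear_scale[OF lin])
    finally have z: "Re v *\<^sub>R ?D 1 + Im v *\<^sub>R ?D \<i> = 0" unfolding that by (rule sym)
    have e: "Re v * Re (?D 1) + Im v * Re (?D \<i>) = 0" "Re v * Im (?D 1) + Im v * Im (?D \<i>) = 0"
      using arg_cong[OF z, of Re] arg_cong[OF z, of Im] by simp_all
    have "Re v * jacobian f z = (Re v * Re (?D 1) + Im v * Re (?D \<i>)) * Im (?D \<i>)
        - (Re v * Im (?D 1) + Im v * Im (?D \<i>)) * Re (?D \<i>)"
      "Im v * jacobian f z = (Re v * Im (?D 1) + Im v * Im (?D \<i>)) * Re (?D 1)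
        - (Re v * Re (?D 1) + Im v * Re (?D \<i>)) * Im (?D 1)"
      by (simp_all add: jacobian_def Let_def algebra_simps)
    then have "Re v = 0" "Im v = 0" using assms(2) unfolding e by simp_all
    then show ?thesis by (simp add: complex_eq_iff)
  qed
  then show ?thesis using lin by (simp add: linear_injective_0)
qed

text \<open>This density is zero within distance \<open>1 / n\<close> of \<open>L\<close> and increases with \<open>n\<close> to \<open>1 / y\<^sup>2\<close> off \<open>L\<close>. The lower
bound \<open>b\<close> for the height makes it continuous on the whole plane.\<close>

definition cutoff :: "complex set \<Rightarrow> real \<Rightarrow> nat \<Rightarrow> complex \<Rightarrow> real" where
  "cutoff L b n w = max 0 (min 1 (real n * infdist w L - 1)) / (max b (Im w))\<^sup>2"

text \<open>Green's formula for the densities \<open>cutoff L b n\<close> with \<open>n \<rightarrow> \<infinity>\<close>. The column integrals of these densities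
converge to \<open>2 / b - 1 / y\<close> at all points whose vertical line meets the curve finitely often. At the other
points the curve moves vertically for almost all parameters, so \<open>dx\<close> vanishes there. The
constant \<open>2 / b\<close> integrates to zero because the curve is closed. On the disc, the curve has a null
preimage since \<open>f\<close> is an immersion.\<close>

theorem area_eq_boundary_integral:
  fixes f :: "complex \<Rightarrow> complex"
  assumes imm: "immersed_disc f" and \<gamma>: "piecewise_C1 \<gamma> \<gamma>'"
    and \<phi>: "continuous_on {0..1} \<phi>" "mono_on {0..1} \<phi>" "\<phi> 0 = 0" "\<phi> 1 = 1"
    and bd: "\<And>t. t \<in> {0..1} \<Longrightarrow> f (cis (2 * pi * t)) = \<gamma> (\<phi> t)"
    and E: "finite E" "\<And>x. x \<notin> E \<Longrightarrow> finite {y. Complex x y \<in> \<gamma> ` {0..1}}"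
  shows "signed_area f = integral {0..1} (\<lambda>t. Re (\<gamma>' t) / Im (\<gamma> t))"
proof -
  have f: "continuous_on (cball 0 1) f" and fH: "f ` cball 0 1 \<subseteq> H2"
    and diff: "\<And>z. z \<in> ball 0 1 \<Longrightarrow> f differentiable (at z)"
    and jac0: "\<And>z. z \<in> ball 0 1 \<Longrightarrow> jacobian f z \<noteq> 0"
    and contD: "\<And>v. continuous_on (ball 0 1) (\<lambda>z. frechet_derivative f (at z) v)"
    using imm unfolding immersed_disc_def by blast+
  have cont\<gamma>: "continuous_on {0..1} \<gamma>" using \<gamma> by (simp add: piecewise_C1_def)
  define L where "L = \<gamma> ` {0..1}"
  have L: "closed L" "L \<noteq> {}"
    unfolding L_def by (auto intro!: compact_imp_closed compact_continuous_image cont\<gamma>)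
  have "continuous_on (cball 0 1) (\<lambda>z. Im (f z))" by (intro continuous_intros f)
  from continuous_attains_inf[OF compact_cball _ this]
  obtain z0 where z0: "z0 \<in> cball 0 1" "\<And>z. z \<in> cball 0 1 \<Longrightarrow> Im (f z0) \<le> Im (f z)" by auto
  define b where "b = Im (f z0)"
  have b: "0 < b" "\<And>z. z \<in> cball 0 1 \<Longrightarrow> b \<le> Im (f z)"
    using z0 subsetD[OF fH imageI[OF z0(1)]] by (auto simp: b_def H2_def)
  have \<phi>in: "\<phi> t \<in> {0..1}" if "t \<in> {0..1}" for t
    using mono_onD[OF \<phi>(2), of 0 t] mono_onD[OF \<phi>(2), of t 1] that \<phi>(3,4) by auto
  have b\<gamma>: "b \<le> Im (\<gamma> s)" if s: "s \<in> {0..1}" for s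
  proof -
    obtain t where "t \<in> {0..1}" "\<phi> t = s" using IVT'[of \<phi> 0 s 1] s \<phi> by auto
    then show ?thesis using bd[of t] b(2)[of "cis (2 * pi * t)"] by simp
  qed
  have circ: "f z \<in> L" if z: "z \<in> sphere 0 1" for z
  proof -
    obtain t where t: "0 \<le> t" "t < 2 * pi" "z = cis t"
      using Arg2pi[of z] z by (auto simp: cis_conv_exp is_Arg_def)
    then have "t / (2 * pi) \<in> {0..1}" by (auto simp: field_simps)
    from bd[OF this] \<phi>in[OF this] t show ?thesis by (auto simp: L_def)
  qed
  define q where "q = (\<lambda>n. cutoff L b n)"
  define qi where "qi w = 1 / (max b (Im w))\<^sup>2" for w :: complex
  have mb: "b \<le> max b y" "0 < max b y" for y using b by auto
  have contq: "continuous_on UNIV (q n)" for n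
    unfolding q_def cutoff_def
    by (intro continuous_intros continuous_on_infdist) (use mb(2) in \<open>auto simp: less_le\<close>)
  have contqi: "continuous_on UNIV qi"
    unfolding qi_def by (intro continuous_intros) (use mb(2) in \<open>auto simp: less_le\<close>)
  have qi_le: "0 \<le> qi w" "qi w \<le> 1 / b\<^sup>2" for w
    unfolding qi_def using b mb by (auto intro!: divide_left_mono power_mono mult_pos_pos)
  have q_nonneg: "0 \<le> q n w" for n w by (simp add: q_def cutoff_def)
  have q_le: "q n w \<le> qi w" for n w
    unfolding q_def cutoff_def qi_def by (intro divide_right_mono) auto
  have q_mono: "q n w \<le> q (Suc n) w" for n w
    unfolding q_def cutoff_def
    by (intro divide_right_mono max.mono min.mono diff_right_mono mult_right_mono infdist_nonneg) auto
  have q_lim: "(\<lambda>n. q n w) \<longlonglongrightarrow> (if w \<in> L then 0 else qi w)" for w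
  proof (cases "w \<in> L")
    case True then show ?thesis by (simp add: q_def cutoff_def)
  next
    case False
    then have d: "0 < infdist w L" using L infdist_pos_not_in_closed by blast
    obtain N where N: "2 / infdist w L < real N" using reals_Archimedean2 by blast
    have "q n w = qi w" if "N \<le> n" for n
    proof -
      have "2 < real N * infdist w L" using N d by (simp add: field_simps)
      also have "\<dots> \<le> real n * infdist w L" using that d by (intro mult_right_mono) auto
      finally show ?thesis by (simp add: q_def cutoff_def qi_def)
    qed
    then have "\<forall>\<^sub>F n in sequentially. q n w = qi w" using eventually_sequentially by blast
    then show ?thesis using False by (simp add: tendsto_eventually)
  qed
  define V where "V n w = column_integral (q n) (Re w) (Im w)" for n w
  have V_eq: "V n w = integral {0..Im w} (\<lambda>s. q n (Complex (Re w) s))" for n w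
    by (simp add: V_def column_integral_def)
  have int_slice: "(\<lambda>s. q n (Complex x s)) integrable_on {0..y}" for n x y
    by (intro integrable_continuous_real continuous_on_Complex_slice contq)
  have V_bd: "\<bar>V n w\<bar> \<le> Im w / b\<^sup>2" if "0 \<le> Im w" for n w
  proof -
    have "norm (integral {0..Im w} (\<lambda>s. q n (Complex (Re w) s))) \<le> 1 / b\<^sup>2 * (Im w - 0)"
      by (rule integral_bound) (use that in \<open>auto intro!: continuous_on_Complex_slice contq simp: q_nonneg order_trans[OF q_le qi_le(2)]\<close>)
    then show ?thesis by (simp add: V_eq)
  qed
  have V_lim: "(\<lambda>n. V n w) \<longlonglongrightarrow> 2 / b - 1 / Im w" if w: "b \<le> Im w" "Re w \<notin> E" for w
  proof -
    have fin: "finite {s. Complex (Re w) s \<in> L}" using E(2)[OF w(2)] by (simp add: L_def)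
    have "(\<lambda>n. V n w) \<longlonglongrightarrow> integral {0..Im w} (\<lambda>s. qi (Complex (Re w) s))"
      unfolding V_eq
    proof (rule dominated_convergence_ae[OF int_slice])
      show "(\<lambda>s. 1 / b\<^sup>2) integrable_on {0..Im w}" by (rule integrable_const_ivl)
      show "\<bar>q n (Complex (Re w) s)\<bar> \<le> 1 / b\<^sup>2" for n s
        using q_nonneg[of n] q_le[of n] qi_le(2) by (metis abs_of_nonneg order_trans)
      show "negligible {s. Complex (Re w) s \<in> L}" by (rule negligible_finite[OF fin])
      show "(\<lambda>n. q n (Complex (Re w) s)) \<longlonglongrightarrow> qi (Complex (Re w) s)"
        if "s \<in> {0..Im w} - {s. Complex (Re w) s \<in> L}" for s
        using q_lim[of "Complex (Re w) s"] that by simp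
    qed
    moreover have "((\<lambda>s. qi (Complex (Re w) s)) has_integral (b / b\<^sup>2 + (1 / b - 1 / Im w))) {0..Im w}"
    proof (rule has_integral_combine)
      have "((\<lambda>s. 1 / b\<^sup>2) has_integral b / b\<^sup>2) {0..b}"
        using has_integral_const_real[of "1 / b\<^sup>2" 0 b] b(1) by simp
      then show "((\<lambda>s. qi (Complex (Re w) s)) has_integral b / b\<^sup>2) {0..b}"
        by (rule has_integral_eq[rotated]) (auto simp: qi_def max_def)
      have "((\<lambda>s. 1 / s\<^sup>2) has_integral (- 1 / Im w - - 1 / b)) {b..Im w}"
        by (rule fundamental_theorem_of_calculus[OF w(1)])
          (use b in \<open>auto intro!: derivative_eq_intros
            simp: has_real_derivative_iff_has_vector_derivative[symmetric] power2_eq_square\<close>)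
      then show "((\<lambda>s. qi (Complex (Re w) s)) has_integral (1 / b - 1 / Im w)) {b..Im w}"
        by (rule has_integral_eq_rhs[OF has_integral_eq[rotated]]) (auto simp: qi_def max_def)
    qed (use b w in auto)
    then have "integral {0..Im w} (\<lambda>s. qi (Complex (Re w) s)) = 2 / b - 1 / Im w"
      using b by (simp add: integral_unique power2_eq_square)
    ultimately show ?thesis by simp
  qed
  have contV: "continuous_on {0..1} (\<lambda>t. V n (\<gamma> t))" for n
    unfolding V_def
    by (intro continuous_on_column_integral_comp contq continuous_intros cont\<gamma>) (use b\<gamma> order_trans[OF less_imp_le[OF b(1)]] in blast)
  have Re_int: "(\<lambda>t. Re (\<gamma>' t)) absolutely_integrable_on {0..1}" by (rule piecewise_C1_Re_integrable[OF \<gamma>])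
  obtain B where B: "\<And>t. t \<in> {0..1} \<Longrightarrow> cmod (\<gamma> t) \<le> B"
    using compact_imp_bounded[OF compact_continuous_image[OF cont\<gamma> compact_Icc]]
    unfolding bounded_iff by blast
  have bdlim: "(\<lambda>n. dx_integral (V n) \<gamma> \<gamma>' 1) \<longlonglongrightarrow> integral {0..1} (\<lambda>t. (2 / b - 1 / Im (\<gamma> t)) * Re (\<gamma>' t))"
    unfolding dx_integral_def
  proof (rule dominated_convergence_ae)
    show "(\<lambda>t. V n (\<gamma> t) * Re (\<gamma>' t)) integrable_on {0..1}" for n
      using piecewise_C1_dx_integrable[OF \<gamma> contV] by (rule set_lebesgue_integral_eq_integral(1))
    have "(\<lambda>t. \<bar>Re (\<gamma>' t)\<bar>) integrable_on {0..1}"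
      using Re_int by (simp add: absolutely_integrable_on_def)
    from has_integral_integrable[OF has_integral_mult_right[OF integrable_integral[OF this]]]
    show "(\<lambda>t. B / b\<^sup>2 * \<bar>Re (\<gamma>' t)\<bar>) integrable_on {0..1}" .
    show "\<bar>V n (\<gamma> t) * Re (\<gamma>' t)\<bar> \<le> B / b\<^sup>2 * \<bar>Re (\<gamma>' t)\<bar>" if t: "t \<in> {0..1}" for n t
    proof -
      have "\<bar>V n (\<gamma> t)\<bar> \<le> Im (\<gamma> t) / b\<^sup>2" using V_bd[of "\<gamma> t" n] b\<gamma>[OF t] b(1) by simp
      also have "\<dots> \<le> B / b\<^sup>2"
        using B[OF t] abs_Im_le_cmod[of "\<gamma> t"] by (intro divide_right_mono) auto
      finally show ?thesis unfolding abs_mult by (intro mult_right_mono) auto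
    qed
    show "negligible {t \<in> {0..1}. Re (\<gamma> t) \<in> E \<and> Re (\<gamma>' t) \<noteq> 0}"
      by (rule negligible_crossing_abscissae[OF \<gamma> E(1)])
    fix t assume t: "t \<in> {0..1} - {t \<in> {0..1}. Re (\<gamma> t) \<in> E \<and> Re (\<gamma>' t) \<noteq> 0}"
    show "(\<lambda>n. V n (\<gamma> t) * Re (\<gamma>' t)) \<longlonglongrightarrow> (2 / b - 1 / Im (\<gamma> t)) * Re (\<gamma>' t)"
    proof (cases "Re (\<gamma>' t) = 0")
      case False
      then show ?thesis using t b\<gamma>[of t] by (intro tendsto_mult V_lim tendsto_const) auto
    qed simp
  qed
  have green: "((\<lambda>z. q n (f z) * jacobian f z) has_integral - dx_integral (V n) \<gamma> \<gamma>' 1) (ball 0 1)" for n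
    unfolding V_def
  proof (rule green_cutoff[OF f diff contD _ contq _ _ \<gamma> \<phi> bd])
    show "0 \<le> Im (f z)" if "z \<in> cball 0 1" for z using b(2)[OF that] b(1) by simp
    show "0 < 1 / (real n + 1)" by simp
    fix z w :: complex assume z: "z \<in> sphere 0 1" and w: "w \<in> ball (f z) (1 / (real n + 1))"
    have "infdist w L \<le> dist w (f z)" by (rule infdist_le[OF circ[OF z]])
    also have "\<dots> < 1 / (real n + 1)" using w by (simp add: dist_commute)
    finally have "(real n + 1) * infdist w L < 1" by (simp add: field_simps)
    then have "real n * infdist w L \<le> 1" using infdist_nonneg[of w L] by (simp add: algebra_simps)
    then show "q n w = 0" by (simp add: q_def cutoff_def)
  qed
  \<comment> \<open>The factor \<open>s\<close> makes the integrands increasing in \<open>n\<close>, whatever the orientation of \<open>f\<close> is.\<close>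
  have contJ: "continuous_on (ball 0 1) (jacobian f)"
    unfolding jacobian_def[abs_def] Let_def by (intro continuous_intros contD)
  obtain s :: real where s: "s * s = 1" "\<And>z. z \<in> ball 0 1 \<Longrightarrow> 0 < s * jacobian f z"
  proof -
    have conn: "connected (jacobian f ` ball 0 1)"
      by (rule connected_continuous_image[OF contJ]) (simp add: convex_connected)
    show thesis
    proof (cases "\<forall>z\<in>ball 0 1. 0 < jacobian f z")
      case True then show thesis by (intro that[of 1]) auto
    next
      case False
      then obtain z1 where z1: "z1 \<in> ball 0 1" "jacobian f z1 < 0" using jac0 by (meson linorder_neqE_linordered_idom)
      have "jacobian f z < 0" if "z \<in> ball 0 1" for z
      proof (rule ccontr)
        assume "\<not> jacobian f z < 0"
        then have "0 \<in> jacobian f ` ball 0 1"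
          using connectedD_interval[OF conn, of "jacobian f z1" "jacobian f z" 0] z1 that by auto
        then show False using jac0 by auto
      qed
      then show thesis by (intro that[of "-1"]) auto
    qed
  qed
  have green_s: "((\<lambda>z. s * (q n (f z) * jacobian f z)) has_integral s * - dx_integral (V n) \<gamma> \<gamma>' 1) (ball 0 1)" for n
    by (rule has_integral_mult_right[OF green])
  define g where "g z = (if f z \<in> L then 0 else s * jacobian f z / (Im (f z))\<^sup>2)" for z
  have "g integrable_on ball 0 1 \<and> (\<lambda>n. integral (ball 0 1) (\<lambda>z. s * (q n (f z) * jacobian f z))) \<longlonglongrightarrow> integral (ball 0 1) g"
  proof (rule monotone_convergence_increasing)
    show "(\<lambda>z. s * (q n (f z) * jacobian f z)) integrable_on ball 0 1" for n
      by (rule has_integral_integrable[OF green_s])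
    show "s * (q n (f z) * jacobian f z) \<le> s * (q (Suc n) (f z) * jacobian f z)" if "z \<in> ball 0 1" for n z
      using mult_right_mono[OF q_mono[of n "f z"] less_imp_le[OF s(2)[OF that]]] by (simp add: mult_ac)
    show "(\<lambda>n. s * (q n (f z) * jacobian f z)) \<longlonglongrightarrow> g z" if z: "z \<in> ball 0 1" for z
    proof -
      have "(\<lambda>n. s * (q n (f z) * jacobian f z)) \<longlonglongrightarrow> s * ((if f z \<in> L then 0 else qi (f z)) * jacobian f z)"
        by (intro tendsto_intros q_lim)
      moreover have "max b (Im (f z)) = Im (f z)" using b(2)[of z] z by (simp add: max_absorb2)
      moreover from this have "s * ((if f z \<in> L then 0 else qi (f z)) * jacobian f z) = g z"
        by (simp add: g_def qi_def)
      ultimately show ?thesis by (simp only:)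
    qed
    have "bounded (range (\<lambda>n. dx_integral (V n) \<gamma> \<gamma>' 1))"
      by (rule convergent_imp_bounded[OF bdlim])
    then have "bounded ((\<lambda>x. - s * x) ` range (\<lambda>n. dx_integral (V n) \<gamma> \<gamma>' 1))"
      by (rule bounded_linear_image) (rule bounded_linear_mult_right)
    then show "bounded (range (\<lambda>n. integral (ball 0 1) (\<lambda>z. s * (q n (f z) * jacobian f z))))"
      unfolding integral_unique[OF green_s] by (simp add: image_image)
  qed
  moreover have "(\<lambda>n. integral (ball 0 1) (\<lambda>z. s * (q n (f z) * jacobian f z)))
      \<longlonglongrightarrow> s * - integral {0..1} (\<lambda>t. (2 / b - 1 / Im (\<gamma> t)) * Re (\<gamma>' t))"
    unfolding integral_unique[OF green_s] by (intro tendsto_intros bdlim)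
  ultimately have lim: "integral (ball 0 1) g = s * - integral {0..1} (\<lambda>t. (2 / b - 1 / Im (\<gamma> t)) * Re (\<gamma>' t))"
    using LIMSEQ_unique by blast
  have "negligible {z \<in> ball 0 1. f z \<in> L}"
    by (rule negligible_differentiable_vimage[where f' = "\<lambda>z. frechet_derivative f (at z)"])
      (use negligible_piecewise_C1_image[OF \<gamma>] diff jac0 in \<open>auto simp: L_def inj_frechet_derivative_if_jacobian
         intro: has_derivative_at_withinI frechet_derivative_works[THEN iffD1]\<close>)
  then have "integral (ball 0 1) (\<lambda>z. s * (jacobian f z / (Im (f z))\<^sup>2)) = integral (ball 0 1) g"
    by (rule integral_spike) (auto simp: g_def)
  then have "s * signed_area f = s * - integral {0..1} (\<lambda>t. (2 / b - 1 / Im (\<gamma> t)) * Re (\<gamma>' t))"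
    unfolding signed_area_def using lim by (subst (asm) integral_mult_right) simp
  then have sa: "signed_area f = - integral {0..1} (\<lambda>t. (2 / b - 1 / Im (\<gamma> t)) * Re (\<gamma>' t))"
    using s(1) by (metis mult.assoc mult_1)
  obtain S where S: "finite S" "\<And>t. t \<in> {0<..<1} - S \<Longrightarrow> (\<gamma> has_vector_derivative \<gamma>' t) (at t)"
    using \<gamma> unfolding piecewise_C1_def by blast
  have "(\<gamma>' has_integral (\<gamma> 1 - \<gamma> 0)) {0..1}"
    by (rule fundamental_theorem_of_calculus_interior_strong[OF S(1) _ S(2) cont\<gamma>]) auto
  from has_integral_Re[OF this]
  have "((\<lambda>t. Re (\<gamma>' t)) has_integral (Re (\<gamma> 1) - Re (\<gamma> 0))) {0..1}" by simp
  moreover have "\<gamma> 1 = \<gamma> 0" using bd[of 0] bd[of 1] \<phi>(3,4) by simp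
  ultimately have R0: "((\<lambda>t. Re (\<gamma>' t)) has_integral 0) {0..1}" by simp
  have "continuous_on {0..1} (\<lambda>t. 1 / Im (\<gamma> t))"
    by (intro continuous_intros cont\<gamma>) (use b\<gamma> b(1) in force)
  from piecewise_C1_dx_integrable[OF \<gamma> this]
  have "(\<lambda>t. 1 / Im (\<gamma> t) * Re (\<gamma>' t)) integrable_on {0..1}" by (rule set_lebesgue_integral_eq_integral(1))
  then have "((\<lambda>t. 1 / Im (\<gamma> t) * Re (\<gamma>' t)) has_integral integral {0..1} (\<lambda>t. Re (\<gamma>' t) / Im (\<gamma> t))) {0..1}"
    using integrable_integral[of "\<lambda>t. 1 / Im (\<gamma> t) * Re (\<gamma>' t)" "{0..1}"] by simp
  from has_integral_diff[OF has_integral_mult_right[OF R0, of "2 / b"] this]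
  have "integral {0..1} (\<lambda>t. (2 / b - 1 / Im (\<gamma> t)) * Re (\<gamma>' t)) = - integral {0..1} (\<lambda>t. Re (\<gamma>' t) / Im (\<gamma> t))"
    by (simp add: integral_unique left_diff_distrib)
  then show ?thesis using sa by simp
qed

section \<open>The sides of the pentagon\<close>

definition piecewise_turning :: "(real \<Rightarrow> complex) \<Rightarrow> (real \<Rightarrow> complex) \<Rightarrow> real \<Rightarrow> bool" where
  "piecewise_turning \<gamma> \<gamma>' I \<longleftrightarrow> piecewise_C1 \<gamma> \<gamma>' \<and> ((\<lambda>t. Re (\<gamma>' t) / Im (\<gamma> t)) has_integral I) {0..1}"

lemma C1_turning_imp_piecewise:
  assumes "C1_turning \<gamma> \<gamma>' I" shows "piecewise_turning \<gamma> \<gamma>' I"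
proof -
  have c: "C1_in_H2 \<gamma> \<gamma>'" using assms by (simp add: C1_turning_def)
  have "bounded (\<gamma>' ` {0..1})"
    using c by (intro compact_imp_bounded compact_continuous_image) (auto simp: C1_in_H2_def)
  moreover have "(\<gamma> has_vector_derivative \<gamma>' t) (at t)" if t: "t \<in> {0<..<1}" for t
  proof -
    have "at t within {0..1} = at t" by (rule at_within_interior) (use t in auto)
    then show ?thesis using c t by (metis C1_in_H2_def atLeastAtMost_iff greaterThanLessThan_iff less_imp_le)
  qed
  ultimately show ?thesis
    using assms C1_in_H2_continuous[OF c] unfolding piecewise_turning_def piecewise_C1_def C1_turning_def by (auto intro!: exI[of _ "{}"])
qed

lemma piecewise_turning_join:
  assumes 1: "piecewise_turning \<gamma>1 \<gamma>1' I1" and 2: "piecewise_turning \<gamma>2 \<gamma>2' I2" and eq: "\<gamma>1 1 = \<gamma>2 0"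
  shows "piecewise_turning (\<gamma>1 +++ \<gamma>2) (\<lambda>t. if t \<le> 1 / 2 then 2 * \<gamma>1' (2 * t) else 2 * \<gamma>2' (2 * t - 1)) (I1 + I2)"
proof -
  let ?L = "\<gamma>1 +++ \<gamma>2"
  let ?D = "\<lambda>t. if t \<le> 1 / 2 then 2 * \<gamma>1' (2 * t) else 2 * \<gamma>2' (2 * t - 1)"
  obtain S1 where S1: "finite S1" "\<And>t. t \<in> {0<..<1} - S1 \<Longrightarrow> (\<gamma>1 has_vector_derivative \<gamma>1' t) (at t)"
    using 1 unfolding piecewise_turning_def piecewise_C1_def by blast
  obtain S2 where S2: "finite S2" "\<And>t. t \<in> {0<..<1} - S2 \<Longrightarrow> (\<gamma>2 has_vector_derivative \<gamma>2' t) (at t)"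
    using 2 unfolding piecewise_turning_def piecewise_C1_def by blast
  obtain B1 where B1: "\<And>t. t \<in> {0..1} \<Longrightarrow> cmod (\<gamma>1' t) \<le> B1" using 1 unfolding piecewise_turning_def piecewise_C1_def bounded_iff by blast
  obtain B2 where B2: "\<And>t. t \<in> {0..1} \<Longrightarrow> cmod (\<gamma>2' t) \<le> B2" using 2 unfolding piecewise_turning_def piecewise_C1_def bounded_iff by blast
  have "path ?L" using 1 2 eq by (intro path_join_imp) (auto simp: piecewise_turning_def piecewise_C1_def path_def pathstart_def pathfinish_def)
  then have cont: "continuous_on {0..1} ?L" by (simp add: path_def)
  have bdd: "cmod (?D t) \<le> 2 * max B1 B2" if "t \<in> {0..1}" for t
    using B1[of "2 * t"] B2[of "2 * t - 1"] that by (auto simp: norm_mult)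
  let ?S = "(\<lambda>x. x / 2) ` S1 \<union> (\<lambda>x. (x + 1) / 2) ` S2 \<union> {1 / 2}"
  have der: "(?L has_vector_derivative ?D t) (at t)" if t: "t \<in> {0<..<1} - ?S" for t
  proof (cases "t < 1 / 2")
    case True
    have "2 * t \<notin> S1"
    proof
      assume "2 * t \<in> S1"
      then have "2 * t / 2 \<in> ?S" by blast
      then show False using t by simp
    qed
    then have "(\<gamma>1 has_vector_derivative \<gamma>1' (2 * t)) (at (2 * t))" using t True by (intro S1(2)) auto
    moreover have "((\<lambda>t. 2 * t) has_vector_derivative 2) (at t)" by (auto intro!: derivative_eq_intros)
    ultimately have "((\<lambda>t. \<gamma>1 (2 * t)) has_vector_derivative ?D t) (at t)"
      using vector_diff_chain_at[of "\<lambda>t. 2 * t" 2 t \<gamma>1] True by (simp add: o_def scaleR_conv_of_real)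
    then show ?thesis
      by (rule has_vector_derivative_transform_within_open[of _ _ _ "{..<1/2}"]) (use True in \<open>auto simp: joinpaths_def\<close>)
  next
    case False
    then have t2: "t > 1 / 2" using t by (cases "t = 1 / 2") auto
    have "2 * t - 1 \<notin> S2"
    proof
      assume "2 * t - 1 \<in> S2"
      then have "(2 * t - 1 + 1) / 2 \<in> ?S" by blast
      then show False using t by simp
    qed
    then have "(\<gamma>2 has_vector_derivative \<gamma>2' (2 * t - 1)) (at (2 * t - 1))" using t t2 by (intro S2(2)) auto
    moreover have "((\<lambda>t. 2 * t - 1) has_vector_derivative 2) (at t)" by (auto intro!: derivative_eq_intros)
    ultimately have "((\<lambda>t. \<gamma>2 (2 * t - 1)) has_vector_derivative ?D t) (at t)"
      using vector_diff_chain_at[of "\<lambda>t. 2 * t - 1" 2 t \<gamma>2] t2 by (simp add: o_def scaleR_conv_of_real)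
    then show ?thesis
      by (rule has_vector_derivative_transform_within_open[of _ _ _ "{1/2<..}"]) (use t2 in \<open>auto simp: joinpaths_def\<close>)
  qed
  have pw: "piecewise_C1 ?L ?D"
    unfolding piecewise_C1_def
  proof (intro conjI exI ballI)
    show "bounded (?D ` {0..1})" unfolding bounded_iff using bdd by blast
    show "finite ?S" using S1 S2 by auto
  qed (fact cont, fact der)
  let ?f1 = "\<lambda>t. Re (\<gamma>1' t) / Im (\<gamma>1 t)" and ?f2 = "\<lambda>t. Re (\<gamma>2' t) / Im (\<gamma>2 t)"
  let ?F = "\<lambda>t. Re (?D t) / Im (?L t)"
  have f: "(?f1 has_integral I1) (cbox 0 1)" "(?f2 has_integral I2) (cbox 0 1)"
    using 1 2 by (simp_all add: piecewise_turning_def cbox_interval)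
  have "((\<lambda>x. ?f1 (2 *\<^sub>R x + 0)) has_integral (1 / \<bar>2\<bar> ^ DIM(real)) *\<^sub>R I1) ((\<lambda>x. (1 / 2) *\<^sub>R x + - ((1 / 2) *\<^sub>R 0)) ` cbox 0 1)"
    by (rule has_integral_affinity[OF f(1)]) simp
  moreover have "(\<lambda>x. (1 / 2) *\<^sub>R x + - ((1 / 2) *\<^sub>R 0)) ` cbox 0 1 = {0..1 / 2::real}"
    by (simp add: image_affinity_cbox cbox_interval del: mult_zero_right)
  ultimately have "((\<lambda>x. 2 * ?f1 (2 * x)) has_integral I1) {0..1 / 2}"
    using has_integral_mult_right[of "\<lambda>x. ?f1 (2 * x)" "I1 / 2" "{0..1/2}" 2] by simp
  then have a: "(?F has_integral I1) {0..1 / 2}"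
    by (rule has_integral_eq[rotated]) (auto simp: joinpaths_def)
  have "((\<lambda>x. ?f2 (2 *\<^sub>R x + - 1)) has_integral (1 / \<bar>2\<bar> ^ DIM(real)) *\<^sub>R I2) ((\<lambda>x. (1 / 2) *\<^sub>R x + - ((1 / 2) *\<^sub>R - 1)) ` cbox 0 1)"
    by (rule has_integral_affinity[OF f(2)]) simp
  moreover have "(\<lambda>x. (1 / 2) *\<^sub>R x + - ((1 / 2) *\<^sub>R - 1)) ` cbox 0 1 = {1 / 2..1::real}"
    by (simp add: cbox_interval image_affinity_atLeastAtMost_div)
  ultimately have "((\<lambda>x. 2 * ?f2 (2 * x - 1)) has_integral I2) {1 / 2..1}"
    using has_integral_mult_right[of "\<lambda>x. ?f2 (2 * x - 1)" "I2 / 2" "{1/2..1}" 2] by simp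
  \<comment> \<open>At \<open>1 / 2\<close> the derivative is taken from the first curve.\<close>
  then have b: "(?F has_integral I2) {1 / 2..1}"
    by (rule has_integral_spike_finite[of "{1/2}", rotated 2]) (auto simp: joinpaths_def)
  have "(?F has_integral (I1 + I2)) {0..1}"
    by (rule has_integral_combine[OF _ _ a b]) auto
  then show ?thesis using pw by (simp add: piecewise_turning_def)
qed

lemma geodesic_edge:
  assumes "y \<in> H2" "z \<in> H2" "y \<noteq> z"
  obtains g d \<gamma>' where "0 < d" "act g (iaxis 0) = y" "act g (iaxis d) = z"
    "\<And>t. t \<in> {0..1} \<Longrightarrow> geodesic y z t = act g (iaxis (t * d))"
    "C1_turning (geodesic y z) \<gamma>' (turn g (iaxis 0) (iaxis d))"
proof -
  obtain g d where gd: "0 < d" "act g (iaxis 0) = y" "act g (iaxis d) = z" using ex_axis_isometry[OF assms] by blast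
  have eq: "geodesic y z t = act g (iaxis (t * d))" if "t \<in> {0..1}" for t
    by (rule geodesic_from_to_unique[OF gd geodesic_is_geodesic[OF assms] that])
  have "C1_turning (\<lambda>t. act g (iaxis (t * d))) (\<lambda>t. deriv (act g) (iaxis (t * d)) * (of_real d * iaxis (t * d)))
     (turn g (iaxis 0) (iaxis d))"
    using C1_turning_act[OF C1_turning_axis[of d], of g] by simp
  from C1_turning_cong[OF this eq] show thesis using that gd eq by blast
qed

text \<open>The preimage of the imaginary axis under a fractional linear map is given by an equation
\<open>a c |w|\<^sup>2 + (a e + b c) Re w + b e = 0\<close>. It is quadratic in the height if \<open>a c \<noteq> 0\<close>, and describes a single
vertical line otherwise.\<close>

lemma geodesic_slices:
  assumes "y \<in> H2" "z \<in> H2" "y \<noteq> z"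
  obtains E where "finite E" "\<And>x. x \<notin> E \<Longrightarrow> finite {s. Complex x s \<in> geodesic y z ` {0..1}}"
proof -
  obtain g d \<gamma>' where gd: "\<And>t. t \<in> {0..1} \<Longrightarrow> geodesic y z t = act g (iaxis (t * d))"
    using geodesic_edge[OF assms] by blast
  obtain A where A: "A \<in> SL2" "inverse g = abs_psl2 A" by (rule psl2_cases)
  define a b c e where "a = A$1$1" and "b = A$1$2" and "c = A$2$1" and "e = A$2$2"
  have eqn: "a * c * (x\<^sup>2 + s\<^sup>2) + (a * e + b * c) * x + b * e = 0" if in': "Complex x s \<in> geodesic y z ` {0..1}" for x s
  proof -
    let ?w = "Complex x s"
    obtain t where t: "t \<in> {0..1}" "?w = act g (iaxis (t * d))" using in' gd by auto
    have w: "?w \<in> H2" "act (inverse g) ?w = iaxis (t * d)"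
      unfolding t(2) by (auto intro: act_H2 iaxis_H2 act_inverse)
    have "of_real a * ?w + of_real b = iaxis (t * d) * denom A ?w"
      using act_num[OF A(1) w(1)] w(2) A(2) by (simp add: a_def b_def)
    then have "(of_real a * ?w + of_real b) * cnj (denom A ?w) = iaxis (t * d) * (denom A ?w * cnj (denom A ?w))" by simp
    also have "\<dots> = iaxis (t * d) * of_real ((cmod (denom A ?w))\<^sup>2)" by (simp only: complex_norm_square)
    finally have "Re ((of_real a * ?w + of_real b) * cnj (denom A ?w)) = 0" by simp
    then show ?thesis by (simp add: denom_def c_def[symmetric] e_def[symmetric] power2_eq_square algebra_simps)
  qed
  show thesis
  proof (cases "a * c = 0")
    case True
    have "a * e - b * c = 1" using SL2_det[OF A(1)] by (simp add: a_def b_def c_def e_def)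
    then have k: "a * e + b * c \<noteq> 0" using True by auto
    show thesis
    proof (rule that[of "{- (b * e) / (a * e + b * c)}"])
      fix x assume x: "x \<notin> {- (b * e) / (a * e + b * c)}"
      have "{s. Complex x s \<in> geodesic y z ` {0..1}} = {}"
      proof -
        have False if "Complex x s \<in> geodesic y z ` {0..1}" for s
        proof -
          have "(a * e + b * c) * x = - (b * e)" using eqn[OF that] True by simp
          then have "x = - (b * e) / (a * e + b * c)" using k by (metis nonzero_mult_div_cancel_left)
          then show False using x by simp
        qed
        then show ?thesis by blast
      qed
      then show "finite {s. Complex x s \<in> geodesic y z ` {0..1}}" by (metis finite.emptyI)
    qed simp
  next
    case False
    show thesis
    proof (rule that[of "{}"])
      fix x
      define K where "K = - ((a * e + b * c) * x + b * e) / (a * c) - x\<^sup>2"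
      have "s \<in> {sqrt K, - sqrt K}" if "Complex x s \<in> geodesic y z ` {0..1}" for s
      proof -
        have "s\<^sup>2 * (a * c) = - ((a * e + b * c) * x + b * e) - x\<^sup>2 * (a * c)" using eqn[OF that] by (simp add: algebra_simps)
        then have "s\<^sup>2 = K" using False unfolding K_def by (simp add: field_simps)
        then have "sqrt K = \<bar>s\<bar>" by (metis real_sqrt_abs)
        then show ?thesis by (auto simp: abs_if split: if_splits)
      qed
      then have "{s. Complex x s \<in> geodesic y z ` {0..1}} \<subseteq> {sqrt K, - sqrt K}" by blast
      then show "finite {s. Complex x s \<in> geodesic y z ` {0..1}}" by (rule finite_subset) simp
    qed simp
  qed
qed

text \<open>In the pentagon, \<open>\<alpha>\<close> and \<open>\<beta>\<close> each carry one side to another one with the opposite direction.\<close>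

lemma geodesic_reverse_act:
  assumes "y \<in> H2" "z \<in> H2" "y \<noteq> z" "t \<in> {0..1}"
  shows "geodesic (act g z) (act g y) t = act g (geodesic y z (1 - t))"
proof -
  let ?c = "\<lambda>t. act g (geodesic y z (1 - t))"
  have geo: "geodesic_from_to y z (geodesic y z)" by (rule geodesic_is_geodesic[OF assms(1-3)])
  have H: "geodesic y z t \<in> H2" if "t \<in> {0..1}" for t using geo that by (auto simp: geodesic_from_to_def)
  have c: "geodesic_from_to (act g z) (act g y) ?c"
    unfolding geodesic_from_to_def
  proof (intro conjI ballI)
    show "?c ` {0..1} \<subseteq> H2" using H act_H2 by auto
    show "?c 0 = act g z" "?c 1 = act g y" using geo by (auto simp: geodesic_from_to_def)
    fix s t :: real assume st: "s \<in> {0..1}" "t \<in> {0..1}"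
    have "hdist z y = hdist y z" by (simp add: hdist_def norm_minus_commute mult_ac)
    moreover have "hdist (geodesic y z (1 - s)) (geodesic y z (1 - t)) = \<bar>(1 - s) - (1 - t)\<bar> * hdist y z"
      using geo st by (auto simp: geodesic_from_to_def)
    ultimately show "hdist (?c s) (?c t) = \<bar>s - t\<bar> * hdist (act g z) (act g y)"
      using st assms by (simp add: hdist_act H abs_minus_commute)
  qed
  have ne: "act g z \<noteq> act g y" using act_inj assms by simp
  obtain h d where hd: "0 < d" "act h (iaxis 0) = act g z" "act h (iaxis d) = act g y"
    using ex_axis_isometry[OF act_H2[OF assms(2)] act_H2[OF assms(1)] ne] by metis
  have "geodesic (act g z) (act g y) t = act h (iaxis (t * d))"
    by (rule geodesic_from_to_unique[OF hd geodesic_is_geodesic[OF act_H2[OF assms(2)] act_H2[OF assms(1)] ne] assms(4)])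
  also have "\<dots> = ?c t" by (rule geodesic_from_to_unique[OF hd c assms(4), symmetric])
  finally show ?thesis .
qed

text \<open>The numbers \<open>I1\<close> and \<open>I4\<close>, the integrals over the second and the fifth side, cancel against the
integrals over their reversed images under \<open>\<alpha>\<close> and \<open>\<beta>\<close>.\<close>

theorem pentagon_turn:
  assumes p: "p \<in> H2" and nd: "pentagon_nondegenerate \<alpha> \<beta> p"
  defines "q \<equiv> act (inverse \<alpha> * inverse \<beta> * \<alpha> * \<beta>) p"
  obtains L' g d E where "0 < d" "act g (iaxis 0) = p" "act g (iaxis d) = q"
    "piecewise_turning (pentagon \<alpha> \<beta> p) L' (turn g (iaxis 0) (iaxis d)
        + turn \<beta> p (act (inverse \<beta> * \<alpha> * \<beta>) p) + turn \<alpha> (act \<beta> p) q)"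
    "finite E" "\<And>x. x \<notin> E \<Longrightarrow> finite {s. Complex x s \<in> pentagon \<alpha> \<beta> p ` {0..1}}"
proof -
  define v2 where "v2 = act \<beta> p"
  define v3 where "v3 = act (\<alpha> * \<beta>) p"
  define v4 where "v4 = act (inverse \<beta> * \<alpha> * \<beta>) p"
  have V: "pentagon_vertices \<alpha> \<beta> p = [p, q, v2, v3, v4]"
    by (simp add: pentagon_vertices_def q_def v2_def v3_def v4_def)
  have H: "q \<in> H2" "v2 \<in> H2" "v3 \<in> H2" "v4 \<in> H2"
    by (simp_all add: q_def v2_def v3_def v4_def act_H2[OF p])
  have nz: "hdist ([p, q, v2, v3, v4] ! i) ([p, q, v2, v3, v4] ! (Suc i mod 5)) \<noteq> 0" if "i < 5" for i
    using nd that by (simp add: pentagon_nondegenerate_def V Let_def)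
  have ne: "p \<noteq> q" "q \<noteq> v2" "v2 \<noteq> v3" "v3 \<noteq> v4" "v4 \<noteq> p"
  proof -
    have "hdist p q \<noteq> 0" "hdist q v2 \<noteq> 0" "hdist v2 v3 \<noteq> 0" "hdist v3 v4 \<noteq> 0" "hdist v4 p \<noteq> 0"
      using nz[of 0] nz[of 1] nz[of 2] nz[of 3] nz[of 4] by simp_all
    then show "p \<noteq> q" "q \<noteq> v2" "v2 \<noteq> v3" "v3 \<noteq> v4" "v4 \<noteq> p"
      using hdist_eq_0_iff p H by blast+
  qed
  have rel: "act \<alpha> v2 = v3" "act \<alpha> q = v4" "act \<beta> p = v2" "act \<beta> v4 = v3"
  proof -
    show "act \<alpha> v2 = v3" "act \<beta> p = v2" by (simp_all add: v2_def v3_def act_mult[OF p])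
    have "\<alpha> * (inverse \<alpha> * inverse \<beta> * \<alpha> * \<beta>) = inverse \<beta> * \<alpha> * \<beta>"
      by (simp add: mult.assoc[symmetric] psl2_inverse)
    then show "act \<alpha> q = v4" unfolding q_def v4_def by (simp add: act_mult[OF p, symmetric])
    have "\<beta> * (inverse \<beta> * \<alpha> * \<beta>) = \<alpha> * \<beta>" by (simp add: mult.assoc[symmetric] psl2_inverse)
    then show "act \<beta> v4 = v3" unfolding v3_def v4_def by (simp add: act_mult[OF p, symmetric])
  qed
  obtain g d e0' where e0: "0 < d" "act g (iaxis 0) = p" "act g (iaxis d) = q" "C1_turning (geodesic p q) e0' (turn g (iaxis 0) (iaxis d))"
    using geodesic_edge[OF p H(1) ne(1)] by metis
  obtain I1 e1' where e1: "C1_turning (geodesic q v2) e1' I1" using geodesic_edge[OF H(1,2) ne(2)] by metis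
  obtain I4 e4' where e4: "C1_turning (geodesic v4 p) e4' I4" using geodesic_edge[OF H(4) p ne(5)] by metis
  have ends: "geodesic y z 0 = y \<and> geodesic y z 1 = z" if "y \<in> H2" "z \<in> H2" "y \<noteq> z" for y z
    using geodesic_is_geodesic[OF that] by (simp add: geodesic_from_to_def)
  note E = ends[OF p H(1) ne(1)] ends[OF H(1,2) ne(2)] ends[OF H(2,3) ne(3)] ends[OF H(3,4) ne(4)] ends[OF H(4) p ne(5)]
  obtain e3' where e3: "C1_turning (geodesic v3 v4) e3' (- I1 + turn \<alpha> v2 q)"
  proof -
    have "C1_turning (geodesic v3 v4) (\<lambda>t. deriv (act \<alpha>) (geodesic q v2 (1 - t)) * - e1' (1 - t)) (- I1 + turn \<alpha> v2 q)"
      by (rule C1_turning_cong[OF C1_turning_act[OF C1_turning_reverse[OF e1], of \<alpha>, unfolded diff_0_right diff_self conjunct1[OF E(2)] conjunct2[OF E(2)]]])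
        (use geodesic_reverse_act[OF H(1,2) ne(2), of _ \<alpha>] rel in simp)
    then show thesis by (rule that)
  qed
  obtain e2' where e2: "C1_turning (geodesic v2 v3) e2' (- I4 + turn \<beta> p v4)"
  proof -
    have "C1_turning (geodesic v2 v3) (\<lambda>t. deriv (act \<beta>) (geodesic v4 p (1 - t)) * - e4' (1 - t)) (- I4 + turn \<beta> p v4)"
      by (rule C1_turning_cong[OF C1_turning_act[OF C1_turning_reverse[OF e4], of \<beta>, unfolded diff_0_right diff_self conjunct1[OF E(5)] conjunct2[OF E(5)]]])
        (use geodesic_reverse_act[OF H(4) p ne(5), of _ \<beta>] rel in simp)
    then show thesis by (rule that)
  qed
  have P: "pentagon \<alpha> \<beta> p = geodesic p q +++ geodesic q v2 +++ geodesic v2 v3 +++ geodesic v3 v4 +++ geodesic v4 p"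
    by (simp add: pentagon_def V Let_def eval_nat_numeral)
  have j0: "(\<gamma>1 +++ \<gamma>2) 0 = \<gamma>1 0" for \<gamma>1 \<gamma>2 :: "real \<Rightarrow> complex" by (simp add: joinpaths_def)
  obtain L' where L': "piecewise_turning (pentagon \<alpha> \<beta> p) L' (turn g (iaxis 0) (iaxis d) + (I1 + ((- I4 + turn \<beta> p v4) + ((- I1 + turn \<alpha> v2 q) + I4))))"
    unfolding P
    using piecewise_turning_join[OF C1_turning_imp_piecewise[OF e0(4)] piecewise_turning_join[OF C1_turning_imp_piecewise[OF e1]
        piecewise_turning_join[OF C1_turning_imp_piecewise[OF e2] piecewise_turning_join[OF C1_turning_imp_piecewise[OF e3] C1_turning_imp_piecewise[OF e4]]]]]
      E unfolding j0 by metis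
  have PI: "pentagon \<alpha> \<beta> p ` {0..1} = geodesic p q ` {0..1} \<union> geodesic q v2 ` {0..1} \<union> geodesic v2 v3 ` {0..1}
      \<union> geodesic v3 v4 ` {0..1} \<union> geodesic v4 p ` {0..1}"
    using E unfolding P path_image_def[symmetric]
    by (simp add: path_image_join pathstart_def pathfinish_def j0 Un_assoc)
  obtain E0 where E0: "finite E0" "\<And>x. x \<notin> E0 \<Longrightarrow> finite {s. Complex x s \<in> geodesic p q ` {0..1}}" using geodesic_slices[OF p H(1) ne(1)] by blast
  obtain E1 where E1: "finite E1" "\<And>x. x \<notin> E1 \<Longrightarrow> finite {s. Complex x s \<in> geodesic q v2 ` {0..1}}" using geodesic_slices[OF H(1,2) ne(2)] by blast
  obtain E2 where E2: "finite E2" "\<And>x. x \<notin> E2 \<Longrightarrow> finite {s. Complex x s \<in> geodesic v2 v3 ` {0..1}}" using geodesic_slices[OF H(2,3) ne(3)] by blast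
  obtain E3 where E3: "finite E3" "\<And>x. x \<notin> E3 \<Longrightarrow> finite {s. Complex x s \<in> geodesic v3 v4 ` {0..1}}" using geodesic_slices[OF H(3,4) ne(4)] by blast
  obtain E4 where E4: "finite E4" "\<And>x. x \<notin> E4 \<Longrightarrow> finite {s. Complex x s \<in> geodesic v4 p ` {0..1}}" using geodesic_slices[OF H(4) p ne(5)] by blast
  show thesis
  proof (rule that[OF e0(1-3)])
    show "piecewise_turning (pentagon \<alpha> \<beta> p) L' (turn g (iaxis 0) (iaxis d) + turn \<beta> p (act (inverse \<beta> * \<alpha> * \<beta>) p) + turn \<alpha> (act \<beta> p) q)"
      using L' by (simp add: v4_def v2_def add_ac)
    show "finite (E0 \<union> E1 \<union> E2 \<union> E3 \<union> E4)" using E0 E1 E2 E3 E4 by simp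
    fix x assume "x \<notin> E0 \<union> E1 \<union> E2 \<union> E3 \<union> E4"
    then show "finite {s. Complex x s \<in> pentagon \<alpha> \<beta> p ` {0..1}}"
      unfolding PI Un_iff Collect_disj_eq using E0 E1 E2 E3 E4 by simp
  qed
qed

theorem proposition3p7:
  fixes \<alpha> \<beta> :: psl2 and p :: complex and A B :: psl2_cover and f :: "complex \<Rightarrow> complex"
  assumes "p \<in> H2"
    and "cover_proj A = \<alpha>" and "cover_proj B = \<beta>"
    and "pentagon_nondegenerate \<alpha> \<beta> p"
    and "immersed_disc f" and "disc_boundary f (pentagon \<alpha> \<beta> p)"
  shows "Tw (comm (inverse A) (inverse B)) p = signed_area f"
proof (rule pentagon_turn[OF assms(1,4)])
  fix L' g d E
  assume L: "0 < d" "act g (iaxis 0) = p" "act g (iaxis d) = act (inverse \<alpha> * inverse \<beta> * \<alpha> * \<beta>) p"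
    "piecewise_turning (pentagon \<alpha> \<beta> p) L' (turn g (iaxis 0) (iaxis d)
        + turn \<beta> p (act (inverse \<beta> * \<alpha> * \<beta>) p)
        + turn \<alpha> (act \<beta> p) (act (inverse \<alpha> * inverse \<beta> * \<alpha> * \<beta>) p))"
    "finite E" "\<And>x. x \<notin> E \<Longrightarrow> finite {s. Complex x s \<in> pentagon \<alpha> \<beta> p ` {0..1}}"
  obtain \<phi> where \<phi>: "continuous_on {0..1} \<phi>" "strict_mono_on {0..1} \<phi>" "\<phi> 0 = 0" "\<phi> 1 = 1"
    "\<And>t. t \<in> {0..1} \<Longrightarrow> f (cis (2 * pi * t)) = pentagon \<alpha> \<beta> p (\<phi> t)"
    using assms(6) unfolding disc_boundary_def by blast
  have "signed_area f = integral {0..1} (\<lambda>t. Re (L' t) / Im (pentagon \<alpha> \<beta> p t))"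
    by (rule area_eq_boundary_integral[OF assms(5) _ \<phi>(1) strict_mono_on_imp_mono_on[OF \<phi>(2)] \<phi>(3-5) L(5,6)])
      (use L(4) in \<open>simp_all add: piecewise_turning_def\<close>)
  also have "\<dots> = Tw (comm (inverse A) (inverse B)) p"
    unfolding Tw_commutator[OF assms(1-3) refl L(1-3)]
    using L(4) by (intro integral_unique) (simp add: piecewise_turning_def)
  finally show "Tw (comm (inverse A) (inverse B)) p = signed_area f" by simp
qed

end
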